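(* Let $\widehat{\mathscr{N}}$ be the operator network (DeepONet) learned via a given learning algorithm, and define its generalization gap by $$\mathscr{E}_{gen}=\mathbb{E}\left|\widehat{\mathscr{E}}(\widehat{\mathscr{N}})-\mathscr{E}_{N,J}(\widehat{\mathscr{N}})\right| .$$ Assume that $\mathscr{G}$ is Lipschitz continuous and that the following two assumptions hold for the operator network $\mathscr{N}=\widehat{\mathscr{N}}$: (A1) there exists $q\in[4,+\infty)$ such that $\mathbb{E}_{f\sim\mu}\|\mathscr{G}(f)-\mathscr{N}(f)\|_{L^2}^q\lesssim 1$; (A2) there exists an operator $\widetilde{\mathscr{N}}:L^2([0,1])\to C^1([0,1])$ such that for any $x\in[0,1]$ $$\mathbb{E}_{f\sim\mu}|\mathscr{N}(f)(x)-\widetilde{\mathscr{N}}(f)(x)|^2\lesssim \frac{1}{N^{1/2}}\quad\text{and}\quad \mathbb{E}_{f\sim\mu}\left|\frac{d}{dx}\big(\mathscr{G}(f)(x)-\widetilde{\mathscr{N}}(f)(x)\big)^2\right|\lesssim 1+\varepsilon^{-1}e^{-\alpha(1-x)/\varepsilon}.$$ Then $$\mathscr{E}_{gen}=\mathbb{E}\left|\widehat{\mathscr{E}}(\widehat{\mathscr{N}})-\mathscr{E}_{N,J}(\widehat{\mathscr{N}})\right|\lesssim\frac{1}{N^{1/4}}+\frac{\sqrt{\ln J}}{J^{1/2}}.$$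
   Context: **Solution operator.** Let $a,b$ be sufficiently differentiable functions on $[0,1]$ with $a(x)\ge\alpha>0$, and let $\varepsilon>0$ be a small parameter. The operator $\mathscr{G}:L^2([0,1])\to L^2([0,1])$, $f\mapsto u$, is the solution operator of $-\varepsilon u''+a u'+b u=f$ on $(0,1)$, $u(0)=u(1)=0$, in weak form: $u\in H_0^1(0,1)$ and $\varepsilon\int_0^1u'v'\,dx+\int_0^1 a u'v\,dx+\int_0^1 b uv\,dx=\int_0^1 fv\,dx$ for all $v\in H_0^1(0,1)$. **Measure.** For $l>0$, $\mu$ is the centred Gaussian measure on $L^2([0,1])$ whose covariance operator is the integral operator with kernel $\sum_{n\in\mathbb{Z}}\exp(-|x_1-x_2-n|^2/(2l^2))$. **Operator network.** A DeepONet is an operator $\mathscr{R}\circ\mathscr{A}\circ\mathscr{E}$, where $\mathscr{E}(f)=(f(x_1),\dots,f(x_m))$ for fixed points $x_i\in[0,1]$ (extended to a Borel measurable map on $L^2([0,1])$), $\mathscr{A}:\mathbb{R}^m\to\mathbb{R}^p$ is a neural network, and $\mathscr{R}(\alpha_1,\dots,\alpha_p)=\tau_0+\sum_{k=1}^p\alpha_k\tau_k$ for a neural network $(\tau_0,\dots,\tau_p):\mathbb{R}\to\mathbb{R}^{p+1}$. A neural network is an alternating composition of affine maps and a componentwise activation function. **Shishkin mesh.** For even $J$ let $\sigma=\min\{1/2,\,2\varepsilon\ln J/\alpha\}$, $h=2(1-\sigma)/J$, $H=2\sigma/J$, and $y_j=jh$ for $0\le j\le J/2$, $y_j=1-\sigma+(j-J/2)H$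 for $J/2\le j\le J$. Weights: $\omega_0=0$, $\omega_j=h$ for $1\le j\le J/2$, $\omega_j=H$ for $J/2<j\le J$. **Errors.** For an operator $\mathscr{N}$, the approximation error is $\widehat{\mathscr{E}}(\mathscr{N})=\big(\int_{L^2([0,1])}\|\mathscr{G}(f)-\mathscr{N}(f)\|_{L^2([0,1])}^2\,d\mu(f)\big)^{1/2}$, and, with samples $F_1,\dots,F_N$ drawn i.i.d. from $\mu$, the empirical risk is $\mathscr{E}_{N,J}(\mathscr{N})=\big(\frac1N\sum_{n=1}^N\sum_{j=0}^J\omega_j|\mathscr{G}(F_n)(y_j)-\mathscr{N}(F_n)(y_j)|^2\big)^{1/2}$. The expectation $\mathbb{E}$ without subscript is with respect to the random samples. **Constants.** $X\lesssim Y$ means $X\le CY$ with a constant $C$ independent of parameters such as $N,J,m,p,\varepsilon,l$.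
   Formalization: The learned network may be random, but what it is learned from is assumed independent of the samples F_1,…,F_N in the empirical risk; without this the claim fails, since a DeepONet interpolating those samples in tiny neighbourhoods satisfies (A1) and (A2) with a non-vanishing gap. *)

theory Defs
  imports "HOL-Probability.Probability"
begin

section \<open>The Hilbert space of square-integrable functions on the unit interval\<close>

abbreviation I01 :: "real measure" where
  "I01 \<equiv> lebesgue_on {0..1}"

definition sq_integrable :: "(real \<Rightarrow> real) \<Rightarrow> bool" where
  "sq_integrable f \<longleftrightarrow> f \<in> borel_measurable I01 \<and> integrable I01 (\<lambda>x. (f x)\<^sup>2)"

definition l2rel :: "(real \<Rightarrow> real) \<Rightarrow> (real \<Rightarrow> real) \<Rightarrow> bool" where
  "l2rel f g \<longleftrightarrow> sq_integrable f \<and> sq_integrable g \<and> (AE x in I01. f x = g x)"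

lemma sq_integrable_zero: "sq_integrable (\<lambda>_. 0)"
  by (simp add: sq_integrable_def)

lemma sq_integrable_mult:
  assumes "sq_integrable f" "sq_integrable g"
  shows "integrable I01 (\<lambda>x. f x * g x)"
proof (rule Bochner_Integration.integrable_bound)
  show "integrable I01 (\<lambda>x. (f x)\<^sup>2 + (g x)\<^sup>2)"
    using assms by (auto simp: sq_integrable_def)
  show "(\<lambda>x. f x * g x) \<in> borel_measurable I01"
    using assms by (auto simp: sq_integrable_def)
  have "\<bar>y * z\<bar> \<le> y\<^sup>2 + z\<^sup>2" for y z :: real
  proof -
    have "0 \<le> (\<bar>y\<bar> - \<bar>z\<bar>)\<^sup>2" by simp
    then have "2 * (\<bar>y\<bar> * \<bar>z\<bar>) \<le> y\<^sup>2 + z\<^sup>2"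
      by (simp add: power2_diff)
    moreover have "0 \<le> \<bar>y\<bar> * \<bar>z\<bar>" by simp
    ultimately show ?thesis unfolding abs_mult by linarith
  qed
  then show "AE x in I01. norm (f x * g x) \<le> norm ((f x)\<^sup>2 + (g x)\<^sup>2)"
    by (intro AE_I2) simp
qed

lemma sq_integrable_add:
  assumes "sq_integrable f" "sq_integrable g"
  shows "sq_integrable (\<lambda>x. f x + g x)"
proof -
  have "integrable I01 (\<lambda>x. (f x)\<^sup>2 + (g x)\<^sup>2 + 2 * (f x * g x))"
    using assms sq_integrable_mult[OF assms] by (auto simp: sq_integrable_def)
  also have "(\<lambda>x. (f x)\<^sup>2 + (g x)\<^sup>2 + 2 * (f x * g x)) = (\<lambda>x. (f x + g x)\<^sup>2)"
    by (auto simp: power2_sum)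
  finally show ?thesis
    using assms by (auto simp: sq_integrable_def)
qed

lemma sq_integrable_scale: "sq_integrable f \<Longrightarrow> sq_integrable (\<lambda>x. c * f x)"
  by (auto simp: sq_integrable_def power_mult_distrib)

lemma sq_integrable_uminus: "sq_integrable f \<Longrightarrow> sq_integrable (\<lambda>x. - f x)"
  by (simp add: sq_integrable_def)

lemma sq_integrable_diff:
  "sq_integrable f \<Longrightarrow> sq_integrable g \<Longrightarrow> sq_integrable (\<lambda>x. f x - g x)"
  using sq_integrable_add[OF _ sq_integrable_uminus, of f g] by simp

quotient_type l2 = "real \<Rightarrow> real" / partial: l2rel
proof (rule part_equivpI)
  show "\<exists>f. l2rel f f"
    using sq_integrable_zero by (auto simp: l2rel_def)
  show "symp l2rel"
    by (auto simp: symp_def l2rel_def eq_commute)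
  show "transp l2rel"
  proof (rule transpI)
    fix f g h assume fg: "l2rel f g" and gh: "l2rel g h"
    have "AE x in I01. f x = g x" "AE x in I01. g x = h x"
      using fg gh by (simp_all add: l2rel_def)
    then have "AE x in I01. f x = h x"
      by eventually_elim simp
    then show "l2rel f h"
      using fg gh by (simp add: l2rel_def)
  qed
qed

instantiation l2 :: real_inner
begin

lift_definition zero_l2 :: l2 is "\<lambda>_. 0"
  by (simp add: l2rel_def sq_integrable_zero)

lift_definition plus_l2 :: "l2 \<Rightarrow> l2 \<Rightarrow> l2" is "\<lambda>f g x. f x + g x"
  by (auto simp: l2rel_def intro: sq_integrable_add)

lift_definition uminus_l2 :: "l2 \<Rightarrow> l2" is "\<lambda>f x. - f x"
  by (auto simp: l2rel_def intro: sq_integrable_uminus)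

lift_definition minus_l2 :: "l2 \<Rightarrow> l2 \<Rightarrow> l2" is "\<lambda>f g x. f x - g x"
  by (auto simp: l2rel_def intro: sq_integrable_diff)

lift_definition scaleR_l2 :: "real \<Rightarrow> l2 \<Rightarrow> l2" is "\<lambda>c f x. c * f x"
  by (auto simp: l2rel_def intro: sq_integrable_scale)

lift_definition inner_l2 :: "l2 \<Rightarrow> l2 \<Rightarrow> real" is "\<lambda>f g. LINT x|I01. f x * g x"
proof (rule integral_cong_AE)
  fix f f' g g' assume f: "l2rel f f'" and g: "l2rel g g'"
  show "(\<lambda>x. f x * g x) \<in> borel_measurable I01" "(\<lambda>x. f' x * g' x) \<in> borel_measurable I01"
    using f g by (auto simp: l2rel_def sq_integrable_def)
  have "AE x in I01. f x = f' x" "AE x in I01. g x = g' x"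
    using f g by (simp_all add: l2rel_def)
  then show "AE x in I01. f x * g x = f' x * g' x"
    by eventually_elim simp
qed

definition norm_l2 :: "l2 \<Rightarrow> real" where
  "norm_l2 u = sqrt (inner u u)"

definition sgn_l2 :: "l2 \<Rightarrow> l2" where
  "sgn_l2 u = inverse (norm u) *\<^sub>R u"

definition dist_l2 :: "l2 \<Rightarrow> l2 \<Rightarrow> real" where
  "dist_l2 u v = norm (u - v)"

definition uniformity_l2 :: "(l2 \<times> l2) filter" where
  "uniformity_l2 = (INF e\<in>{0<..}. principal {(u, v). dist u v < e})"

definition open_l2 :: "l2 set \<Rightarrow> bool" where
  "open_l2 U \<longleftrightarrow> (\<forall>u\<in>U. \<forall>\<^sub>F (u', v) in uniformity. u' = u \<longrightarrow> v \<in> U)"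

instance
proof
  fix u v w :: l2 and r s :: real
  show "u + v + w = u + (v + w)"
    by transfer (auto simp: l2rel_def add.assoc intro!: sq_integrable_add)
  show "u + v = v + u"
    by transfer (auto simp: l2rel_def add.commute intro!: sq_integrable_add)
  show "0 + u = u"
    by transfer (auto simp: l2rel_def)
  show "- u + u = 0"
    by transfer (auto simp: l2rel_def sq_integrable_zero)
  show "u - v = u + - v"
    by transfer (auto simp: l2rel_def intro!: sq_integrable_diff)
  show "r *\<^sub>R (u + v) = r *\<^sub>R u + r *\<^sub>R v"
    by transfer (auto simp: l2rel_def algebra_simps intro!: sq_integrable_add sq_integrable_scale)
  show "(r + s) *\<^sub>R u = r *\<^sub>R u + s *\<^sub>R u"
    by transfer (auto simp: l2rel_def algebra_simps intro!: sq_integrable_add sq_integrable_scale)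
  show "r *\<^sub>R s *\<^sub>R u = (r * s) *\<^sub>R u"
    by transfer (auto simp: l2rel_def algebra_simps intro!: sq_integrable_scale)
  show "1 *\<^sub>R u = u"
    by transfer (auto simp: l2rel_def)
  show "dist u v = norm (u - v)"
    by (rule dist_l2_def)
  show "sgn u = inverse (norm u) *\<^sub>R u"
    by (rule sgn_l2_def)
  show "uniformity = (INF e\<in>{0<..}. principal {(x::l2, y). dist x y < e})"
    by (rule uniformity_l2_def)
  show "open U \<longleftrightarrow> (\<forall>x\<in>U. \<forall>\<^sub>F (x', y) in uniformity. x' = x \<longrightarrow> y \<in> U)" for U :: "l2 set"
    by (rule open_l2_def)
  show "inner u v = inner v u"
    by transfer (simp add: mult.commute)
  show "inner (u + v) w = inner u w + inner v w"
    by transfer (auto simp: l2rel_def distrib_right sq_integrable_mult)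
  show "inner (r *\<^sub>R u) v = r * inner u v"
    by transfer (auto simp: l2rel_def mult.assoc)
  show "0 \<le> inner u u"
    by transfer simp
  show "inner u u = 0 \<longleftrightarrow> u = 0"
    by transfer
       (auto simp: l2rel_def sq_integrable_def integral_nonneg_eq_0_iff_AE simp flip: power2_eq_square)
  show "norm u = sqrt (inner u u)"
    by (rule norm_l2_def)
qed

end

text \<open>\<open>l2_class f\<close> is the class of a square-integrable function \<open>f\<close> and is unspecified for other
  functions; \<open>l2_fun u\<close> is an arbitrary representative of \<open>u\<close>.\<close>

abbreviation l2_class :: "(real \<Rightarrow> real) \<Rightarrow> l2" where
  "l2_class \<equiv> abs_l2"

abbreviation l2_fun :: "l2 \<Rightarrow> real \<Rightarrow> real" where
  "l2_fun \<equiv> rep_l2"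

definition represents :: "(real \<Rightarrow> real) \<Rightarrow> l2 \<Rightarrow> bool" where
  "represents g u \<longleftrightarrow> sq_integrable g \<and> l2_class g = u"

text \<open>The continuous representative, which is unique on the unit interval when it exists; it gives
  the meaning of point values of elements of \<open>l2\<close>.\<close>

definition cont_rep :: "l2 \<Rightarrow> real \<Rightarrow> real" where
  "cont_rep u = (SOME g. continuous_on {0..1} g \<and> represents g u)"

section \<open>The boundary value problem\<close>

definition test_function :: "(real \<Rightarrow> real) \<Rightarrow> bool" where
  "test_function \<phi> \<longleftrightarrow>
     (\<forall>k x. (deriv ^^ k) \<phi> field_differentiable at x) \<and>
     (\<exists>S. compact S \<and> S \<subseteq> {0<..<1} \<and> (\<forall>x. x \<notin> S \<longrightarrow> \<phi> x = 0))"

text \<open>\<open>H01\<close> is the space $H^1_0(0,1)$, the closure of the test functions in the $H^1$ norm.  Each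
  element is recorded together with its weak derivative, so that the closure is taken in
  \<open>l2 \<times> l2\<close>.\<close>

definition H01 :: "(l2 \<times> l2) set" where
  "H01 = closure {(l2_class \<phi>, l2_class (deriv \<phi>)) | \<phi>. test_function \<phi>}"

definition weak_solution ::
  "real \<Rightarrow> (real \<Rightarrow> real) \<Rightarrow> (real \<Rightarrow> real) \<Rightarrow> l2 \<Rightarrow> l2 \<Rightarrow> bool" where
  "weak_solution \<epsilon> a b f u \<longleftrightarrow>
     (\<exists>u'. (u, u') \<in> H01 \<and>
       (\<forall>(v, v') \<in> H01.
          \<epsilon> * inner u' v'
            + (LINT x|I01. a x * l2_fun u' x * l2_fun v x)
            + (LINT x|I01. b x * l2_fun u x * l2_fun v x)
          = inner f v))"

text \<open>Unique solvability is part of the notion of a solution operator.\<close>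

definition solution_operator ::
  "real \<Rightarrow> (real \<Rightarrow> real) \<Rightarrow> (real \<Rightarrow> real) \<Rightarrow> (l2 \<Rightarrow> l2) \<Rightarrow> bool" where
  "solution_operator \<epsilon> a b G \<longleftrightarrow> (\<forall>f u. weak_solution \<epsilon> a b f u \<longleftrightarrow> u = G f)"

definition C1_unit :: "(real \<Rightarrow> real) \<Rightarrow> bool" where
  "C1_unit g \<longleftrightarrow>
     (\<exists>g'. continuous_on {0..1} g' \<and>
       (\<forall>x\<in>{0..1}. (g has_real_derivative g' x) (at x within {0..1})))"

section \<open>The Gaussian measure\<close>

definition cov_kernel :: "real \<Rightarrow> real \<Rightarrow> real \<Rightarrow> real" where
  "cov_kernel l x y = (\<Sum>\<^sub>\<infinity>n::int. exp (- (\<bar>x - y - of_int n\<bar>\<^sup>2 / (2 * l\<^sup>2))))"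

definition cov_operator :: "real \<Rightarrow> l2 \<Rightarrow> l2" where
  "cov_operator l v = l2_class (\<lambda>x. LINT y|I01. cov_kernel l x y * l2_fun v y)"

text \<open>The case \<open>s = 0\<close> admits degenerate one-dimensional marginals.\<close>

definition centred_gaussian :: "l2 measure \<Rightarrow> bool" where
  "centred_gaussian \<mu> \<longleftrightarrow> prob_space \<mu> \<and> sets \<mu> = sets borel \<and>
     (\<forall>v. \<exists>s\<ge>0. distr \<mu> borel (\<lambda>f. inner f v) =
        (if s = 0 then return borel 0 else density lborel (\<lambda>t. ennreal (normal_density 0 s t))))"

definition has_covariance :: "l2 measure \<Rightarrow> (l2 \<Rightarrow> l2) \<Rightarrow> bool" where
  "has_covariance \<mu> Q \<longleftrightarrow> (\<forall>v w. (LINT f|\<mu>. inner f v * inner f w) = inner (Q v) w)"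

section \<open>Operator networks\<close>

text \<open>A vector in $\mathbb{R}^n$ is a function on \<open>nat\<close> of which only the values below \<open>n\<close>
  matter.\<close>

definition affine_map :: "nat \<Rightarrow> nat \<Rightarrow> ((nat \<Rightarrow> real) \<Rightarrow> nat \<Rightarrow> real) \<Rightarrow> bool" where
  "affine_map m n \<Phi> \<longleftrightarrow>
     (\<exists>W c. \<Phi> = (\<lambda>v i. if i < n then (\<Sum>j<m. W i j * v j) + c i else 0))"

inductive neural_net ::
  "(real \<Rightarrow> real) \<Rightarrow> nat \<Rightarrow> nat \<Rightarrow> ((nat \<Rightarrow> real) \<Rightarrow> nat \<Rightarrow> real) \<Rightarrow> bool"
  for act :: "real \<Rightarrow> real" where
  affine: "affine_map m n \<Phi> \<Longrightarrow> neural_net act m n \<Phi>"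
| layer: "neural_net act m k \<Phi> \<Longrightarrow> affine_map k n \<Psi> \<Longrightarrow>
            neural_net act m n (\<lambda>v. \<Psi> (\<lambda>i. act (\<Phi> v i)))"

text \<open>Point evaluation at \<open>s 0, \<dots>, s (m - 1)\<close>, extended from continuous functions to all of
  \<open>l2\<close>.\<close>

definition encoder :: "nat \<Rightarrow> (nat \<Rightarrow> real) \<Rightarrow> (l2 \<Rightarrow> nat \<Rightarrow> real) \<Rightarrow> bool" where
  "encoder m s E \<longleftrightarrow>
     (\<forall>i<m. s i \<in> {0..1} \<and> (\<lambda>f. E f i) \<in> borel_measurable borel \<and>
       (\<forall>g f. continuous_on {0..1} g \<and> represents g f \<longrightarrow> E f i = g (s i)))"

text \<open>A DeepONet is kept as a map into functions, because its output is evaluated at mesh points.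
  That it is also a map into \<open>l2\<close> is the requirement that the trunk functions are
  square-integrable, which is automatic for a continuous activation.\<close>

definition deeponet ::
  "nat \<Rightarrow> nat \<Rightarrow> (l2 \<Rightarrow> nat \<Rightarrow> real) \<Rightarrow> (l2 \<Rightarrow> real \<Rightarrow> real) \<Rightarrow> bool" where
  "deeponet m p E \<N> \<longleftrightarrow>
     (\<exists>act act' A \<tau>.
       act \<in> borel_measurable borel \<and> neural_net act m p A \<and>
       act' \<in> borel_measurable borel \<and> neural_net act' 1 (p + 1) \<tau> \<and>
       (\<forall>k\<le>p. sq_integrable (\<lambda>x. \<tau> (\<lambda>_. x) k)) \<and>
       \<N> = (\<lambda>f x. \<tau> (\<lambda>_. x) 0 + (\<Sum>k=1..p. A (E f) (k - 1) * \<tau> (\<lambda>_. x) k)))"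

section \<open>The Shishkin mesh\<close>

definition shishkin_sigma :: "real \<Rightarrow> real \<Rightarrow> nat \<Rightarrow> real" where
  "shishkin_sigma \<alpha> \<epsilon> J = min (1 / 2) (2 * \<epsilon> * ln (real J) / \<alpha>)"

definition mesh_coarse :: "real \<Rightarrow> real \<Rightarrow> nat \<Rightarrow> real" where
  "mesh_coarse \<alpha> \<epsilon> J = 2 * (1 - shishkin_sigma \<alpha> \<epsilon> J) / real J"

definition mesh_fine :: "real \<Rightarrow> real \<Rightarrow> nat \<Rightarrow> real" where
  "mesh_fine \<alpha> \<epsilon> J = 2 * shishkin_sigma \<alpha> \<epsilon> J / real J"

definition mesh_point :: "real \<Rightarrow> real \<Rightarrow> nat \<Rightarrow> nat \<Rightarrow> real" where
  "mesh_point \<alpha> \<epsilon> J j =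
     (if j \<le> J div 2 then real j * mesh_coarse \<alpha> \<epsilon> J
      else 1 - shishkin_sigma \<alpha> \<epsilon> J + (real j - real J / 2) * mesh_fine \<alpha> \<epsilon> J)"

definition mesh_weight :: "real \<Rightarrow> real \<Rightarrow> nat \<Rightarrow> nat \<Rightarrow> real" where
  "mesh_weight \<alpha> \<epsilon> J j =
     (if j = 0 then 0
      else if j \<le> J div 2 then mesh_coarse \<alpha> \<epsilon> J
      else mesh_fine \<alpha> \<epsilon> J)"

section \<open>Errors and assumptions\<close>

definition approx_error :: "l2 measure \<Rightarrow> (l2 \<Rightarrow> l2) \<Rightarrow> (l2 \<Rightarrow> real \<Rightarrow> real) \<Rightarrow> real" where
  "approx_error \<mu> G \<N> = sqrt (LINT f|\<mu>. (norm (G f - l2_class (\<N> f)))\<^sup>2)"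

definition empirical_risk ::
  "real \<Rightarrow> real \<Rightarrow> nat \<Rightarrow> nat \<Rightarrow> (l2 \<Rightarrow> l2) \<Rightarrow> (l2 \<Rightarrow> real \<Rightarrow> real) \<Rightarrow> (nat \<Rightarrow> l2) \<Rightarrow> real" where
  "empirical_risk \<alpha> \<epsilon> N J G \<N> F =
     sqrt (1 / real N * (\<Sum>n<N. \<Sum>j\<le>J. mesh_weight \<alpha> \<epsilon> J j *
       \<bar>cont_rep (G (F n)) (mesh_point \<alpha> \<epsilon> J j) - \<N> (F n) (mesh_point \<alpha> \<epsilon> J j)\<bar>\<^sup>2))"

text \<open>In the two assumptions \<open>K\<close> is the constant hidden in $\lesssim$.  Expectations that have to
  be finite are written as nonnegative integrals.\<close>

definition assumption_A1 ::
  "real \<Rightarrow> l2 measure \<Rightarrow> (l2 \<Rightarrow> l2) \<Rightarrow> (l2 \<Rightarrow> real \<Rightarrow> real) \<Rightarrow> bool" where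
  "assumption_A1 K \<mu> G \<N> \<longleftrightarrow>
     (\<exists>q\<ge>4. (\<integral>\<^sup>+f. ennreal (norm (G f - l2_class (\<N> f)) powr q) \<partial>\<mu>) \<le> ennreal K)"

text \<open>Measurability of the point values of \<open>\<N>'\<close> is what makes the expectations in the second
  assumption meaningful.  The derivative is one-sided at the end points of the interval.\<close>

definition assumption_A2 ::
  "real \<Rightarrow> real \<Rightarrow> real \<Rightarrow> nat \<Rightarrow> l2 measure \<Rightarrow> (l2 \<Rightarrow> l2) \<Rightarrow> (l2 \<Rightarrow> real \<Rightarrow> real) \<Rightarrow> bool" where
  "assumption_A2 K \<alpha> \<epsilon> N \<mu> G \<N> \<longleftrightarrow>
     (\<exists>\<N>' :: l2 \<Rightarrow> real \<Rightarrow> real.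
       (\<forall>f. C1_unit (\<N>' f)) \<and>
       (\<forall>x\<in>{0..1}. (\<lambda>f. \<N>' f x) \<in> borel_measurable borel) \<and>
       (\<forall>x\<in>{0..1}.
         (\<integral>\<^sup>+f. ennreal (\<bar>\<N> f x - \<N>' f x\<bar>\<^sup>2) \<partial>\<mu>) \<le> ennreal (K / real N powr (1 / 2)) \<and>
         (\<integral>\<^sup>+f. ennreal \<bar>vector_derivative (\<lambda>y. (cont_rep (G f) y - \<N>' f y)\<^sup>2) (at x within {0..1})\<bar> \<partial>\<mu>)
           \<le> ennreal (K * (1 + 1 / \<epsilon> * exp (- \<alpha> * (1 - x) / \<epsilon>)))))"

definition iid_samples :: "'w measure \<Rightarrow> l2 measure \<Rightarrow> nat \<Rightarrow> (nat \<Rightarrow> 'w \<Rightarrow> l2) \<Rightarrow> bool" where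
  "iid_samples P \<mu> N F \<longleftrightarrow>
     prob_space.indep_vars P (\<lambda>_. borel) F {..<N} \<and> (\<forall>n<N. distr P borel (F n) = \<mu>)"

text \<open>A learned network is \<open>\<N> (D \<omega>)\<close>, where \<open>D\<close> is the data (training set, initialisation, random
  choices) consumed by the learning algorithm and \<open>\<N>\<close> maps such data to a DeepONet.  The data are
  independent of the samples \<open>F\<close> on which the empirical risk is evaluated: if \<open>\<N>\<close> could depend
  on these, a network interpolating the samples would violate the bound on the generalization
  gap.  A deterministic network is the case where \<open>D\<close> is constant.\<close>

definition learned_network ::
  "'w measure \<Rightarrow> 'd measure \<Rightarrow> ('w \<Rightarrow> 'd) \<Rightarrow> ('d \<Rightarrow> l2 \<Rightarrow> real \<Rightarrow> real) \<Rightarrow>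
   nat \<Rightarrow> nat \<Rightarrow> (l2 \<Rightarrow> nat \<Rightarrow> real) \<Rightarrow> nat \<Rightarrow> (nat \<Rightarrow> 'w \<Rightarrow> l2) \<Rightarrow> bool" where
  "learned_network P T D \<N> m p E N F \<longleftrightarrow>
     (\<forall>d\<in>space T. deeponet m p E (\<N> d)) \<and>
     (\<lambda>(d, f, x). \<N> d f x) \<in> borel_measurable (T \<Otimes>\<^sub>M borel \<Otimes>\<^sub>M borel) \<and>
     D \<in> measurable P T \<and>
     prob_space.indep_set P
       (sets (vimage_algebra (space P) D T))
       (sets (vimage_algebra (space P) (\<lambda>\<omega>. restrict (\<lambda>n. F n \<omega>) {..<N}) (PiM {..<N} (\<lambda>_. borel))))"

definition generalization_gap ::
  "'w measure \<Rightarrow> l2 measure \<Rightarrow> real \<Rightarrow> real \<Rightarrow> nat \<Rightarrow> nat \<Rightarrow> (l2 \<Rightarrow> l2) \<Rightarrow>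
   ('w \<Rightarrow> l2 \<Rightarrow> real \<Rightarrow> real) \<Rightarrow> (nat \<Rightarrow> 'w \<Rightarrow> l2) \<Rightarrow> ennreal" where
  "generalization_gap P \<mu> \<alpha> \<epsilon> N J G \<N> F =
     (\<integral>\<^sup>+\<omega>. ennreal \<bar>approx_error \<mu> G (\<N> \<omega>)
        - empirical_risk \<alpha> \<epsilon> N J G (\<N> \<omega>) (\<lambda>n. F n \<omega>)\<bar> \<partial>P)"

end

theory Submission
  imports Defs
begin

text \<open>For fixed network data the gap splits, up to the triangle inequality in weighted $\ell^2$ sums
  and $|\sqrt x - \sqrt y| \le \sqrt{|x - y|}$, into the deviation of a sample mean of
  $\|\mathscr{G}(f) - \mathscr{N}(f)\|^2$ from its expectation, two errors from replacing the network
  by its $C^1$ approximation (in $L^2$ and at the mesh points), and a quadrature error for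
  $(\mathscr{G}(f) - \widetilde{\mathscr{N}}(f))^2$.  The first has size $N^{-1/4}$ because (A1) bounds the
  variance, the next two by (A2).  The quadrature error is at most the largest mesh width, $2/J$, times
  the total variation, and $\varepsilon^{-1} e^{-\alpha(1-x)/\varepsilon}$ has integral at most $1/\alpha$;
  the fine part of the mesh plays no role.  Point values of $\mathscr{G}(f)$ make sense because weak
  solutions are $C^1$, by the du Bois-Reymond lemma.  Independence of the learning data and the samples
  lets the bound for fixed data be integrated by Fubini.\<close>

section \<open>Smooth test functions\<close>

text \<open>Two obstacles shape the proof. \<open>H01\<close> is a closure of classes of test
  functions, so all regularity of a weak solution has to come from testing with smooth compactly
  supported functions. What is needed is a supply of them whose derivatives stay bounded and
  converge pointwise to prescribed step functions of mean zero; it is built from e^(-1/x).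

  The other obstacle is measurability. \<open>cont_rep\<close> picks a representative by choice,
  separately for every class, so nothing about its dependence on f is evident. Point values are
  instead recovered as x-derivatives of \<open>inner (G f) (l2_class (indicator {0..x}))\<close>,
  which is continuous in f because G is Lipschitz. Each exchange of the integral over x with an
  expectation then needs joint measurability, obtained from continuity in x.

  Expectations of square roots are estimated by 2 sqrt z \<le> t + z / t with a fixed t of the rate
  aimed at. Only the expectation of z enters, and everything can be phrased with nonnegative
  integrals.\<close>

text \<open>Polynomial multiples, in 1/x, of the standard flat function e^(-1/x) (the case
  \<open>p = 1\<close>), extended by zero. Keeping the polynomial as a parameter makes the family
  closed under differentiation.\<close>

definition flat :: "real poly \<Rightarrow> real \<Rightarrow> real" where
  "flat p x = (if x > 0 then poly p (inverse x) * exp (- inverse x) else 0)"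

lemma poly_exp_tendsto_0: "((\<lambda>z. poly p z * exp (- z)) \<longlongrightarrow> (0::real)) at_top"
proof -
  have "((\<lambda>z. \<Sum>i\<le>degree p. coeff p i * (z ^ i / exp z)) \<longlongrightarrow> (\<Sum>i\<le>degree p. coeff p i * 0)) at_top"
    by (intro tendsto_intros tendsto_power_div_exp_0)
  then show ?thesis
    by (simp add: poly_altdef sum_distrib_right exp_minus divide_inverse mult.assoc)
qed

text \<open>With z = 1/x one has dz/dx = -z^2, so p(z) e^(-z) has derivative z^2 (p(z) - p'(z))
  e^(-z), which is of the same form. At 0 the exponential beats every power of z.\<close>

lemma flat_deriv: "(flat p has_real_derivative flat ([:0, 0, 1:] * (p - pderiv p)) x) (at x)"
proof -
  consider "x > 0" | "x < 0" | "x = 0" by linarith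
  then show ?thesis
  proof cases
    case 1
    have "((\<lambda>x. poly p (inverse x) * exp (- inverse x)) has_real_derivative
        flat ([:0, 0, 1:] * (p - pderiv p)) x) (at x)"
      using 1 by (auto intro!: derivative_eq_intros DERIV_chain2[OF poly_DERIV]
          simp: flat_def algebra_simps power2_eq_square)
    then show ?thesis
    proof (rule has_field_derivative_transform_within_open[where S = "{0<..}"])
      show "\<And>y. y \<in> {0<..} \<Longrightarrow> poly p (inverse y) * exp (- inverse y) = flat p y"
        by (simp add: flat_def)
    qed (use 1 in auto)
  next
    case 2
    have "((\<lambda>x. 0) has_real_derivative flat ([:0, 0, 1:] * (p - pderiv p)) x) (at x)"
      using 2 by (simp add: flat_def)
    then show ?thesis
    proof (rule has_field_derivative_transform_within_open[where S = "{..<0}"])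
      show "\<And>y. y \<in> {..<0} \<Longrightarrow> 0 = flat p y"
        by (simp add: flat_def)
    qed (use 2 in auto)
  next
    case 3
    have "((\<lambda>y. flat p y / y) \<longlongrightarrow> 0) (at_right 0)"
    proof -
      \<comment> \<open>For y > 0 the difference quotient at 0 is z p(z) e^(-z) with z = 1/y, and
        \<open>pCons 0 p\<close> is the polynomial z p(z).\<close>
      have "((\<lambda>z. poly (pCons 0 p) z * exp (- z)) \<longlongrightarrow> 0) at_top"
        by (rule poly_exp_tendsto_0)
      then have "((\<lambda>y. poly (pCons 0 p) (inverse y) * exp (- inverse y)) \<longlongrightarrow> 0) (at_right 0)"
        by (rule filterlim_compose[OF _ filterlim_inverse_at_top_right])
      then show ?thesis
        by (rule tendsto_cong[THEN iffD1, rotated])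
           (auto simp: eventually_at_filter flat_def divide_inverse)
    qed
    moreover have "((\<lambda>y. flat p y / y) \<longlongrightarrow> 0) (at_left 0)"
      by (rule tendsto_eventually) (auto simp: eventually_at_filter flat_def)
    ultimately have "((\<lambda>y. flat p y / y) \<longlongrightarrow> 0) (at 0)"
      by (simp add: filterlim_split_at)
    then show ?thesis
      using 3 by (simp add: has_field_derivative_iff flat_def)
  qed
qed

text \<open>Closed under differentiation by the chain, sum and product rules, so that infinite
  differentiability becomes a matter of membership. Affine arguments are part of the generators
  because composition is not among the operations.\<close>

inductive_set smooth_algebra :: "(real \<Rightarrow> real) set" where
  flat: "(\<lambda>x. flat p (s * x + t)) \<in> smooth_algebra"
| const: "(\<lambda>x. c) \<in> smooth_algebra"
| add: "f \<in> smooth_algebra \<Longrightarrow> g \<in> smooth_algebra \<Longrightarrow> (\<lambda>x. f x + g x) \<in> smooth_algebra"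
| mult: "f \<in> smooth_algebra \<Longrightarrow> g \<in> smooth_algebra \<Longrightarrow> (\<lambda>x. f x * g x) \<in> smooth_algebra"

lemma smooth_algebra_deriv:
  assumes "f \<in> smooth_algebra"
  shows "\<exists>f'\<in>smooth_algebra. \<forall>x. (f has_real_derivative f' x) (at x)"
  using assms
proof induction
  case (flat p s t)
  let ?f' = "\<lambda>x. s * flat ([:0, 0, 1:] * (p - pderiv p)) (s * x + t)"
  have "((\<lambda>x. flat p (s * x + t)) has_real_derivative ?f' x) (at x)" for x
    by (rule DERIV_chain2[OF flat_deriv, THEN DERIV_cong]) (auto intro!: derivative_eq_intros)
  moreover have "?f' \<in> smooth_algebra"
    by (intro smooth_algebra.intros)
  ultimately show ?case by (intro bexI[of _ ?f']) auto
next
  case (const c)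
  show ?case
    by (rule bexI[of _ "\<lambda>x. 0"]) (auto intro: smooth_algebra.intros)
next
  case (add f g)
  then obtain f' g' where
    "f' \<in> smooth_algebra" "g' \<in> smooth_algebra"
    "\<forall>x. (f has_real_derivative f' x) (at x)" "\<forall>x. (g has_real_derivative g' x) (at x)"
    by blast
  then show ?case
    by (intro bexI[of _ "\<lambda>x. f' x + g' x"]) (auto intro!: smooth_algebra.add derivative_eq_intros)
next
  case (mult f g)
  then obtain f' g' where
    "f' \<in> smooth_algebra" "g' \<in> smooth_algebra"
    "\<forall>x. (f has_real_derivative f' x) (at x)" "\<forall>x. (g has_real_derivative g' x) (at x)"
    by blast
  with mult show ?case
    by (intro bexI[of _ "\<lambda>x. f' x * g x + g' x * f x"])
       (auto intro!: smooth_algebra.add smooth_algebra.mult derivative_eq_intros)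
qed

lemma smooth_algebra_higher_deriv:
  assumes "f \<in> smooth_algebra"
  shows "(deriv ^^ k) f \<in> smooth_algebra"
proof (induction k)
  case (Suc k)
  then obtain f' where f': "f' \<in> smooth_algebra"
      "\<forall>x. ((deriv ^^ k) f has_real_derivative f' x) (at x)"
    using smooth_algebra_deriv by blast
  then have "deriv ((deriv ^^ k) f) = f'"
    by (intro ext DERIV_imp_deriv) simp
  with f' show ?case by simp
qed (use assms in simp)

text \<open>The ramps below are twofold antiderivatives of a bump and have no closed form, so they
  need not lie in the algebra themselves. The first two derivatives are checked by hand, and from
  the second one on the algebra takes over.\<close>

lemma smooth_algebra_second_antiderivative:
  assumes "h \<in> smooth_algebra"
    and g: "\<And>x. (g has_real_derivative h x) (at x)"
    and f: "\<And>x. (f has_real_derivative g x) (at x)"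
  shows "(deriv ^^ k) f field_differentiable at x"
proof -
  have df: "deriv f = g" and dg: "deriv g = h"
    using DERIV_imp_deriv[OF f] DERIV_imp_deriv[OF g] by (simp_all add: fun_eq_iff)
  consider "k = 0" | "k = 1" | i where "k = Suc (Suc i)"
    by (metis One_nat_def not0_implies_Suc)
  then show ?thesis
  proof cases
    case 1
    then show ?thesis using f[of x] by (auto simp: field_differentiable_def)
  next
    case 2
    then show ?thesis using g[of x] by (auto simp: field_differentiable_def df)
  next
    case 3
    have "(deriv ^^ k) f = (deriv ^^ i) h"
      unfolding 3 funpow_Suc_right comp_apply df dg ..
    moreover have "(deriv ^^ i) h \<in> smooth_algebra"
      using assms(1) by (rule smooth_algebra_higher_deriv)
    ultimately show ?thesis
      using smooth_algebra_deriv[of "(deriv ^^ k) f"] unfolding field_differentiable_def by auto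
  qed
qed

section \<open>Test functions whose derivatives approximate step functions\<close>

text \<open>B is a bump on (0, 1) of integral 1, S a smooth step and Q a smooth ramp with Q' = S and
  S' = B. A difference of two shifted ramps has as its derivative a difference of two smooth steps,
  that is, a smoothed indicator of an interval.\<close>

lemma smooth_ramp:
  obtains Q S B :: "real \<Rightarrow> real"
  where "\<And>s t. (\<lambda>x. B (s * x + t)) \<in> smooth_algebra"
    and "\<And>x. (S has_real_derivative B x) (at x)" "\<And>x. (Q has_real_derivative S x) (at x)"
    and "\<And>x. 0 \<le> S x" "\<And>x. S x \<le> 1"
    and "\<And>x. x \<le> 0 \<Longrightarrow> S x = 0" "\<And>x. x \<ge> 1 \<Longrightarrow> S x = 1"
    and "\<And>x. x \<le> 0 \<Longrightarrow> Q x = 0" "\<And>x. x \<ge> 1 \<Longrightarrow> Q x = Q 1 + (x - 1)"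
proof -
  \<comment> \<open>A bump that is positive exactly on (0, 1).\<close>
  define B0 where "B0 x = flat 1 x * flat 1 (1 - x)" for x
  have alg0: "(\<lambda>x. B0 (s * x + t)) \<in> smooth_algebra" for s t
  proof -
    have "(\<lambda>x. B0 (s * x + t)) = (\<lambda>x. flat 1 (s * x + t) * flat 1 ((-s) * x + (1 - t)))"
      by (simp add: B0_def algebra_simps)
    also have "\<dots> \<in> smooth_algebra" by (intro smooth_algebra.intros)
    finally show ?thesis .
  qed
  have antideriv: "\<exists>F. \<forall>x. (F has_real_derivative f x) (at x)" if "continuous_on UNIV f" for f :: "real \<Rightarrow> real"
  proof -
    have "\<exists>F. \<forall>x::real. -\<infinity> < ereal x \<longrightarrow> ereal x < \<infinity> \<longrightarrow> (F has_vector_derivative f x) (at x)"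
      by (rule einterval_antiderivative) (use that in \<open>auto simp: continuous_on_eq_continuous_at\<close>)
    then show ?thesis by (simp add: has_real_derivative_iff_has_vector_derivative)
  qed
  have "continuous_on UNIV B0"
    using smooth_algebra_deriv[OF alg0[of 1 0]] by (auto intro: DERIV_continuous_on)
  then obtain S0 where S0: "\<And>x. (S0 has_real_derivative B0 x) (at x)"
    using antideriv by blast
  have B0_nonneg: "B0 x \<ge> 0" for x by (simp add: B0_def flat_def)
  have B0_zero: "B0 x = 0" if "x \<le> 0 \<or> x \<ge> 1" for x using that by (auto simp: B0_def flat_def)
  have mono: "S0 x \<le> S0 y" if "x \<le> y" for x y
    by (rule DERIV_nonneg_imp_nondecreasing[OF that]) (use S0 B0_nonneg in blast)
  have left: "S0 x = S0 0" if "x \<le> 0" for x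
  proof (rule antisym)
    show "S0 0 \<le> S0 x"
      by (rule DERIV_nonpos_imp_nonincreasing[OF that]) (metis S0 B0_zero order_refl)
  qed (use mono that in auto)
  have right: "S0 x = S0 1" if "x \<ge> 1" for x
  proof (rule antisym)
    show "S0 x \<le> S0 1"
      by (rule DERIV_nonpos_imp_nonincreasing[OF that]) (metis S0 B0_zero order_refl)
  qed (use mono that in auto)
  have cont: "continuous_on A S0" for A
    by (rule DERIV_continuous_on[OF has_field_derivative_at_within[OF S0]])
  have "S0 0 < S0 1"
    by (rule DERIV_pos_imp_increasing_open[of 0 1 S0])
       (use S0 cont in \<open>auto intro!: exI simp: B0_def flat_def\<close>)
  \<comment> \<open>The total mass of the bump; dividing by it makes the step rise from 0 to exactly
    1.\<close>
  define r where "r = S0 1 - S0 0"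
  have r: "r > 0" using \<open>S0 0 < S0 1\<close> by (simp add: r_def)
  define S where "S x = (S0 x - S0 0) / r" for x
  define B where "B x = (1 / r) * B0 x" for x
  have S: "(S has_real_derivative B x) (at x)" for x
    unfolding S_def B_def using r by (auto intro!: derivative_eq_intros S0)
  have "continuous_on UNIV S"
    unfolding S_def using r by (intro continuous_intros cont) auto
  then obtain Q0 where Q0: "\<And>x. (Q0 has_real_derivative S x) (at x)"
    using antideriv by blast
  define Q where "Q x = Q0 x - Q0 0" for x
  have Q: "(Q has_real_derivative S x) (at x)" for x
    unfolding Q_def by (auto intro!: derivative_eq_intros Q0)
  have S_left: "S x = 0" if "x \<le> 0" for x using left[OF that] by (simp add: S_def)
  have S_right: "S x = 1" if "x \<ge> 1" for x using right[OF that] r by (simp add: S_def r_def)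
  have S_mono: "S x \<le> S y" if "x \<le> y" for x y
    using mono[OF that] r by (auto simp: S_def divide_right_mono)
  show thesis
  proof
    show "(\<lambda>x. B (s * x + t)) \<in> smooth_algebra" for s t
      unfolding B_def by (intro smooth_algebra.intros alg0)
    show "0 \<le> S x" for x
      using S_mono[of "min x 0" x] S_left[of "min x 0"] by simp
    show "S x \<le> 1" for x
      using S_mono[of x "max x 1"] S_right[of "max x 1"] by simp
    show "Q x = 0" if "x \<le> 0" for x
    proof -
      have "(Q has_real_derivative 0) (at y within {..0})" if "y \<le> 0" for y
        using has_field_derivative_at_within[OF Q[of y]] S_left[OF that] by simp
      then have "\<exists>c. \<forall>y\<in>{..0}. Q y = c"
        by (intro has_field_derivative_zero_constant) auto
      then obtain c where "\<And>y. y \<le> 0 \<Longrightarrow> Q y = c" by auto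
      from this[of 0] this[of x] that show ?thesis by (simp add: Q_def)
    qed
    show "Q x = Q 1 + (x - 1)" if "x \<ge> 1" for x
    proof -
      have "((\<lambda>x. Q x - x) has_real_derivative 0) (at y within {1..})" if "y \<ge> 1" for y
        by (rule has_field_derivative_at_within)
           (use S_right[OF that] in \<open>auto intro!: derivative_eq_intros Q\<close>)
      then have "\<exists>c. \<forall>y\<in>{1..}. Q y - y = c"
        by (intro has_field_derivative_zero_constant) auto
      then obtain c where "\<And>y. y \<ge> 1 \<Longrightarrow> Q y - y = c" by auto
      from this[of 1] this[of x] that show ?thesis by simp
    qed
  qed (fact S Q S_left S_right)+
qed

text \<open>The derivative of a compactly supported function has mean zero, so the indicator of an
  interval alone cannot be approximated; a multiple of the fixed indicator of (1/4, 3/4] compensates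
  its integral. The uniform bound serves as the majorant for dominated convergence.\<close>

lemma test_function_derivative_approximation:
  fixes c d :: real
  assumes "0 < c" "c \<le> d" "d < 1"
  obtains \<phi> :: "nat \<Rightarrow> real \<Rightarrow> real"
  where "\<And>n. test_function (\<phi> n)"
    and "\<And>n x. \<bar>deriv (\<phi> n) x\<bar> \<le> 4"
    and "\<And>x. (\<lambda>n. deriv (\<phi> n) x) \<longlonglongrightarrow> indicator {c<..d} x - 2 * (d - c) * indicator {1/4<..3/4} x"
proof -
  obtain Q S B :: "real \<Rightarrow> real"
    where B: "\<And>s t. (\<lambda>x. B (s * x + t)) \<in> smooth_algebra"
    and S: "\<And>x. (S has_real_derivative B x) (at x)" and Q: "\<And>x. (Q has_real_derivative S x) (at x)"
    and S_nonneg: "\<And>x. 0 \<le> S x" and S_le: "\<And>x. S x \<le> 1"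
    and S_left: "\<And>x. x \<le> 0 \<Longrightarrow> S x = 0" and S_right: "\<And>x. x \<ge> 1 \<Longrightarrow> S x = 1"
    and Q_left: "\<And>x. x \<le> 0 \<Longrightarrow> Q x = 0" and Q_right: "\<And>x. x \<ge> 1 \<Longrightarrow> Q x = Q 1 + (x - 1)"
    by (rule smooth_ramp) (use that in blast)
  \<comment> \<open>The supports will lie in \<open>{m..(1 + M) / 2}\<close>: up to m no ramp has
    started, and from (1 + M) / 2 on every transition is complete.\<close>
  define m where "m = min c (1/4)"
  define M where "M = max d (3/4)"
  have m: "0 < m" "m \<le> c" "m \<le> 1/4" and M: "M < 1" "d \<le> M" "3/4 \<le> M"
    using assms by (auto simp: m_def M_def)
  \<comment> \<open>The steepness tends to infinity, while the transition width 1 / s n is at most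
    (1 - M) / 2 for every n: a ramp that starts at or before M is linear from (1 + M) / 2
    on.\<close>
  define s where "s n = (real n + 1) / (1 - M) * 2" for n
  have s: "s n > 0" "s n * (1 - M) \<ge> 2" for n
    using M by (auto simp: s_def)
  \<comment> \<open>The interval (1/4, 3/4] has length 1/2, so r times that length equals d - c and
    the two plateaus cancel.\<close>
  define r where "r = 2 * (d - c)"
  have r: "0 \<le> r" "r \<le> 2" using assms by (auto simp: r_def)
  \<comment> \<open>A smoothed primitive of the indicator of (a, b]. The arguments are kept in the
    shape \<open>s * x + t\<close> of the generators of \<open>smooth_algebra\<close>.\<close>
  define \<psi> where "\<psi> n a b x = (Q (s n * x + - s n * a) - Q (s n * x + - s n * b)) / s n" for n a b x
  define \<psi>' where "\<psi>' n a b x = S (s n * x + - s n * a) - S (s n * x + - s n * b)" for n a b x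
  define \<psi>'' where "\<psi>'' n a b x = s n * (B (s n * x + - s n * a) + (-1) * B (s n * x + - s n * b))" for n a b x
  have d1: "(\<psi> n a b has_real_derivative \<psi>' n a b x) (at x)" for n a b x
    unfolding \<psi>_def \<psi>'_def using s(1)[of n]
    by (auto intro!: derivative_eq_intros DERIV_chain2[OF Q] simp: field_simps)
  have d2: "(\<psi>' n a b has_real_derivative \<psi>'' n a b x) (at x)" for n a b x
    unfolding \<psi>'_def \<psi>''_def
    by (auto intro!: derivative_eq_intros DERIV_chain2[OF S] simp: field_simps)
  define \<phi> where "\<phi> n x = \<psi> n c d x + (-r) * \<psi> n (1/4) (3/4) x" for n x
  define \<phi>' where "\<phi>' n x = \<psi>' n c d x + (-r) * \<psi>' n (1/4) (3/4) x" for n x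
  define \<phi>'' where "\<phi>'' n x = \<psi>'' n c d x + (-r) * \<psi>'' n (1/4) (3/4) x" for n x
  have D1: "(\<phi> n has_real_derivative \<phi>' n x) (at x)" for n x
    unfolding \<phi>_def \<phi>'_def by (auto intro!: derivative_eq_intros d1)
  have D2: "(\<phi>' n has_real_derivative \<phi>'' n x) (at x)" for n x
    unfolding \<phi>'_def \<phi>''_def by (auto intro!: derivative_eq_intros d2)
  have alg: "\<phi>'' n \<in> smooth_algebra" for n
    unfolding \<phi>''_def \<psi>''_def by (intro smooth_algebra.intros B)
  have deriv: "deriv (\<phi> n) = \<phi>' n" for n
    using D1 by (auto intro: DERIV_imp_deriv)
  have left: "\<psi> n a b x = 0" if "x \<le> m" "m \<le> a" "m \<le> b" for n a b x
  proof -
    have "s n * x \<le> s n * a" "s n * x \<le> s n * b"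
      using that s(1)[of n] by (auto intro!: mult_left_mono)
    then show ?thesis by (simp add: \<psi>_def Q_left)
  qed
  have right: "\<psi> n a b x = b - a" if "x \<ge> (1 + M) / 2" "a \<le> M" "b \<le> M" for n a b x
  proof -
    have 1: "s n * ((1 - M) / 2) \<le> s n * (x - e)" if "e \<le> M" for e
      using that \<open>x \<ge> _\<close> s(1)[of n] by (intro mult_left_mono) auto
    have "s n * x + - s n * e \<ge> 1" if "e \<le> M" for e
    proof -
      have "s n * x + - s n * e = s n * (x - e)"
        by (simp add: algebra_simps)
      then show ?thesis using 1[OF that] s(2)[of n] by linarith
    qed
    then have "Q (s n * x + - s n * a) = Q 1 + (s n * x + - s n * a - 1)"
         "Q (s n * x + - s n * b) = Q 1 + (s n * x + - s n * b - 1)"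
      using that by (auto intro!: Q_right)
    then show ?thesis using s(1)[of n] by (simp add: \<psi>_def field_simps)
  qed
  have supp: "\<phi> n x = 0" if "x \<notin> {m..(1 + M) / 2}" for n x
  proof (cases "x \<le> m")
    case True
    then show ?thesis using left[of x c d n] left[of x "1/4" "3/4" n] m assms by (simp add: \<phi>_def)
  next
    case False
    then have "x \<ge> (1 + M) / 2" using that by auto
    then have 1: "\<psi> n c d x = d - c" and 2: "\<psi> n (1/4) (3/4) x = 1/2"
      using right[of x c d n] right[of x "1/4" "3/4" n] M assms by auto
    show ?thesis
      unfolding \<phi>_def r_def 1 2 by (simp add: field_simps)
  qed
  \<comment> \<open>At x = a the argument is 0, where S vanishes; this is why the limiting intervals
    are open on the left and closed on the right.\<close>
  have lim: "(\<lambda>n. S (s n * x + - s n * a)) \<longlonglongrightarrow> (if a < x then 1 else 0)" for x a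
  proof (cases "a < x")
    case True
    have "eventually (\<lambda>n. real n \<ge> (1 - M) / (x - a)) sequentially"
      using filterlim_real_sequentially by (simp add: filterlim_at_top)
    then have "eventually (\<lambda>n. S (s n * x + - s n * a) = 1) sequentially"
    proof eventually_elim
      case (elim n)
      have "(real n + 1) * 2 * (x - a) \<ge> (1 - M)"
      proof -
        have "1 - M \<le> real n * (x - a)" using elim True by (simp add: field_simps)
        also have "\<dots> \<le> ((real n + 1) * 2) * (x - a)" using True by (intro mult_right_mono) auto
        finally show ?thesis .
      qed
      then have "s n * (x - a) \<ge> 1"
        using M by (simp add: s_def field_simps)
      then show ?case by (intro S_right) (simp add: algebra_simps)
    qed
    then show ?thesis using True by (auto intro: tendsto_eventually)
  next
    case False
    then have "s n * x \<le> s n * a" for n using s(1)[of n] by (auto intro!: mult_left_mono)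
    then have "S (s n * x + - s n * a) = 0" for n by (intro S_left) simp
    then show ?thesis using False by simp
  qed
  show thesis
  proof
    show "test_function (\<phi> n)" for n
      unfolding test_function_def
    proof (intro conjI allI exI)
      show "(deriv ^^ k) (\<phi> n) field_differentiable at x" for k x
        by (rule smooth_algebra_second_antiderivative[OF alg D2 D1])
      show "compact {m..(1 + M) / 2}" by simp
      show "{m..(1 + M) / 2} \<subseteq> {0<..<1}" using m M by auto
      show "x \<notin> {m..(1 + M) / 2} \<longrightarrow> \<phi> n x = 0" for x using supp by blast
    qed
    show "\<bar>deriv (\<phi> n) x\<bar> \<le> 4" for n x
    proof -
      have *: "\<bar>\<psi>' n a b x\<bar> \<le> 1" for a b
        unfolding \<psi>'_def using S_nonneg S_le by (smt (verit))
      have "\<bar>r * \<psi>' n (1/4) (3/4) x\<bar> \<le> 2 * 1"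
        unfolding abs_mult by (rule mult_mono) (use r * in auto)
      then show ?thesis
        using *[of c d] unfolding deriv \<phi>'_def by simp
    qed
    show "(\<lambda>n. deriv (\<phi> n) x) \<longlonglongrightarrow>
        indicator {c<..d} x - 2 * (d - c) * indicator {1/4<..3/4} x" for x
    proof -
      have "(\<lambda>n. \<phi>' n x) \<longlonglongrightarrow> ((if c < x then 1 else 0) - (if d < x then 1 else 0)) +
          (-r) * ((if 1/4 < x then 1 else 0) - (if 3/4 < x then 1 else 0))"
        unfolding \<phi>'_def \<psi>'_def by (intro tendsto_intros lim)
      moreover have "((if c < x then 1 else 0) - (if d < x then 1 else 0)) +
          (-r) * ((if 1/4 < x then 1 else 0) - (if 3/4 < x then 1 else 0)) =
          indicator {c<..d} x - 2 * (d - c) * indicator {1/4<..3/4} x"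
        using assms by (auto simp: r_def indicator_def)
      ultimately show ?thesis by (simp add: deriv)
    qed
  qed
qed

section \<open>Square-integrable functions and their primitives\<close>

lemma l2_fun_sq_integrable: "sq_integrable (l2_fun u)"
  using Quotient_rep_reflp[OF Quotient_l2] by (simp add: l2rel_def)

lemma l2_class_l2_fun: "l2_class (l2_fun u) = u"
  by (rule Quotient_abs_rep[OF Quotient_l2])

lemma l2_class_eqI:
  "sq_integrable f \<Longrightarrow> sq_integrable g \<Longrightarrow> AE x in I01. f x = g x \<Longrightarrow> l2_class f = l2_class g"
  by (intro Quotient_rel_abs[OF Quotient_l2]) (simp add: l2rel_def)

lemma l2_fun_l2_class:
  assumes "sq_integrable f"
  shows "AE x in I01. l2_fun (l2_class f) x = f x"
  using Quotient_rep_abs[OF Quotient_l2, of f] assms by (simp add: l2rel_def)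

lemma inner_l2_class:
  "sq_integrable f \<Longrightarrow> sq_integrable g \<Longrightarrow>
    inner (l2_class f) (l2_class g) = (LINT x|I01. f x * g x)"
  by (intro inner_l2.abs_eq) (simp_all add: l2rel_def)

lemma minus_l2_class:
  "sq_integrable f \<Longrightarrow> sq_integrable g \<Longrightarrow> l2_class f - l2_class g = l2_class (\<lambda>x. f x - g x)"
  by (intro minus_l2.abs_eq) (simp_all add: l2rel_def)

lemma norm_l2_class_square:
  "sq_integrable f \<Longrightarrow> (norm (l2_class f))\<^sup>2 = (LINT x|I01. (f x)\<^sup>2)"
  by (simp only: power2_norm_eq_inner inner_l2_class flip: power2_eq_square)

lemma prob_space_I01: "prob_space I01"
  by (rule prob_spaceI) (simp add: emeasure_restrict_space space_restrict_space)

lemma continuous_on_measurable_I01: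
  "continuous_on {0..1} f \<Longrightarrow> f \<in> borel_measurable I01" for f :: "real \<Rightarrow> real"
  by (rule continuous_imp_measurable_on_sets_lebesgue) auto

lemma sq_integrable_continuous: "continuous_on {0..1} f \<Longrightarrow> sq_integrable f"
  unfolding sq_integrable_def
  by (intro conjI continuous_on_measurable_I01 continuous_imp_integrable_real continuous_intros)

lemma sq_integrable_bounded:
  assumes "f \<in> borel_measurable I01" "\<And>x. x \<in> {0..1} \<Longrightarrow> \<bar>f x\<bar> \<le> B"
  shows "sq_integrable f"
proof -
  interpret prob_space I01 by (rule prob_space_I01)
  have "integrable I01 (\<lambda>x. (f x)\<^sup>2)"
  proof (rule integrable_const_bound[where B = "B\<^sup>2"])
    show "AE x in I01. norm ((f x)\<^sup>2) \<le> B\<^sup>2"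
      using assms(2) by (intro AE_I2) (auto simp: space_restrict_space intro!: abs_le_square_iff[THEN iffD1] order_trans[OF assms(2)])
  qed (use assms(1) in auto)
  then show ?thesis using assms(1) by (simp add: sq_integrable_def)
qed

lemma sq_integrable_indicator: "A \<in> sets borel \<Longrightarrow> sq_integrable (indicator A)"
  by (rule sq_integrable_bounded[where B = 1])
     (auto simp: indicator_def intro!: borel_measurable_indicator measurable_restrict_space1 borel_measurable_if)

lemma sq_integrable_continuous_mult:
  assumes a: "continuous_on {0..1} a" and f: "sq_integrable f"
  shows "sq_integrable (\<lambda>x. a x * f x)"
proof -
  have am: "a \<in> borel_measurable I01" using a by (rule continuous_on_measurable_I01)
  have fm: "f \<in> borel_measurable I01" using f by (simp add: sq_integrable_def)
  have "bounded (a ` {0..1})"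
    using a by (intro compact_imp_bounded compact_continuous_image) auto
  then obtain B where B: "\<And>x. x \<in> {0..1} \<Longrightarrow> \<bar>a x\<bar> \<le> B"
    unfolding bounded_iff by (metis imageI real_norm_def)
  have "integrable I01 (\<lambda>x. (a x * f x)\<^sup>2)"
  proof (rule Bochner_Integration.integrable_bound)
    show "integrable I01 (\<lambda>x. B\<^sup>2 * (f x)\<^sup>2)"
      using f by (simp add: sq_integrable_def)
    show "AE x in I01. norm ((a x * f x)\<^sup>2) \<le> norm (B\<^sup>2 * (f x)\<^sup>2)"
    proof (rule AE_I2)
      fix x assume "x \<in> space I01"
      then have "\<bar>a x\<bar> \<le> \<bar>B\<bar>" using B[of x] by (auto simp: space_restrict_space)
      then have "(a x)\<^sup>2 \<le> B\<^sup>2" by (simp add: abs_le_square_iff)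
      then show "norm ((a x * f x)\<^sup>2) \<le> norm (B\<^sup>2 * (f x)\<^sup>2)"
        by (simp add: power_mult_distrib mult_right_mono)
    qed
  qed (use am fm in measurable)
  then show ?thesis
    using am fm by (simp add: sq_integrable_def)
qed

lemma sq_integrable_integrable: "sq_integrable f \<Longrightarrow> integrable I01 f"
  using sq_integrable_mult[of f "\<lambda>_. 1"] sq_integrable_continuous[of "\<lambda>_. 1"] by simp

lemma sq_integrable_integrable_on: "sq_integrable f \<Longrightarrow> {c..d} \<subseteq> {0..1} \<Longrightarrow> f integrable_on {c..d}"
  by (rule integrable_subinterval_real[OF integrable_on_lebesgue_on])
     (auto intro: sq_integrable_integrable)

lemma norm_l2_class_le:
  assumes "f \<in> borel_measurable I01" "\<And>x. x \<in> {0..1} \<Longrightarrow> \<bar>f x\<bar> \<le> B"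
  shows "norm (l2_class f) \<le> B"
proof -
  interpret prob_space I01 by (rule prob_space_I01)
  have f: "sq_integrable f" by (rule sq_integrable_bounded[OF assms])
  have B: "B \<ge> 0" using assms(2)[of 0] by auto
  have "(norm (l2_class f))\<^sup>2 \<le> (LINT x|I01. B\<^sup>2)"
    unfolding norm_l2_class_square[OF f]
  proof (rule integral_mono_AE)
    show "AE x in I01. (f x)\<^sup>2 \<le> B\<^sup>2"
    proof (rule AE_I2)
      fix x assume "x \<in> space I01"
      then have "\<bar>f x\<bar> \<le> \<bar>B\<bar>" using assms(2)[of x] by (auto simp: space_restrict_space)
      then show "(f x)\<^sup>2 \<le> B\<^sup>2" by (simp add: abs_le_square_iff)
    qed
  qed (use f in \<open>auto simp: sq_integrable_def\<close>)
  also have "\<dots> = B\<^sup>2" using prob_space by simp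
  finally show ?thesis using B by (rule power2_le_imp_le)
qed

section \<open>Primitives of square-integrable functions\<close>

definition primitive :: "(real \<Rightarrow> real) \<Rightarrow> real \<Rightarrow> real" where
  "primitive f x = integral {0..x} f"

lemma integral_eq_LINT_indicator:
  assumes "sq_integrable f" "{c..d} \<subseteq> {0..1}"
  shows "integral {c..d} f = (LINT t|I01. f t * indicator {c..d} t)"
proof -
  have 1: "(LINT t|I01. f t * indicator {c..d} t) = integral {0..1} (\<lambda>t. f t * indicator {c..d} t)"
    by (rule lebesgue_integral_eq_integral)
       (auto intro!: sq_integrable_mult assms sq_integrable_indicator)
  have 2: "(\<lambda>t. f t * indicator {c..d} t) = (\<lambda>t. if t \<in> {c..d} then f t else 0)"
    by (auto simp: indicator_def)
  show ?thesis
    unfolding 1 unfolding 2 using assms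
    by (intro integral_unique[symmetric] iffD2[OF has_integral_restrict] integrable_integral
        sq_integrable_integrable_on) auto
qed

lemma primitive_eq_LINT:
  assumes "sq_integrable f" "x \<in> {0..1}"
  shows "primitive f x = (LINT t|I01. f t * indicator {0..x} t)"
  unfolding primitive_def using assms by (intro integral_eq_LINT_indicator) auto

text \<open>Pairing with an indicator shows that the primitive depends only on the class, and
  continuously so. This is the bridge from \<open>l2\<close> to point values.\<close>

lemma primitive_eq_inner:
  assumes "sq_integrable f" "x \<in> {0..1}"
  shows "primitive f x = inner (l2_class f) (l2_class (indicator {0..x}))"
  using assms by (simp add: primitive_eq_LINT inner_l2_class sq_integrable_indicator)

lemma continuous_on_primitive: "sq_integrable f \<Longrightarrow> continuous_on {0..1} (primitive f)"
  unfolding primitive_def by (rule indefinite_integral_continuous_1) (rule sq_integrable_integrable_on, auto)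

lemma primitive_has_derivative:
  "continuous_on {0..1} f \<Longrightarrow> x \<in> {0..1} \<Longrightarrow> (primitive f has_real_derivative f x) (at x within {0..1})"
  unfolding primitive_def by (rule integral_has_real_derivative)

lemma primitive_diff:
  "sq_integrable f \<Longrightarrow> 0 \<le> c \<Longrightarrow> c \<le> d \<Longrightarrow> d \<le> 1 \<Longrightarrow> integral {c..d} f = primitive f d - primitive f c"
  unfolding primitive_def
  using Henstock_Kurzweil_Integration.integral_combine[of 0 c d f] sq_integrable_integrable_on[of f 0 d]
  by auto

lemma primitive_cong_AE:
  assumes "sq_integrable f" "sq_integrable g" "AE t in I01. f t = g t" "x \<in> {0..1}"
  shows "primitive f x = primitive g x"
  unfolding primitive_eq_inner[OF assms(1,4)] primitive_eq_inner[OF assms(2,4)]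
  using l2_class_eqI[OF assms(1-3)] by simp

text \<open>Cauchy-Schwarz, the indicator having norm at most 1. Convergence of derivatives in
  \<open>l2\<close> thereby becomes uniform convergence of the primitives.\<close>

lemma abs_primitive_le:
  assumes f: "sq_integrable f" and x: "x \<in> {0..1}"
  shows "\<bar>primitive f x\<bar> \<le> norm (l2_class f)"
proof -
  have "\<bar>primitive f x\<bar> \<le> norm (l2_class f) * norm (l2_class (indicator {0..x}))"
    unfolding primitive_eq_inner[OF assms] by (rule Cauchy_Schwarz_ineq2)
  also have "\<dots> \<le> norm (l2_class f) * 1"
    by (intro mult_left_mono norm_l2_class_le)
       (use sq_integrable_indicator[of "{0..x}"] in \<open>auto simp: sq_integrable_def indicator_def\<close>)
  finally show ?thesis by simp
qed

section \<open>Test functions and the du Bois-Reymond lemma\<close>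

lemma test_function_continuous:
  assumes "test_function \<phi>"
  shows "continuous_on A \<phi>" "continuous_on A (deriv \<phi>)"
proof -
  have "\<phi> field_differentiable at x" "deriv \<phi> field_differentiable at x" for x
    using assms[unfolded test_function_def, THEN conjunct1, rule_format, of 0 x]
      assms[unfolded test_function_def, THEN conjunct1, rule_format, of 1 x] by simp_all
  then show "continuous_on A \<phi>" "continuous_on A (deriv \<phi>)"
    by (auto intro!: continuous_at_imp_continuous_on field_differentiable_imp_continuous_at)
qed

lemma test_function_zero:
  assumes "test_function \<phi>" "x \<notin> {0<..<1}"
  shows "\<phi> x = 0"
  using assms unfolding test_function_def by blast

lemma test_function_primitive:
  assumes \<phi>: "test_function \<phi>" and x: "x \<in> {0..1}"
  shows "primitive (deriv \<phi>) x = \<phi> x"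
proof -
  have "(deriv \<phi> has_integral (\<phi> x - \<phi> 0)) {0..x}"
  proof (rule fundamental_theorem_of_calculus)
    fix t
    have "\<phi> field_differentiable at t"
      using \<phi>[unfolded test_function_def, THEN conjunct1, rule_format, of 0 t] by simp
    then have "(\<phi> has_real_derivative deriv \<phi> t) (at t)"
      by (simp add: DERIV_deriv_iff_field_differentiable)
    then show "(\<phi> has_vector_derivative deriv \<phi> t) (at t within {0..x})"
      by (simp add: has_field_derivative_at_within has_real_derivative_iff_has_vector_derivative[symmetric])
  qed (use x in auto)
  then show ?thesis
    using test_function_zero[OF \<phi>, of 0] by (simp add: primitive_def integral_unique)
qed

lemma AE_I01_I:
  assumes "negligible N" "\<And>x. x \<in> {0..1} \<Longrightarrow> x \<notin> N \<Longrightarrow> P x"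
  shows "AE x in I01. P x"
proof -
  have "N \<in> null_sets lebesgue" using assms(1) by (simp add: negligible_iff_null_sets)
  then have "AE x in lebesgue. x \<in> {0..1} \<longrightarrow> P x"
    by (rule AE_I') (use assms(2) in auto)
  then show ?thesis by (simp add: AE_restrict_space_iff)
qed

text \<open>Passing to the limit along test functions whose derivatives approach a step function
  shows that the increments of the primitive of w are proportional to the length of the interval.
  Lebesgue differentiation turns this into a statement on w itself.\<close>

lemma du_bois_reymond:
  assumes w: "sq_integrable w"
    and orth: "\<And>\<phi>. test_function \<phi> \<Longrightarrow> (LINT x|I01. w x * deriv \<phi> x) = 0"
  obtains \<kappa> where "AE x in I01. w x = \<kappa>"
proof -
  have wm: "w \<in> borel_measurable I01" using w by (simp add: sq_integrable_def)
  \<comment> \<open>The mean of w over (1/4, 3/4], the interval used for compensation.\<close>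
  define \<kappa> where "\<kappa> = 2 * (primitive w (3/4) - primitive w (1/4))"
  have step: "primitive w d - primitive w c = \<kappa> * (d - c)" if cd: "0 < c" "c \<le> d" "d < 1" for c d
  proof -
    obtain \<phi> :: "nat \<Rightarrow> real \<Rightarrow> real"
      where \<phi>: "\<And>n. test_function (\<phi> n)" and bound: "\<And>n x. \<bar>deriv (\<phi> n) x\<bar> \<le> 4"
        and lim: "\<And>x. (\<lambda>n. deriv (\<phi> n) x) \<longlonglongrightarrow>
          indicator {c<..d} x - 2 * (d - c) * indicator {1/4<..3/4} x"
      using test_function_derivative_approximation[OF cd] by blast
    \<comment> \<open>The limit of the derivatives, rewritten with intervals that start at 0, whose
      integrals against w are values of \<open>primitive w\<close>.\<close>
    let ?g = "\<lambda>x. (indicator {0..d} x - indicator {0..c} x)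
        - 2 * (d - c) * (indicator {0..3/4} x - indicator {0..1/4} x) :: real"
    have sq: "sq_integrable (indicator {0..x})" for x :: real
      by (rule sq_integrable_indicator) simp
    then have ind: "(indicator {0..x} :: real \<Rightarrow> real) \<in> borel_measurable I01" for x :: real
      unfolding sq_integrable_def by blast
    have int: "integrable I01 (\<lambda>t. w t * indicator {0..x} t)" for x :: real
      by (rule sq_integrable_mult[OF w sq])
    have "(\<lambda>n. LINT x|I01. w x * deriv (\<phi> n) x) \<longlonglongrightarrow> (LINT x|I01. w x * ?g x)"
    proof (rule integral_dominated_convergence)
      show "(\<lambda>x. w x * ?g x) \<in> borel_measurable I01"
        using wm ind by measurable
      show "(\<lambda>x. w x * deriv (\<phi> n) x) \<in> borel_measurable I01" for n
        using wm continuous_on_measurable_I01[OF test_function_continuous(2)[OF \<phi>[of n]]] by measurable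
      show "integrable I01 (\<lambda>x. 4 * \<bar>w x\<bar>)"
        using sq_integrable_integrable[OF w] by simp
      show "AE x in I01. norm (w x * deriv (\<phi> n) x) \<le> 4 * \<bar>w x\<bar>" for n
        using mult_left_mono[OF bound[of n], of "\<bar>w _\<bar>"]
        by (intro AE_I2) (simp add: abs_mult mult.commute)
      show "AE x in I01. (\<lambda>n. w x * deriv (\<phi> n) x) \<longlonglongrightarrow> w x * ?g x"
      proof (rule AE_I2)
        fix x assume "x \<in> space I01"
        then have "?g x = indicator {c<..d} x - 2 * (d - c) * indicator {1/4<..3/4} x"
          using cd by (auto simp: indicator_def space_restrict_space)
        then show "(\<lambda>n. w x * deriv (\<phi> n) x) \<longlonglongrightarrow> w x * ?g x"
          using lim[of x] by (auto intro!: tendsto_mult)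
      qed
    qed
    then have "0 = (LINT x|I01. w x * ?g x)"
      using orth[OF \<phi>] by (simp add: LIMSEQ_const_iff)
    also have "\<dots> = (LINT x|I01. (w x * indicator {0..d} x - w x * indicator {0..c} x)
        - 2 * (d - c) * (w x * indicator {0..3/4} x - w x * indicator {0..1/4} x))"
      by (simp add: algebra_simps)
    also have "\<dots> = (primitive w d - primitive w c) - 2 * (d - c) * (primitive w (3/4) - primitive w (1/4))"
      using cd by (simp add: int primitive_eq_LINT[OF w] Bochner_Integration.integral_diff Bochner_Integration.integrable_diff)
    finally show ?thesis by (simp add: \<kappa>_def algebra_simps)
  qed
  \<comment> \<open>Cut off to zero outside the unit interval, so that it is integrable on every
    box, as the differentiation theorem requires.\<close>
  define f where "f x = (if x \<in> {0..1} then w x - \<kappa> else 0)" for x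
  have sqf: "sq_integrable (\<lambda>x. w x - \<kappa>)"
    by (intro sq_integrable_diff w sq_integrable_continuous continuous_intros)
  have fi: "f integrable_on cbox p q" for p q
  proof -
    have "(\<lambda>x. w x - \<kappa>) integrable_on {0..1}"
      by (rule sq_integrable_integrable_on[OF sqf]) simp
    then have "f integrable_on UNIV"
      unfolding f_def by (simp only: integrable_restrict_UNIV)
    then show ?thesis by (rule integrable_on_subcbox) simp
  qed
  \<comment> \<open>Lebesgue differentiation with right-hand averages: off a null set they converge
    to the value of f.\<close>
  have "\<exists>N. negligible N \<and> (\<forall>x e. x \<notin> N \<and> 0 < e \<longrightarrow> (\<exists>d>0. \<forall>h. 0 < h \<and> h < d \<longrightarrow>
      norm (integral (cbox x (x + h *\<^sub>R One)) f /\<^sub>R h ^ DIM(real) - f x) < e))"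
    by (rule integrable_ccontinuous_explicit[OF fi]) blast
  then obtain N where N: "negligible N"
    "\<And>x e. x \<notin> N \<Longrightarrow> 0 < e \<Longrightarrow> \<exists>d>0. \<forall>h. 0 < h \<and> h < d \<longrightarrow>
      norm (integral (cbox x (x + h *\<^sub>R One)) f /\<^sub>R h ^ DIM(real) - f x) < e"
    by blast
  have zero: "w x = \<kappa>" if x: "0 < x" "x < 1" "x \<notin> N" for x
  proof (rule ccontr)
    assume "w x \<noteq> \<kappa>"
    then have fx: "\<bar>f x\<bar> > 0" using x by (simp add: f_def)
    obtain d where d: "d > 0" "\<And>h. 0 < h \<Longrightarrow> h < d \<Longrightarrow>
        norm (integral (cbox x (x + h *\<^sub>R One)) f /\<^sub>R h ^ DIM(real) - f x) < \<bar>f x\<bar>"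
      using N(2)[OF x(3) fx] by blast
    \<comment> \<open>Small enough for the average over [x, x + h] to differ from f x by less than
      its modulus, and for x + h < 1, so that \<open>step\<close> makes this average exactly
      0.\<close>
    define h where "h = min (d / 2) ((1 - x) / 2)"
    have h: "0 < h" "h < d" "x + h < 1" using d x by (auto simp: h_def min_def field_simps)
    have "integral {x..x + h} f = integral {x..x + h} (\<lambda>x. w x - \<kappa>)"
      using x h by (intro integral_cong) (auto simp: f_def)
    also have "\<dots> = integral {x..x + h} w - \<kappa> * h"
      using x h by (subst Henstock_Kurzweil_Integration.integral_diff)
        (auto intro!: sq_integrable_integrable_on[OF w])
    also have "\<dots> = 0"
      using step[of x "x + h"] primitive_diff[OF w, of x "x + h"] x h by simp
    finally show False using d(2)[OF h(1,2)] by simp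
  qed
  have "AE x in I01. w x = \<kappa>"
  proof (rule AE_I01_I)
    show "negligible (N \<union> {0, 1})" using N(1) by (simp add: negligible_Un)
  next
    fix x :: real assume "x \<in> {0..1}" "x \<notin> N \<union> {0, 1}"
    then show "w x = \<kappa>" by (intro zero) auto
  qed
  then show thesis by (rule that)
qed

section \<open>Regularity of the weak solution\<close>

lemma H01_test_function:
  "test_function \<phi> \<Longrightarrow> (l2_class \<phi>, l2_class (deriv \<phi>)) \<in> H01"
  unfolding H01_def by (rule subsetD[OF closure_subset]) blast

text \<open>Test functions are the primitives of their derivatives, and taking primitives is bounded
  on \<open>l2\<close>, so the relation survives the closure. The zero boundary value at 0 is what
  leaves no constant of integration.\<close>

lemma H01_primitive:
  assumes "(u, u') \<in> H01"
  shows "u = l2_class (primitive (l2_fun u'))"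
proof -
  let ?w = "l2_fun u'"
  obtain z where z: "\<And>n. z n \<in> {(l2_class \<phi>, l2_class (deriv \<phi>)) | \<phi>. test_function \<phi>}"
    and lim: "z \<longlonglongrightarrow> (u, u')"
    using assms unfolding H01_def closure_sequential by blast
  have "\<forall>n. \<exists>\<phi>. test_function \<phi> \<and> z n = (l2_class \<phi>, l2_class (deriv \<phi>))"
    using z by blast
  then obtain \<phi> where \<phi>: "\<And>n. test_function (\<phi> n)"
    and z_eq: "\<And>n. z n = (l2_class (\<phi> n), l2_class (deriv (\<phi> n)))"
    by metis
  have lim1: "(\<lambda>n. l2_class (\<phi> n)) \<longlonglongrightarrow> u" and lim2: "(\<lambda>n. l2_class (deriv (\<phi> n))) \<longlonglongrightarrow> u'"
    using tendsto_fst[OF lim] tendsto_snd[OF lim] by (simp_all add: z_eq)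
  have sq\<phi>: "sq_integrable (\<phi> n)" "sq_integrable (deriv (\<phi> n))" for n
    using \<phi> by (auto intro!: sq_integrable_continuous test_function_continuous)
  have sqP: "sq_integrable (primitive ?w)"
    by (intro sq_integrable_continuous continuous_on_primitive l2_fun_sq_integrable)
  have le: "norm (l2_class (\<phi> n) - l2_class (primitive ?w)) \<le> norm (l2_class (deriv (\<phi> n)) - u')" for n
  proof -
    have "\<bar>\<phi> n x - primitive ?w x\<bar> \<le> norm (l2_class (deriv (\<phi> n)) - u')" if x: "x \<in> {0..1}" for x
    proof -
      have "\<phi> n x - primitive ?w x = primitive (\<lambda>t. deriv (\<phi> n) t - ?w t) x"
        unfolding test_function_primitive[OF \<phi> x, symmetric] unfolding primitive_def
        using x by (intro Henstock_Kurzweil_Integration.integral_diff[symmetric] sq_integrable_integrable_on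
            sq\<phi> l2_fun_sq_integrable) auto
      also have "\<bar>\<dots>\<bar> \<le> norm (l2_class (\<lambda>t. deriv (\<phi> n) t - ?w t))"
        by (intro abs_primitive_le sq_integrable_diff sq\<phi> l2_fun_sq_integrable x)
      also have "\<dots> = norm (l2_class (deriv (\<phi> n)) - u')"
        using minus_l2_class[OF sq\<phi>(2)[of n] l2_fun_sq_integrable[of u']] by (simp add: l2_class_l2_fun)
      finally show ?thesis .
    qed
    then show ?thesis
      unfolding minus_l2_class[OF sq\<phi>(1) sqP]
      using sq_integrable_diff[OF sq\<phi>(1) sqP]
      by (intro norm_l2_class_le) (auto simp: sq_integrable_def)
  qed
  have "(\<lambda>n. l2_class (deriv (\<phi> n)) - u') \<longlonglongrightarrow> u' - u'"
    by (intro tendsto_diff lim2 tendsto_const)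
  then have "(\<lambda>n. norm (l2_class (deriv (\<phi> n)) - u')) \<longlonglongrightarrow> 0"
    by (simp add: tendsto_norm_zero)
  then have "(\<lambda>n. l2_class (\<phi> n) - l2_class (primitive ?w)) \<longlonglongrightarrow> 0"
    by (rule Lim_null_comparison[rotated]) (use le in auto)
  then have "(\<lambda>n. l2_class (\<phi> n)) \<longlonglongrightarrow> l2_class (primitive ?w)"
    by (simp add: LIM_zero_iff)
  with lim1 show ?thesis by (rule LIMSEQ_unique)
qed

text \<open>Integration by parts for a factor r that is merely square-integrable, so that its
  primitive need not be differentiable everywhere. Fubini on the triangle s \<le> t replaces the
  product rule, and the boundary term drops out because \<phi> vanishes at both end points.\<close>

lemma LINT_mult_test_function:
  assumes r: "sq_integrable r" and \<phi>: "test_function \<phi>"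
  shows "(LINT x|I01. r x * \<phi> x) = - (LINT x|I01. primitive r x * deriv \<phi> x)"
proof -
  interpret P: prob_space I01 by (rule prob_space_I01)
  interpret pair_sigma_finite I01 I01 ..
  have rm: "r \<in> borel_measurable I01" using r by (simp add: sq_integrable_def)
  have cont: "continuous_on {0..1} \<phi>" "continuous_on {0..1} (deriv \<phi>)"
    using \<phi> by (auto intro: test_function_continuous)
  then have dm: "deriv \<phi> \<in> borel_measurable I01" by (intro continuous_on_measurable_I01)
  have sqd: "sq_integrable (deriv \<phi>)" by (intro sq_integrable_continuous cont)
  have "bounded (deriv \<phi> ` {0..1})"
    by (intro compact_imp_bounded compact_continuous_image cont) simp
  then obtain B where B: "\<And>x. x \<in> {0..1} \<Longrightarrow> \<bar>deriv \<phi> x\<bar> \<le> B"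
    unfolding bounded_iff by (metis imageI real_norm_def)
  have id: "(\<lambda>x. x) \<in> borel_measurable I01"
    by (intro continuous_on_measurable_I01 continuous_intros)
  \<comment> \<open>As \<phi> t is the integral of its derivative over [0, t], the left side is the
    double integral of \<open>?k\<close>; integrating over t first leaves the tail of r beyond
    s.\<close>
  let ?k = "\<lambda>t s. r t * (deriv \<phi> s * (if s \<le> t then 1 else 0))"
  have km: "case_prod ?k \<in> borel_measurable (I01 \<Otimes>\<^sub>M I01)"
  proof -
    have [measurable]: "(\<lambda>z. r (fst z)) \<in> borel_measurable (I01 \<Otimes>\<^sub>M I01)"
      "(\<lambda>z. deriv \<phi> (snd z)) \<in> borel_measurable (I01 \<Otimes>\<^sub>M I01)"
      "(\<lambda>z. fst z) \<in> borel_measurable (I01 \<Otimes>\<^sub>M I01)"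
      "(\<lambda>z. snd z) \<in> borel_measurable (I01 \<Otimes>\<^sub>M I01)"
      using measurable_compose[OF measurable_fst rm] measurable_compose[OF measurable_snd dm]
        measurable_compose[OF measurable_fst id] measurable_compose[OF measurable_snd id] by blast+
    show ?thesis unfolding split_beta' by measurable
  qed
  have "integrable (I01 \<Otimes>\<^sub>M I01) (case_prod ?k)"
  proof (rule Bochner_Integration.integrable_bound)
    have "integrable (distr (I01 \<Otimes>\<^sub>M I01) I01 fst) r"
      unfolding P.distr_pair_fst by (rule sq_integrable_integrable[OF r])
    then have "integrable (I01 \<Otimes>\<^sub>M I01) (\<lambda>z. r (fst z))"
      by (rule integrable_distr[OF measurable_fst])
    then show "integrable (I01 \<Otimes>\<^sub>M I01) (\<lambda>z. r (fst z) * B)"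
      by simp
    show "AE z in I01 \<Otimes>\<^sub>M I01. norm (case_prod ?k z) \<le> norm (r (fst z) * B)"
    proof (rule AE_I2)
      fix z assume "z \<in> space (I01 \<Otimes>\<^sub>M I01)"
      then have "\<bar>deriv \<phi> (snd z)\<bar> \<le> B"
        by (intro B) (auto simp: space_pair_measure space_restrict_space)
      then show "norm (case_prod ?k z) \<le> norm (r (fst z) * B)"
        by (auto simp: split_beta abs_mult intro!: mult_left_mono)
    qed
  qed (rule km)
  then have swap: "(LINT s|I01. LINT t|I01. ?k t s) = (LINT t|I01. LINT s|I01. ?k t s)"
    by (rule Fubini_integral)
  have right: "(LINT t|I01. r t * (if s \<le> t then 1 else 0)) = primitive r 1 - primitive r s"
    if s: "s \<in> {0..1}" for s
  proof -
    have "(LINT t|I01. r t * (if s \<le> t then 1 else 0)) = (LINT t|I01. r t * indicator {s..1} t)"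
      by (rule Bochner_Integration.integral_cong) (auto simp: indicator_def space_restrict_space)
    also have "\<dots> = integral {s..1} r"
      using s by (intro integral_eq_LINT_indicator[OF r, symmetric]) auto
    finally show ?thesis using s primitive_diff[OF r, of s 1] by simp
  qed
  have "(LINT t|I01. r t * \<phi> t) = (LINT t|I01. LINT s|I01. ?k t s)"
  proof (rule Bochner_Integration.integral_cong[OF refl])
    fix t assume "t \<in> space I01"
    then have t: "t \<in> {0..1}" by (simp add: space_restrict_space)
    have "\<phi> t = (LINT s|I01. deriv \<phi> s * indicator {0..t} s)"
      using test_function_primitive[OF \<phi> t] primitive_eq_LINT[OF sqd t] by simp
    also have "\<dots> = (LINT s|I01. deriv \<phi> s * (if s \<le> t then 1 else 0))"
      by (rule Bochner_Integration.integral_cong) (auto simp: indicator_def space_restrict_space)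
    finally show "r t * \<phi> t = (LINT s|I01. ?k t s)" by simp
  qed
  also have "\<dots> = (LINT s|I01. deriv \<phi> s * (primitive r 1 - primitive r s))"
    unfolding swap[symmetric]
  proof (rule Bochner_Integration.integral_cong[OF refl])
    fix s assume "s \<in> space I01"
    then have s: "s \<in> {0..1}" by (simp add: space_restrict_space)
    have "(LINT t|I01. ?k t s) = (LINT t|I01. deriv \<phi> s * (r t * (if s \<le> t then 1 else 0)))"
      by (simp add: ac_simps)
    also have "\<dots> = deriv \<phi> s * (primitive r 1 - primitive r s)"
      using right[OF s] by simp
    finally show "(LINT t|I01. ?k t s) = deriv \<phi> s * (primitive r 1 - primitive r s)" .
  qed
  also have "\<dots> = (LINT s|I01. primitive r 1 * deriv \<phi> s - primitive r s * deriv \<phi> s)"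
    by (simp add: algebra_simps)
  also have "\<dots> = primitive r 1 * (LINT s|I01. deriv \<phi> s) - (LINT s|I01. primitive r s * deriv \<phi> s)"
    using sq_integrable_mult[OF sq_integrable_continuous[OF continuous_on_primitive[OF r]] sqd]
      sq_integrable_integrable[OF sqd] by simp
  also have "(LINT s|I01. deriv \<phi> s) = 0"
    using lebesgue_integral_eq_integral[OF sq_integrable_integrable[OF sqd]]
      test_function_primitive[OF \<phi>, of 1] test_function_zero[OF \<phi>, of 1] by (simp add: primitive_def)
  finally show ?thesis by simp
qed

text \<open>Testing with \<open>\<phi>\<close> shows that \<open>\<epsilon> u' - \<integral> (a u' + b u - f)\<close> is constant, so \<open>u'\<close> has a
  continuous representative.\<close>

lemma weak_solution_C1:
  assumes "\<epsilon> \<noteq> 0" and a: "continuous_on {0..1} a" and b: "continuous_on {0..1} b"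
    and "weak_solution \<epsilon> a b f u"
  obtains g where "C1_unit g" "represents g u"
proof -
  obtain u' where H: "(u, u') \<in> H01" and eq: "\<And>v v'. (v, v') \<in> H01 \<Longrightarrow>
      \<epsilon> * inner u' v' + (LINT x|I01. a x * l2_fun u' x * l2_fun v x)
        + (LINT x|I01. b x * l2_fun u x * l2_fun v x) = inner f v"
    using assms(4) unfolding weak_solution_def by blast
  define w where "w = l2_fun u'"
  define v where "v = l2_fun u"
  define F where "F = l2_fun f"
  have sq: "sq_integrable w" "sq_integrable v" "sq_integrable F"
    by (auto simp: w_def v_def F_def l2_fun_sq_integrable)
  define r where "r x = (a x * w x + b x * v x) - F x" for x
  have sqaw: "sq_integrable (\<lambda>x. a x * w x)" and sqbv: "sq_integrable (\<lambda>x. b x * v x)"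
    by (intro sq_integrable_continuous_mult a b sq)+
  have sqr: "sq_integrable r"
    unfolding r_def by (intro sq_integrable_diff sq_integrable_add sqaw sqbv sq)
  have contP: "continuous_on {0..1} (primitive r)" by (rule continuous_on_primitive[OF sqr])
  have sqd: "sq_integrable (\<lambda>x. \<epsilon> * w x - primitive r x)"
    by (intro sq_integrable_diff sq_integrable_scale sq sq_integrable_continuous contP)
  have orth: "(LINT x|I01. (\<epsilon> * w x - primitive r x) * deriv \<phi> x) = 0" if \<phi>: "test_function \<phi>" for \<phi>
  proof -
    have sq\<phi>: "sq_integrable \<phi>" "sq_integrable (deriv \<phi>)"
      using \<phi> by (auto intro!: sq_integrable_continuous test_function_continuous)
    have \<phi>m: "\<phi> \<in> borel_measurable I01" and lm: "l2_fun (l2_class \<phi>) \<in> borel_measurable I01"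
      using sq\<phi> l2_fun_sq_integrable by (auto simp: sq_integrable_def)
    \<comment> \<open>The weak formulation sees \<phi> only through the representative
      \<open>l2_fun (l2_class \<phi>)\<close>, which agrees with it almost everywhere.\<close>
    have cong: "(LINT x|I01. h x * l2_fun (l2_class \<phi>) x) = (LINT x|I01. h x * \<phi> x)"
      if "sq_integrable h" for h
    proof (rule integral_cong_AE)
      show "AE x in I01. h x * l2_fun (l2_class \<phi>) x = h x * \<phi> x"
        using l2_fun_l2_class[OF sq\<phi>(1)] by eventually_elim simp
    qed (use that \<phi>m lm in \<open>auto simp: sq_integrable_def\<close>)
    have iw: "inner u' (l2_class (deriv \<phi>)) = (LINT x|I01. w x * deriv \<phi> x)"
      using inner_l2_class[OF sq(1) sq\<phi>(2)] by (simp add: w_def l2_class_l2_fun)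
    have iF: "inner f (l2_class \<phi>) = (LINT x|I01. F x * \<phi> x)"
      using inner_l2_class[OF sq(3) sq\<phi>(1)] by (simp add: F_def l2_class_l2_fun)
    have E: "\<epsilon> * (LINT x|I01. w x * deriv \<phi> x) + (LINT x|I01. a x * w x * \<phi> x)
        + (LINT x|I01. b x * v x * \<phi> x) = (LINT x|I01. F x * \<phi> x)"
      using eq[OF H01_test_function[OF \<phi>]] cong[OF sqaw] cong[OF sqbv]
      unfolding iw iF w_def[symmetric] v_def[symmetric] by simp
    have "(LINT x|I01. r x * \<phi> x) =
        (LINT x|I01. (a x * w x * \<phi> x + b x * v x * \<phi> x) - F x * \<phi> x)"
      by (simp add: r_def algebra_simps)
    also have "\<dots> = (LINT x|I01. a x * w x * \<phi> x) + (LINT x|I01. b x * v x * \<phi> x) - (LINT x|I01. F x * \<phi> x)"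
      by (simp add: sq_integrable_mult sqaw sqbv sq sq\<phi>)
    finally have R: "(LINT x|I01. r x * \<phi> x) = - \<epsilon> * (LINT x|I01. w x * deriv \<phi> x)"
      using E by simp
    have "(LINT x|I01. (\<epsilon> * w x - primitive r x) * deriv \<phi> x) =
        (LINT x|I01. \<epsilon> * (w x * deriv \<phi> x) - primitive r x * deriv \<phi> x)"
      by (simp add: algebra_simps)
    also have "\<dots> = \<epsilon> * (LINT x|I01. w x * deriv \<phi> x) - (LINT x|I01. primitive r x * deriv \<phi> x)"
      by (simp add: sq_integrable_mult sq sq\<phi> sq_integrable_continuous[OF contP])
    also have "\<dots> = 0" using R LINT_mult_test_function[OF sqr \<phi>] by simp
    finally show ?thesis .
  qed
  obtain \<kappa> where \<kappa>: "AE x in I01. \<epsilon> * w x - primitive r x = \<kappa>"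
    using du_bois_reymond[OF sqd orth] by blast
  define q where "q x = (primitive r x + \<kappa>) / \<epsilon>" for x
  have q: "continuous_on {0..1} q"
    unfolding q_def using \<open>\<epsilon> \<noteq> 0\<close> by (intro continuous_intros contP) auto
  have "AE x in I01. w x = q x"
    using \<kappa> by eventually_elim (use \<open>\<epsilon> \<noteq> 0\<close> in \<open>auto simp: q_def field_simps\<close>)
  then have prim: "primitive w x = primitive q x" if "x \<in> {0..1}" for x
    by (intro primitive_cong_AE sq sq_integrable_continuous q that)
  have sqp: "sq_integrable (primitive q)" "sq_integrable (primitive w)"
    by (intro sq_integrable_continuous continuous_on_primitive q sq)+
  \<comment> \<open>Membership in \<open>H01\<close> makes u the primitive of its weak derivative,
    for which the continuous version q may now be substituted.\<close>
  have "u = l2_class (primitive q)"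
    unfolding H01_primitive[OF H] w_def[symmetric]
    using prim by (intro l2_class_eqI sqp AE_I2) (simp add: space_restrict_space)
  then have "represents (primitive q) u" using sqp by (simp add: represents_def)
  moreover have "C1_unit (primitive q)"
    unfolding C1_unit_def using q primitive_has_derivative[OF q] by blast
  ultimately show thesis by (intro that)
qed

section \<open>Point values recovered from classes\<close>

text \<open>The left side depends on the class alone. This yields uniqueness of the continuous
  representative and, applied to \<open>G f\<close>, measurability of its point values.\<close>

lemma represents_derivative:
  assumes g: "continuous_on {0..1} g" "represents g u" and x: "x \<in> {0..1}"
  shows "((\<lambda>x. inner u (l2_class (indicator {0..x}))) has_real_derivative g x) (at x within {0..1})"
proof -
  have "(primitive g has_real_derivative g x) (at x within {0..1})"
    by (rule primitive_has_derivative[OF g(1) x])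
  then show ?thesis
    by (rule has_field_derivative_transform_within[where d = 1])
       (use g x in \<open>auto simp: represents_def primitive_eq_inner\<close>)
qed

lemma represents_unique:
  assumes "continuous_on {0..1} g" "represents g u" "continuous_on {0..1} h" "represents h u" "x \<in> {0..1}"
  shows "g x = h x"
proof -
  have "(at x within {0..1}) \<noteq> bot"
    using assms(5) by (simp add: trivial_limit_within islimpt_Icc)
  then show ?thesis
    using represents_derivative[OF assms(1,2,5)] represents_derivative[OF assms(3,4,5)]
    unfolding has_real_derivative_iff_has_vector_derivative
    by (rule vector_derivative_unique_within)
qed

text \<open>\<open>cont_rep\<close> is chosen merely as some continuous representative; uniqueness
  on the unit interval carries over to it the regularity of the representative obtained from the
  equation.\<close>

lemma solution_operator_C1:
  assumes "\<epsilon> > 0" "C1_unit a" "C1_unit b" "solution_operator \<epsilon> a b G"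
  shows "C1_unit (cont_rep (G f))" and "represents (cont_rep (G f)) (G f)"
    and "continuous_on {0..1} (cont_rep (G f))"
proof -
  have C1_cont: "continuous_on {0..1} g" if "C1_unit g" for g
    using that unfolding C1_unit_def by (metis DERIV_continuous_on)
  have "weak_solution \<epsilon> a b f (G f)"
    using assms(4) by (simp add: solution_operator_def)
  then obtain g where g: "C1_unit g" "represents g (G f)"
    using weak_solution_C1[of \<epsilon> a b f "G f"] assms C1_cont by blast
  have *: "continuous_on {0..1} (cont_rep (G f)) \<and> represents (cont_rep (G f)) (G f)"
    unfolding cont_rep_def by (rule someI[of _ g]) (use g C1_cont in blast)
  then show "represents (cont_rep (G f)) (G f)" "continuous_on {0..1} (cont_rep (G f))"
    by auto
  have eq: "cont_rep (G f) x = g x" if "x \<in> {0..1}" for x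
    using * g C1_cont that by (intro represents_unique[of _ "G f"]) auto
  obtain g' where g': "continuous_on {0..1} g'"
    "\<And>x. x \<in> {0..1} \<Longrightarrow> (g has_real_derivative g' x) (at x within {0..1})"
    using g(1) unfolding C1_unit_def by blast
  have "(cont_rep (G f) has_real_derivative g' x) (at x within {0..1})" if "x \<in> {0..1}" for x
    by (rule has_field_derivative_transform_within[OF g'(2)[OF that], where d = 1])
       (use that eq in auto)
  with g'(1) show "C1_unit (cont_rep (G f))"
    unfolding C1_unit_def by blast
qed

section \<open>Measurability of families and the quadrature error\<close>

text \<open>Continuity and measurability are known only for arguments in the unit interval.
  Composition with this retraction gives functions on the whole line, to which Borel measurability
  on a product applies.\<close>

definition clamp01 :: "real \<Rightarrow> real" where
  "clamp01 x = max 0 (min 1 x)"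

lemma clamp01_in: "clamp01 x \<in> {0..1}"
  by (auto simp: clamp01_def)

lemma clamp01_id: "x \<in> {0..1} \<Longrightarrow> clamp01 x = x"
  by (auto simp: clamp01_def)

lemma clamp01_measurable [measurable]: "clamp01 \<in> borel_measurable borel"
  unfolding clamp01_def by measurable

lemma borel_measurable_family_at_1:
  fixes h :: "'a \<Rightarrow> real \<Rightarrow> real"
  assumes meas: "\<And>x. 0 \<le> x \<Longrightarrow> x < 1 \<Longrightarrow> (\<lambda>f. h f x) \<in> borel_measurable M"
    and cont: "\<And>f. continuous_on {0..1} (h f)"
  shows "(\<lambda>f. h f 1) \<in> borel_measurable M"
proof (rule borel_measurable_LIMSEQ_real)
  define x where "x n = 1 - inverse (real (Suc n))" for n
  have x: "0 \<le> x n" "x n < 1" for n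
  proof -
    have "inverse (real (Suc n)) \<le> 1" "inverse (real (Suc n)) > 0"
      by (auto simp: inverse_le_1_iff)
    then show "0 \<le> x n" "x n < 1" unfolding x_def by linarith+
  qed
  show "(\<lambda>f. h f (x n)) \<in> borel_measurable M" for n
    using x by (rule meas)
  have lim: "x \<longlonglongrightarrow> 1"
    unfolding x_def using tendsto_diff[OF tendsto_const[of 1] LIMSEQ_inverse_real_of_nat] by simp
  show "(\<lambda>n. h f (x n)) \<longlonglongrightarrow> h f 1" for f
    by (rule continuous_on_tendsto_compose[OF cont lim]) (use x in \<open>auto intro!: always_eventually less_imp_le\<close>)
qed

text \<open>A derivative is a limit of difference quotients, each of them measurable in f. The
  quotients are taken to the right, which is possible for x < 1; the value at 1 follows by
  continuity of the derivative.\<close>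

lemma borel_measurable_family_derivative:
  fixes h h' :: "'a \<Rightarrow> real \<Rightarrow> real"
  assumes meas: "\<And>x. x \<in> {0..1} \<Longrightarrow> (\<lambda>f. h f x) \<in> borel_measurable M"
    and deriv: "\<And>f x. x \<in> {0..1} \<Longrightarrow> (h f has_real_derivative h' f x) (at x within {0..1})"
    and cont: "\<And>f. continuous_on {0..1} (h' f)"
    and x: "x \<in> {0..1}"
  shows "(\<lambda>f. h' f x) \<in> borel_measurable M"
proof -
  have *: "(\<lambda>f. h' f y) \<in> borel_measurable M" if y: "0 \<le> y" "y < 1" for y
  proof (rule borel_measurable_LIMSEQ_real)
    define z where "z n = y + (1 - y) * inverse (real (Suc n))" for n
    have z: "z n \<noteq> y" "z n \<in> {0..1}" for n
    proof -
      define r where "r = inverse (real (Suc n))"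
      have "r \<le> 1" "r > 0"
        by (auto simp: r_def inverse_le_1_iff)
      then have "(1 - y) * r \<le> (1 - y) * 1" "(1 - y) * r > 0"
        using y by (intro mult_left_mono mult_pos_pos; simp)+
      then show "z n \<noteq> y" "z n \<in> {0..1}"
        using y unfolding z_def r_def[symmetric] atLeastAtMost_iff mult_1_right by linarith+
    qed
    have "(\<lambda>n. y + (1 - y) * inverse (real (Suc n))) \<longlonglongrightarrow> y + (1 - y) * 0"
      by (intro tendsto_intros LIMSEQ_inverse_real_of_nat)
    moreover have "z = (\<lambda>n. y + (1 - y) * inverse (real (Suc n)))"
      by (simp add: fun_eq_iff z_def)
    ultimately have lim: "z \<longlonglongrightarrow> y" by (simp only: mult_zero_right add_0_right)
    have "filterlim z (at y within {0..1}) sequentially"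
      unfolding filterlim_at using lim z by simp
    then show "(\<lambda>n. (h f (z n) - h f y) / (z n - y)) \<longlonglongrightarrow> h' f y" for f
      using deriv[of y f] y unfolding has_field_derivative_iff by (auto intro: filterlim_compose)
    show "(\<lambda>f. (h f (z n) - h f y) / (z n - y)) \<in> borel_measurable M" for n
      using meas[OF z(2)[of n]] meas[of y] y by simp
  qed
  show ?thesis
  proof (cases "x < 1")
    case True then show ?thesis using * x by simp
  next
    case False
    then have "x = 1" using x by simp
    then show ?thesis using borel_measurable_family_at_1[OF * cont] by simp
  qed
qed

text \<open>Rounding x down to a grid of width 1 / (n + 1) leaves countably many sections, each
  measurable in f; continuity in x gives convergence as the grid is refined.\<close>

lemma borel_measurable_Caratheodory:
  fixes h :: "'a \<Rightarrow> real \<Rightarrow> real"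
  assumes meas: "\<And>x. x \<in> {0..1} \<Longrightarrow> (\<lambda>f. h f x) \<in> borel_measurable M"
    and cont: "\<And>f. continuous_on {0..1} (h f)"
  shows "(\<lambda>z. h (fst z) (clamp01 (snd z))) \<in> borel_measurable (M \<Otimes>\<^sub>M borel)"
proof (rule borel_measurable_LIMSEQ_real)
  define q where "q n x = real_of_int \<lfloor>real (Suc n) * clamp01 x\<rfloor> / real (Suc n)" for n x
  show "(\<lambda>z. h (fst z) (clamp01 (q n (snd z)))) \<in> borel_measurable (M \<Otimes>\<^sub>M borel)" for n
  proof -
    have "(\<lambda>z. h (fst z) (clamp01 (real_of_int i / real (Suc n)))) \<in> borel_measurable (M \<Otimes>\<^sub>M borel)" for i
      by (rule measurable_compose[OF measurable_fst meas[OF clamp01_in]])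
    moreover have "(\<lambda>z. \<lfloor>real (Suc n) * clamp01 (snd z)\<rfloor>) \<in> measurable (M \<Otimes>\<^sub>M borel) (count_space UNIV)"
      by measurable
    ultimately show ?thesis
      unfolding q_def by (rule measurable_compose_countable)
  qed
  show "(\<lambda>n. h (fst z) (clamp01 (q n (snd z)))) \<longlonglongrightarrow> h (fst z) (clamp01 (snd z))" for z
  proof (rule continuous_on_tendsto_compose[OF cont])
    have q: "\<bar>q n x - clamp01 x\<bar> \<le> inverse (real (Suc n))" for n x
    proof -
      have "\<bar>real_of_int \<lfloor>real (Suc n) * clamp01 x\<rfloor> - real (Suc n) * clamp01 x\<bar> \<le> 1"
        by linarith
      moreover have "q n x - clamp01 x = (real_of_int \<lfloor>real (Suc n) * clamp01 x\<rfloor> - real (Suc n) * clamp01 x) / real (Suc n)"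
        unfolding q_def by (simp add: diff_divide_distrib)
      ultimately show ?thesis
        by (simp add: divide_inverse abs_mult mult_left_le_one_le)
    qed
    have "\<bar>clamp01 t - clamp01 x\<bar> \<le> \<bar>t - clamp01 x\<bar>" for t x
      by (auto simp: clamp01_def max_def min_def)
    then have le: "\<bar>clamp01 (q n x) - clamp01 x\<bar> \<le> inverse (real (Suc n))" for n x
      using q order_trans by blast
    have "(\<lambda>n. clamp01 (q n (snd z)) - clamp01 (snd z)) \<longlonglongrightarrow> 0"
      by (rule Lim_null_comparison[OF always_eventually LIMSEQ_inverse_real_of_nat]) (use le in auto)
    then show "(\<lambda>n. clamp01 (q n (snd z))) \<longlonglongrightarrow> clamp01 (snd z)"
      by (simp add: LIM_zero_iff)
  qed (intro always_eventually allI clamp01_in)+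
qed

text \<open>Lipschitz continuity of G makes the pairings of \<open>G f\<close> with indicators
  continuous in f; the point values are their derivatives in x.\<close>

lemma cont_rep_measurable:
  assumes G: "L-lipschitz_on UNIV G"
    and rep: "\<And>f. represents (cont_rep (G f)) (G f)"
    and cont: "\<And>f. continuous_on {0..1} (cont_rep (G f))"
    and y: "y \<in> {0..1}"
  shows "(\<lambda>f. cont_rep (G f) y) \<in> borel_measurable borel"
proof (rule borel_measurable_family_derivative[OF _ represents_derivative[OF cont rep] cont y])
  show "(\<lambda>f. inner (G f) (l2_class (indicator {0..x}))) \<in> borel_measurable borel" for x
    using lipschitz_on_continuous_on[OF G]
    by (intro borel_measurable_continuous_onI continuous_intros)
qed

text \<open>Lebesgue measure on the unit interval, on the Borel sets of the whole line.\<close>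

definition unit_measure :: "real measure" where
  "unit_measure = density lborel (\<lambda>x. ennreal (indicator {0..1} x))"

lemma sets_unit_measure [measurable_cong, simp]: "sets unit_measure = sets borel"
  by (simp add: unit_measure_def)

lemma space_unit_measure [simp]: "space unit_measure = UNIV"
  by (simp add: unit_measure_def)

lemma nn_integral_unit_measure:
  assumes "f \<in> borel_measurable borel"
  shows "(\<integral>\<^sup>+x. f x \<partial>unit_measure) = (\<integral>\<^sup>+x. f x \<partial>I01)"
  using assms
  by (simp add: unit_measure_def nn_integral_density nn_integral_restrict_space nn_integral_completion
      mult.commute ennreal_indicator)

lemma prob_space_unit_measure: "prob_space unit_measure"
proof (rule prob_spaceI)
  have "(\<integral>\<^sup>+x. 1 \<partial>unit_measure) = (\<integral>\<^sup>+x. 1 \<partial>I01)"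
    by (rule nn_integral_unit_measure) simp
  then show "emeasure unit_measure (space unit_measure) = 1"
    using prob_space.emeasure_space_1[OF prob_space_I01] by simp
qed

lemma AE_unit_measure: "AE x in unit_measure. x \<in> {0..1}"
  unfolding unit_measure_def by (subst AE_density) (auto simp: indicator_def)

section \<open>Right-endpoint quadrature and the Shishkin mesh\<close>

text \<open>On one cell g differs from its value at the right end by at most the integral of |g'|
  over that cell. Integrating costs a factor of the cell width, and the variations add up over the
  cells.\<close>

lemma quadrature_error:
  fixes g g' y :: "_ \<Rightarrow> real"
  assumes deriv: "\<And>x. x \<in> {0..1} \<Longrightarrow> (g has_real_derivative g' x) (at x within {0..1})"
    and cont: "continuous_on {0..1} g'"
    and y: "y 0 = 0" "y J = 1" "\<And>j. j < J \<Longrightarrow> y j \<le> y (Suc j)" "\<And>j. j < J \<Longrightarrow> y (Suc j) - y j \<le> \<delta>"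
  shows "\<bar>integral {0..1} g - (\<Sum>j<J. (y (Suc j) - y j) * g (y (Suc j)))\<bar> \<le> \<delta> * integral {0..1} (\<lambda>x. \<bar>g' x\<bar>)"
proof -
  have y_mono: "y i \<le> y j" if "i \<le> j" "j \<le> J" for i j
    using that(1,2)
  proof (induction j rule: dec_induct)
    case (step k)
    then show ?case using y(3)[of k] by simp
  qed simp
  have contg: "continuous_on {0..1} g" using deriv by (rule DERIV_continuous_on)
  have contg': "continuous_on {0..1} (\<lambda>x. \<bar>g' x\<bar>)" by (intro continuous_intros cont)
  have int: "h integrable_on {c..d}" if "continuous_on {0..1} h" "0 \<le> c" "d \<le> 1" for h :: "real \<Rightarrow> real" and c d
    by (rule integrable_continuous_real[OF continuous_on_subset[OF that(1)]]) (use that in auto)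
  have "\<bar>integral {0..y k} g - (\<Sum>j<k. (y (Suc j) - y j) * g (y (Suc j)))\<bar>
      \<le> \<delta> * integral {0..y k} (\<lambda>x. \<bar>g' x\<bar>)" if "k \<le> J" for k
    using that
  proof (induction k)
    case 0 then show ?case by (simp add: y(1))
  next
    case (Suc k)
    let ?a = "y k" and ?b = "y (Suc k)"
    have ab: "0 \<le> ?a" "?a \<le> ?b" "?b \<le> 1"
      using y_mono[of 0 k] y_mono[of k "Suc k"] y_mono[of "Suc k" J] Suc.prems y(1,2) by auto
    let ?D = "integral {?a..?b} (\<lambda>x. \<bar>g' x\<bar>)"
    have D: "?D \<ge> 0" by (rule integral_nonneg[OF int[OF contg']]) (use ab in auto)
    have pt: "\<bar>g x - g ?b\<bar> \<le> ?D" if x: "x \<in> {?a..?b}" for x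
    proof -
      have "(g' has_integral (g ?b - g x)) {x..?b}"
      proof (rule fundamental_theorem_of_calculus)
        fix t assume "t \<in> {x..?b}"
        then show "(g has_vector_derivative g' t) (at t within {x..?b})"
          using x ab
          by (intro has_vector_derivative_within_subset[OF
                deriv[unfolded has_real_derivative_iff_has_vector_derivative]]) auto
      qed (use x in auto)
      then have "g ?b - g x = integral {x..?b} g'" by (simp add: integral_unique)
      also have "\<bar>\<dots>\<bar> \<le> integral {x..?b} (\<lambda>x. \<bar>g' x\<bar>)"
      proof -
        have "norm (integral {x..?b} g') \<le> integral {x..?b} (\<lambda>x. \<bar>g' x\<bar>)"
          using x ab by (intro integral_norm_bound_integral int cont contg') simp_all
        then show ?thesis by (simp only: real_norm_def)
      qed
      also have "\<dots> \<le> ?D"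
        using x ab by (intro integral_subset_le int contg') simp_all
      finally show ?thesis by (simp add: abs_minus_commute)
    qed
    have "integral {?a..?b} g - (?b - ?a) * g ?b = integral {?a..?b} (\<lambda>x. g x - g ?b)"
      using ab by (subst Henstock_Kurzweil_Integration.integral_diff) (auto intro!: int[OF contg])
    also have "\<bar>\<dots>\<bar> \<le> integral {?a..?b} (\<lambda>x. ?D)"
    proof -
      have "(\<lambda>x. g x - g ?b) integrable_on {?a..?b}"
        by (rule int) (use ab in \<open>auto intro!: continuous_intros contg\<close>)
      moreover have "(\<lambda>x. ?D) integrable_on {?a..?b}"
        by (rule int) (use ab in \<open>auto intro!: continuous_intros\<close>)
      ultimately have "norm (integral {?a..?b} (\<lambda>x. g x - g ?b)) \<le> integral {?a..?b} (\<lambda>x. ?D)"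
        using pt by (intro integral_norm_bound_integral) (simp_all only: real_norm_def)
      then show ?thesis by (simp only: real_norm_def)
    qed
    also have "\<dots> = (?b - ?a) * ?D" using ab by simp
    also have "\<dots> \<le> \<delta> * ?D" using y(4)[of k] Suc.prems D by (intro mult_right_mono) auto
    finally have 1: "\<bar>integral {?a..?b} g - (?b - ?a) * g ?b\<bar> \<le> \<delta> * ?D" .
    have 2: "integral {0..?b} g = integral {0..?a} g + integral {?a..?b} g"
      "integral {0..?b} (\<lambda>x. \<bar>g' x\<bar>) = integral {0..?a} (\<lambda>x. \<bar>g' x\<bar>) + ?D"
      using ab by (auto intro!: Henstock_Kurzweil_Integration.integral_combine[symmetric] int contg contg')
    have "\<bar>integral {0..?a} g - (\<Sum>j<k. (y (Suc j) - y j) * g (y (Suc j)))\<bar>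
      \<le> \<delta> * integral {0..?a} (\<lambda>x. \<bar>g' x\<bar>)" using Suc by simp
    then show ?case using 1 unfolding 2 by (simp add: distrib_left)
  qed
  from this[of J] show ?thesis by (simp add: y)
qed

text \<open>Each weight is the length of the cell that ends at its mesh point, so the discrete norm
  is a right-endpoint rule. Both widths are at most 2 / J because the transition parameter lies
  between 0 and 1/2.\<close>

lemma shishkin_mesh:
  assumes "\<alpha> > 0" "\<epsilon> > 0" "J \<ge> 2" "even J"
  shows mesh_point_0: "mesh_point \<alpha> \<epsilon> J 0 = 0"
    and mesh_point_last: "mesh_point \<alpha> \<epsilon> J J = 1"
    and mesh_weight_0: "mesh_weight \<alpha> \<epsilon> J 0 = 0"
    and mesh_weight_nonneg: "mesh_weight \<alpha> \<epsilon> J j \<ge> 0"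
    and mesh_weight_le: "mesh_weight \<alpha> \<epsilon> J j \<le> 2 / real J"
    and mesh_weight_Suc: "mesh_point \<alpha> \<epsilon> J (Suc j) - mesh_point \<alpha> \<epsilon> J j = mesh_weight \<alpha> \<epsilon> J (Suc j)"
proof -
  obtain k where J: "J = 2 * k" using assms(4) by auto
  have k: "k \<ge> 1" using assms(3) J by simp
  have s: "0 \<le> shishkin_sigma \<alpha> \<epsilon> J" "shishkin_sigma \<alpha> \<epsilon> J \<le> 1 / 2"
    using assms by (auto simp: shishkin_sigma_def)
  \<comment> \<open>The coarse half ends exactly at the transition point 1 - \<sigma>, which glues
    the two branches of \<open>mesh_point\<close> together at index k.\<close>
  have half: "real k * mesh_coarse \<alpha> \<epsilon> J = 1 - shishkin_sigma \<alpha> \<epsilon> J"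
    using k by (simp add: mesh_coarse_def J)
  show "mesh_point \<alpha> \<epsilon> J 0 = 0" "mesh_weight \<alpha> \<epsilon> J 0 = 0"
    by (simp_all add: mesh_point_def mesh_weight_def)
  show "mesh_point \<alpha> \<epsilon> J J = 1"
    using k by (simp add: mesh_point_def mesh_fine_def J)
  have c: "mesh_coarse \<alpha> \<epsilon> J \<ge> 0" "mesh_coarse \<alpha> \<epsilon> J \<le> 2 / real J"
    "mesh_fine \<alpha> \<epsilon> J \<ge> 0" "mesh_fine \<alpha> \<epsilon> J \<le> 2 / real J"
    using s by (auto simp: mesh_coarse_def mesh_fine_def intro!: divide_right_mono)
  then show "mesh_weight \<alpha> \<epsilon> J j \<ge> 0" "mesh_weight \<alpha> \<epsilon> J j \<le> 2 / real J"
    by (auto simp: mesh_weight_def)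
  consider "Suc j \<le> k" | "j = k" | "k < j" by linarith
  then show "mesh_point \<alpha> \<epsilon> J (Suc j) - mesh_point \<alpha> \<epsilon> J j = mesh_weight \<alpha> \<epsilon> J (Suc j)"
  proof cases
    case 2
    then show ?thesis using half by (simp add: mesh_point_def mesh_weight_def J)
  qed (auto simp: mesh_point_def mesh_weight_def J algebra_simps)
qed

section \<open>Sample means\<close>

text \<open>The arithmetic-geometric mean inequality for t and z / t. It linearises the square root
  and is sharp when t is of the size of sqrt z, so t is later chosen as the rate to be
  proved.\<close>

lemma sqrt_le_mean:
  assumes "t > 0" "z \<ge> 0"
  shows "sqrt z \<le> (t + z / t) / 2"
proof -
  have "0 \<le> (sqrt z - t)\<^sup>2" by simp
  also have "\<dots> = z + t\<^sup>2 - 2 * t * sqrt z" using assms by (simp add: power2_diff)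
  finally have "2 * t * sqrt z \<le> t * (t + z / t)"
    using assms by (simp add: power2_eq_square algebra_simps)
  then have "t * (2 * sqrt z) \<le> t * (t + z / t)" by (simp add: ac_simps)
  then show ?thesis using assms(1) by simp
qed

lemma abs_sqrt_diff_le:
  assumes "x \<ge> 0" "y \<ge> 0"
  shows "\<bar>sqrt x - sqrt y\<bar> \<le> sqrt \<bar>x - y\<bar>"
proof -
  have "sqrt x \<le> sqrt y + sqrt \<bar>x - y\<bar>" if "x \<ge> 0" "y \<ge> 0" for x y :: real
    using that sqrt_add_le_add_sqrt[of y "\<bar>x - y\<bar>"] real_sqrt_le_mono[of x "y + \<bar>x - y\<bar>"] by linarith
  from this[of x y] this[of y x] show ?thesis using assms by (simp add: abs_minus_commute abs_le_iff)
qed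

text \<open>The reverse triangle inequality for \<open>L2_set\<close>, once the weights are absorbed
  into the vectors as factors sqrt (c i).\<close>

lemma weighted_L2_diff:
  fixes a b c :: "'i \<Rightarrow> real"
  assumes c: "\<And>i. i \<in> A \<Longrightarrow> c i \<ge> 0"
  shows "\<bar>sqrt (\<Sum>i\<in>A. c i * (a i)\<^sup>2) - sqrt (\<Sum>i\<in>A. c i * (b i)\<^sup>2)\<bar>
    \<le> sqrt (\<Sum>i\<in>A. c i * (a i - b i)\<^sup>2)"
proof -
  have L: "sqrt (\<Sum>i\<in>A. c i * (h i)\<^sup>2) = L2_set (\<lambda>i. sqrt (c i) * h i) A" for h :: "'i \<Rightarrow> real"
    unfolding L2_set_def using c by (intro arg_cong[of _ _ sqrt] sum.cong) (auto simp: power_mult_distrib)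
  have *: "L2_set (\<lambda>i. sqrt (c i) * p i) A \<le>
      L2_set (\<lambda>i. sqrt (c i) * q i) A + L2_set (\<lambda>i. sqrt (c i) * (p i - q i)) A" for p q :: "'i \<Rightarrow> real"
    using L2_set_triangle_ineq[of "\<lambda>i. sqrt (c i) * q i" "\<lambda>i. sqrt (c i) * (p i - q i)" A]
    by (simp add: algebra_simps)
  have "L2_set (\<lambda>i. sqrt (c i) * (b i - a i)) A = L2_set (\<lambda>i. sqrt (c i) * (a i - b i)) A"
    unfolding L2_set_def by (simp add: power_mult_distrib power2_commute)
  then show ?thesis
    unfolding L using *[of a b] *[of b a] by (simp add: abs_le_iff)
qed

section \<open>Sample means under the product measure\<close>

lemma nn_integral_PiM_component:
  assumes "prob_space \<mu>" "i \<in> I" "h \<in> borel_measurable \<mu>"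
  shows "(\<integral>\<^sup>+F. h (F i) \<partial>PiM I (\<lambda>_. \<mu>)) = (\<integral>\<^sup>+f. h f \<partial>\<mu>)"
proof -
  have "(\<integral>\<^sup>+f. h f \<partial>distr (PiM I (\<lambda>_. \<mu>)) \<mu> (\<lambda>F. F i)) = (\<integral>\<^sup>+F. h (F i) \<partial>PiM I (\<lambda>_. \<mu>))"
    by (rule nn_integral_distr) (use assms in auto)
  then show ?thesis
    using distr_PiM_component[of I "\<lambda>_. \<mu>" i] assms by simp
qed

lemma nn_integral_sample_mean:
  fixes h :: "'a \<Rightarrow> real"
  assumes \<mu>: "prob_space \<mu>" and N: "N \<ge> 1" and h: "h \<in> borel_measurable \<mu>" "\<And>f. h f \<ge> 0"
  shows "(\<integral>\<^sup>+F. ennreal (\<Sum>n<N. 1 / real N * h (F n)) \<partial>PiM {..<N} (\<lambda>_. \<mu>)) = (\<integral>\<^sup>+f. ennreal (h f) \<partial>\<mu>)"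
proof -
  let ?P = "PiM {..<N} (\<lambda>_. \<mu>)"
  have hm: "(\<lambda>F. ennreal (h (F n))) \<in> borel_measurable ?P" if "n < N" for n
    by (rule measurable_compose[OF measurable_component_singleton]) (use h that in auto)
  then have hm': "(\<lambda>F. ennreal (1 / real N) * ennreal (h (F n))) \<in> borel_measurable ?P" if "n < N" for n
    using that by (intro borel_measurable_times_ennreal) auto
  have "(\<integral>\<^sup>+F. ennreal (\<Sum>n<N. 1 / real N * h (F n)) \<partial>?P)
      = (\<integral>\<^sup>+F. (\<Sum>n<N. ennreal (1 / real N) * ennreal (h (F n))) \<partial>?P)"
  proof (rule nn_integral_cong)
    fix F
    have "(\<Sum>n<N. ennreal (1 / real N) * ennreal (h (F n))) = (\<Sum>n<N. ennreal (1 / real N * h (F n)))"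
      using h(2) by (intro sum.cong refl ennreal_mult[symmetric]) auto
    also have "\<dots> = ennreal (\<Sum>n<N. 1 / real N * h (F n))"
      using h(2) by (intro sum_ennreal) auto
    finally show "ennreal (\<Sum>n<N. 1 / real N * h (F n)) = (\<Sum>n<N. ennreal (1 / real N) * ennreal (h (F n)))" ..
  qed
  also have "\<dots> = (\<Sum>n<N. ennreal (1 / real N) * (\<integral>\<^sup>+F. ennreal (h (F n)) \<partial>?P))"
    by (subst nn_integral_sum) (auto intro!: sum.cong nn_integral_cmult hm hm')
  also have "\<dots> = (\<Sum>n<N. ennreal (1 / real N) * (\<integral>\<^sup>+f. ennreal (h f) \<partial>\<mu>))"
    by (intro sum.cong refl arg_cong2[of _ _ _ _ "(*)"] nn_integral_PiM_component[OF \<mu>]) (use h in auto)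
  also have "\<dots> = ennreal (real N * (1 / real N)) * (\<integral>\<^sup>+f. ennreal (h f) \<partial>\<mu>)"
    by (simp only: sum_constant card_lessThan ennreal_of_nat_eq_real_of_nat mult.assoc ennreal_mult of_nat_0_le_iff zero_le_divide_1_iff)
  finally show ?thesis using N by simp
qed

text \<open>Independence makes the covariances vanish, so the mean of N centred copies has second
  moment at most B / N. The first absolute moment is then of order N^(-1/2).\<close>

lemma sample_mean_deviation:
  fixes X :: "'a \<Rightarrow> real"
  assumes \<mu>: "prob_space \<mu>" and N: "N \<ge> 1" and X: "X \<in> borel_measurable \<mu>"
    and B: "(\<integral>\<^sup>+f. ennreal ((X f)\<^sup>2) \<partial>\<mu>) \<le> ennreal B" "B \<ge> 0"
  shows "(\<integral>\<^sup>+F. ennreal \<bar>(LINT f|\<mu>. X f) - (\<Sum>n<N. 1 / real N * X (F n))\<bar> \<partial>PiM {..<N} (\<lambda>_. \<mu>))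
    \<le> ennreal ((1 + B) / 2 / sqrt (real N))"
proof -
  interpret M: prob_space \<mu> by (rule \<mu>)
  interpret PS: product_prob_space "\<lambda>_::nat. \<mu>" "{..<N}" by unfold_locales
  let ?P = "PiM {..<N} (\<lambda>_. \<mu>)"
  have X2: "integrable \<mu> (\<lambda>f. (X f)\<^sup>2)"
    using X B(1) by (intro integrableI_bounded) (auto simp: top_unique less_top[symmetric] intro: le_less_trans)
  have X1: "integrable \<mu> X"
    by (rule M.square_integrable_imp_integrable[OF X X2])
  define m where "m = (LINT f|\<mu>. X f)"
  define Y where "Y f = m - X f" for f
  have Ym: "Y \<in> borel_measurable \<mu>" unfolding Y_def using X by simp
  have Y1: "integrable \<mu> Y" and EY: "(LINT f|\<mu>. Y f) = 0"
    using X1 M.prob_space by (simp_all add: Y_def[abs_def] m_def)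
  have Y2: "integrable \<mu> (\<lambda>f. (Y f)\<^sup>2)"
  proof -
    have "integrable \<mu> (\<lambda>f. m\<^sup>2 + (X f)\<^sup>2 - 2 * m * X f)" using X1 X2 by simp
    then show ?thesis by (simp add: Y_def power2_diff)
  qed
  have EY2: "(LINT f|\<mu>. (Y f)\<^sup>2) \<le> B"
  proof -
    have "(LINT f|\<mu>. (Y f)\<^sup>2) = (LINT f|\<mu>. m\<^sup>2 + (X f)\<^sup>2 - 2 * m * X f)"
      by (simp add: Y_def power2_diff)
    also have "\<dots> = (LINT f|\<mu>. (X f)\<^sup>2) - m\<^sup>2"
      using X1 X2 M.prob_space by (simp add: m_def[symmetric] power2_eq_square)
    also have "\<dots> \<le> (LINT f|\<mu>. (X f)\<^sup>2)" by simp
    also have "\<dots> \<le> B"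
      using B nn_integral_eq_integral[OF X2] by simp
    finally show ?thesis .
  qed
  have comp: "integrable ?P (\<lambda>F. h (F i)) \<and> (LINT F|?P. h (F i)) = (LINT f|\<mu>. h f)"
    if "integrable \<mu> h" "i < N" for h :: "'a \<Rightarrow> real" and i
  proof -
    have d: "distr ?P \<mu> (\<lambda>F. F i) = \<mu>" using that \<mu> by (intro distr_PiM_component) auto
    have mm: "(\<lambda>F. F i) \<in> measurable ?P \<mu>" by (rule measurable_component_singleton) (use that in auto)
    show ?thesis
      using integrable_distr_eq[OF mm, of h] integral_distr[OF mm, of h] that(1) d by simp
  qed
  have cross: "integrable ?P (\<lambda>F. Y (F i) * Y (F j)) \<and>
      (LINT F|?P. Y (F i) * Y (F j)) = (if i = j then LINT f|\<mu>. (Y f)\<^sup>2 else 0)"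
    if ij: "i < N" "j < N" for i j
  proof (cases "i = j")
    case True
    then show ?thesis using comp[OF Y2 ij(1)] by (simp add: power2_eq_square)
  next
    case False
    \<comment> \<open>The mixed term as a product over all coordinates, with factor 1 except at i
      and j; its integral factorises and contains the zero mean of Y.\<close>
    let ?f = "\<lambda>k f. if k = i \<or> k = j then Y f else 1"
    have int: "integrable \<mu> (?f k)" for k using Y1 by (cases "k = i \<or> k = j") auto
    have eq: "(\<Prod>k<N. ?f k (F k)) = Y (F i) * Y (F j)" for F
    proof -
      have "(\<Prod>k<N. ?f k (F k)) = (\<Prod>k\<in>{i, j}. ?f k (F k))"
        by (rule prod.mono_neutral_right) (use ij in auto)
      then show ?thesis using False by simp
    qed
    have "(\<Prod>k<N. LINT f|\<mu>. ?f k f) = 0"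
      using ij EY by (intro prod_zero) (auto intro!: bexI[of _ i])
    then show ?thesis
      using PS.product_integrable_prod[of "{..<N}" ?f] PS.product_integral_prod[of "{..<N}" ?f] int False
      unfolding eq by simp
  qed
  define Z where "Z F = (\<Sum>n<N. Y (F n)) / real N" for F :: "nat \<Rightarrow> 'a"
  have Z2_eq: "(Z F)\<^sup>2 = (\<Sum>i<N. \<Sum>j<N. Y (F i) * Y (F j)) / (real N)\<^sup>2" for F
    by (simp add: Z_def power_divide power2_eq_square sum_product)
  have Z2: "integrable ?P (\<lambda>F. (Z F)\<^sup>2)"
    unfolding Z2_eq using cross by (intro integrable_divide_zero Bochner_Integration.integrable_sum) auto
  have EZ2: "(LINT F|?P. (Z F)\<^sup>2) \<le> B / real N"
  proof -
    have "(LINT F|?P. (Z F)\<^sup>2) = (\<Sum>i<N. \<Sum>j<N. LINT F|?P. Y (F i) * Y (F j)) / (real N)\<^sup>2"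
    proof -
      have "(LINT F|?P. (\<Sum>i<N. \<Sum>j<N. Y (F i) * Y (F j))) = (\<Sum>i<N. LINT F|?P. (\<Sum>j<N. Y (F i) * Y (F j)))"
        by (rule Bochner_Integration.integral_sum) (use cross in auto)
      also have "\<dots> = (\<Sum>i<N. \<Sum>j<N. LINT F|?P. Y (F i) * Y (F j))"
        by (intro sum.cong refl Bochner_Integration.integral_sum) (use cross in auto)
      finally show ?thesis unfolding Z2_eq by (simp only: integral_divide_zero)
    qed
    also have "(\<Sum>i<N. \<Sum>j<N. LINT F|?P. Y (F i) * Y (F j)) = (\<Sum>i<N. \<Sum>j<N. if i = j then LINT f|\<mu>. (Y f)\<^sup>2 else 0)"
      using cross by (intro sum.cong) auto
    also have "\<dots> = real N * (LINT f|\<mu>. (Y f)\<^sup>2)" by simp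
    also have "\<dots> / (real N)\<^sup>2 = (LINT f|\<mu>. (Y f)\<^sup>2) / real N"
      using N by (simp add: power2_eq_square)
    also have "\<dots> \<le> B / real N" using EY2 by (intro divide_right_mono) auto
    finally show ?thesis .
  qed
  have Z_eq: "m - (\<Sum>n<N. 1 / real N * X (F n)) = Z F" for F
    using N by (simp add: Z_def Y_def sum_subtractf sum_divide_distrib diff_divide_distrib)
  have P1: "measure ?P (space ?P) = 1"
    by (rule prob_space.prob_space[OF prob_space_PiM]) (rule \<mu>)
  \<comment> \<open>The size expected of |Z|, used as the parameter in the mean inequality for |Z| =
    sqrt (Z^2).\<close>
  define s where "s = 1 / sqrt (real N)"
  have s: "s > 0" "1 / s = sqrt (real N)" using N by (auto simp: s_def)
  have Zs: "\<bar>Z F\<bar> \<le> (s + (Z F)\<^sup>2 / s) / 2" for F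
    using sqrt_le_mean[OF s(1), of "(Z F)\<^sup>2"] by simp
  have "(\<integral>\<^sup>+F. ennreal \<bar>Z F\<bar> \<partial>?P) \<le> (\<integral>\<^sup>+F. ennreal ((s + (Z F)\<^sup>2 / s) / 2) \<partial>?P)"
    by (intro nn_integral_mono ennreal_leI Zs)
  also have "\<dots> = ennreal (LINT F|?P. (s + (Z F)\<^sup>2 / s) / 2)"
    using s Z2 by (intro nn_integral_eq_integral AE_I2) auto
  also have "(LINT F|?P. (s + (Z F)\<^sup>2 / s) / 2) = (s + (LINT F|?P. (Z F)\<^sup>2) / s) / 2"
    using Z2 P1 by simp
  also have "ennreal \<dots> \<le> ennreal ((1 + B) / 2 / sqrt (real N))"
  proof (rule ennreal_leI)
    have "(LINT F|?P. (Z F)\<^sup>2) / s \<le> (B / real N) / s"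
      using EZ2 s by (intro divide_right_mono) auto
    also have "\<dots> = B / real N * sqrt (real N)"
      using s(2) by (metis divide_inverse inverse_eq_divide)
    also have "\<dots> = B / sqrt (real N)"
      using N by (simp add: field_simps)
    finally show "(s + (LINT F|?P. (Z F)\<^sup>2) / s) / 2 \<le> (1 + B) / 2 / sqrt (real N)"
      by (simp add: s_def add_divide_distrib)
  qed
  finally show ?thesis unfolding Z_eq m_def[symmetric] .
qed

text \<open>In the antiderivative of the layer term the factor 1/\<epsilon> turns into 1/\<alpha>,
  which makes the bound uniform in \<epsilon>.\<close>

lemma integral_boundary_layer:
  assumes "\<alpha> > 0" "\<epsilon> > 0" "K \<ge> 0"
  shows "(\<integral>\<^sup>+x. ennreal (K * (1 + 1 / \<epsilon> * exp (- \<alpha> * (1 - x) / \<epsilon>))) \<partial>I01) \<le> ennreal (K * (1 + 1 / \<alpha>))"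
proof -
  let ?f = "\<lambda>x. K * (1 + 1 / \<epsilon> * exp (- \<alpha> * (1 - x) / \<epsilon>))"
  let ?F = "\<lambda>x. K * (x + 1 / \<alpha> * exp (- \<alpha> * (1 - x) / \<epsilon>))"
  have int: "integrable I01 ?f"
    by (intro continuous_imp_integrable_real continuous_intros) (use assms in auto)
  have "(?f has_integral (?F 1 - ?F 0)) {0..1}"
  proof (rule fundamental_theorem_of_calculus)
    show "(?F has_vector_derivative ?f x) (at x within {0..1})" for x
      unfolding has_real_derivative_iff_has_vector_derivative[symmetric]
      using assms by (auto intro!: derivative_eq_intros simp: field_simps)
  qed simp
  then have "(LINT x|I01. ?f x) = ?F 1 - ?F 0"
    by (subst lebesgue_integral_eq_integral[OF int]) (simp_all only: integral_unique, simp)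
  also have "\<dots> \<le> K * (1 + 1 / \<alpha>)"
  proof -
    have "?F 0 \<ge> 0" using assms by simp
    then show ?thesis by simp
  qed
  finally have "(LINT x|I01. ?f x) \<le> K * (1 + 1 / \<alpha>)" .
  moreover have "(\<integral>\<^sup>+x. ennreal (?f x) \<partial>I01) = ennreal (LINT x|I01. ?f x)"
    using assms by (intro nn_integral_eq_integral int AE_I2) auto
  ultimately show ?thesis by (simp add: ennreal_leI)
qed

section \<open>Expectations of norms and of the quadrature error\<close>

text \<open>The squared norm of a class is an integral over x depending on the parameter f, so its
  measurability follows from joint measurability of h. Writing it over \<open>unit_measure\<close>
  keeps the product sigma-algebra Borel in x.\<close>

lemma l2_class_measurable_family:
  assumes sq: "\<And>f. f \<in> space M \<Longrightarrow> sq_integrable (h f)"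
    and meas: "(\<lambda>z. h (fst z) (snd z)) \<in> borel_measurable (M \<Otimes>\<^sub>M borel)"
  shows l2_class_norm_measurable: "(\<lambda>f. (norm (l2_class (h f)))\<^sup>2) \<in> borel_measurable M"
    and l2_class_norm_nn_integral: "\<And>f. f \<in> space M \<Longrightarrow>
      ennreal ((norm (l2_class (h f)))\<^sup>2) = (\<integral>\<^sup>+x. ennreal ((h f x)\<^sup>2) \<partial>unit_measure)"
proof -
  interpret U: prob_space unit_measure by (rule prob_space_unit_measure)
  have sect: "h f \<in> borel_measurable borel" if "f \<in> space M" for f
    using measurable_compose[OF measurable_Pair1'[OF that, of borel] meas] by simp
  show eq: "ennreal ((norm (l2_class (h f)))\<^sup>2) = (\<integral>\<^sup>+x. ennreal ((h f x)\<^sup>2) \<partial>unit_measure)"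
    if f: "f \<in> space M" for f
  proof -
    have "ennreal ((norm (l2_class (h f)))\<^sup>2) = (\<integral>\<^sup>+x. ennreal ((h f x)\<^sup>2) \<partial>I01)"
      using sq[OF f] unfolding norm_l2_class_square[OF sq[OF f]]
      by (intro nn_integral_eq_integral[symmetric]) (auto simp: sq_integrable_def)
    also have "\<dots> = (\<integral>\<^sup>+x. ennreal ((h f x)\<^sup>2) \<partial>unit_measure)"
      by (rule nn_integral_unit_measure[symmetric]) (use sect[OF f] in measurable)
    finally show ?thesis .
  qed
  have m: "(\<lambda>f. \<integral>\<^sup>+x. ennreal ((h f x)\<^sup>2) \<partial>unit_measure) \<in> borel_measurable M"
  proof (rule U.borel_measurable_nn_integral)
    have "(\<lambda>z. ennreal ((h (fst z) (snd z))\<^sup>2)) \<in> borel_measurable (M \<Otimes>\<^sub>M borel)"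
      using meas by measurable
    then show "(\<lambda>(f, x). ennreal ((h f x)\<^sup>2)) \<in> borel_measurable (M \<Otimes>\<^sub>M unit_measure)"
      unfolding split_beta' by (simp cong: measurable_cong_sets sets_pair_measure_cong)
  qed
  have "(norm (l2_class (h f)))\<^sup>2 = enn2real (\<integral>\<^sup>+x. ennreal ((h f x)\<^sup>2) \<partial>unit_measure)"
    if "f \<in> space M" for f
    unfolding eq[OF that, symmetric] by simp
  then show "(\<lambda>f. (norm (l2_class (h f)))\<^sup>2) \<in> borel_measurable M"
    using borel_measurable_enn2real[OF m] by (simp cong: measurable_cong)
qed

text \<open>By Tonelli the expected squared norm is the average over x of the expectations at fixed
  x, and the interval has length 1.\<close>

lemma nn_integral_l2_class_norm_le:
  assumes \<mu>: "prob_space \<mu>"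
    and sq: "\<And>f. sq_integrable (h f)"
    and meas: "(\<lambda>z. h (fst z) (snd z)) \<in> borel_measurable (\<mu> \<Otimes>\<^sub>M borel)"
    and le: "\<And>x. x \<in> {0..1} \<Longrightarrow> (\<integral>\<^sup>+f. ennreal ((h f x)\<^sup>2) \<partial>\<mu>) \<le> c"
  shows "(\<integral>\<^sup>+f. ennreal ((norm (l2_class (h f)))\<^sup>2) \<partial>\<mu>) \<le> c"
proof -
  interpret U: prob_space unit_measure by (rule prob_space_unit_measure)
  interpret M: prob_space \<mu> by (rule \<mu>)
  interpret pair_sigma_finite \<mu> unit_measure ..
  have "(\<lambda>z. ennreal ((h (fst z) (snd z))\<^sup>2)) \<in> borel_measurable (\<mu> \<Otimes>\<^sub>M borel)"
    using meas by measurable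
  then have m: "(\<lambda>(f, x). ennreal ((h f x)\<^sup>2)) \<in> borel_measurable (\<mu> \<Otimes>\<^sub>M unit_measure)"
    unfolding split_beta' by (simp cong: measurable_cong_sets sets_pair_measure_cong)
  have "(\<integral>\<^sup>+f. ennreal ((norm (l2_class (h f)))\<^sup>2) \<partial>\<mu>)
      = (\<integral>\<^sup>+f. \<integral>\<^sup>+x. ennreal ((h f x)\<^sup>2) \<partial>unit_measure \<partial>\<mu>)"
    by (intro nn_integral_cong l2_class_norm_nn_integral[OF sq meas])
  also have "\<dots> = (\<integral>\<^sup>+x. \<integral>\<^sup>+f. ennreal ((h f x)\<^sup>2) \<partial>\<mu> \<partial>unit_measure)"
    by (rule Fubini'[OF m, symmetric])
  also have "\<dots> \<le> (\<integral>\<^sup>+x. c \<partial>unit_measure)"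
    by (rule nn_integral_mono_AE) (use AE_unit_measure le in auto)
  also have "\<dots> = c" using U.emeasure_space_1 by simp
  finally show ?thesis .
qed

text \<open>If the expectation of z is of order t^2, the choice of t as parameter bounds the
  expectation of sqrt z by a multiple of t.\<close>

lemma nn_integral_sqrt_bound:
  assumes P: "prob_space P" and z: "z \<in> borel_measurable P" "\<And>F. z F \<ge> 0"
    and c: "(\<integral>\<^sup>+F. ennreal (z F) \<partial>P) \<le> ennreal c" "c \<ge> 0" and t: "t > 0"
  shows "(\<integral>\<^sup>+F. ennreal (sqrt (z F)) \<partial>P) \<le> ennreal ((t + c / t) / 2)"
proof -
  interpret prob_space P by (rule P)
  have "(\<integral>\<^sup>+F. ennreal (sqrt (z F)) \<partial>P) \<le> (\<integral>\<^sup>+F. ennreal (t / 2) + ennreal (1 / (2 * t)) * ennreal (z F) \<partial>P)"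
  proof (rule nn_integral_mono)
    fix F
    have "ennreal (sqrt (z F)) \<le> ennreal (t / 2 + 1 / (2 * t) * z F)"
      using sqrt_le_mean[OF t z(2)[of F]] by (intro ennreal_leI) (simp add: field_simps)
    also have "\<dots> = ennreal (t / 2) + ennreal (1 / (2 * t) * z F)"
      using t z(2)[of F] by (intro ennreal_plus) auto
    also have "ennreal (1 / (2 * t) * z F) = ennreal (1 / (2 * t)) * ennreal (z F)"
      using t z(2)[of F] by (intro ennreal_mult) auto
    finally show "ennreal (sqrt (z F)) \<le> ennreal (t / 2) + ennreal (1 / (2 * t)) * ennreal (z F)" .
  qed
  also have "\<dots> = ennreal (t / 2) + ennreal (1 / (2 * t)) * (\<integral>\<^sup>+F. ennreal (z F) \<partial>P)"
    using z(1) emeasure_space_1 by (subst nn_integral_add) (auto simp: nn_integral_cmult)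
  also have "\<dots> \<le> ennreal (t / 2) + ennreal (1 / (2 * t)) * ennreal c"
    by (intro add_mono mult_mono c) auto
  also have "ennreal (1 / (2 * t)) * ennreal c = ennreal (1 / (2 * t) * c)"
    by (rule ennreal_mult[symmetric]) (use t c(2) in auto)
  also have "ennreal (t / 2) + \<dots> = ennreal (t / 2 + 1 / (2 * t) * c)"
    by (rule ennreal_plus[symmetric]) (use t c(2) in auto)
  also have "t / 2 + 1 / (2 * t) * c = (t + c / t) / 2"
    using t by (simp add: field_simps)
  finally show ?thesis .
qed

lemma clamp01_sq_integrable: "sq_integrable g \<Longrightarrow> sq_integrable (\<lambda>x. g (clamp01 x))"
  and clamp01_l2_class: "sq_integrable g \<Longrightarrow> l2_class (\<lambda>x. g (clamp01 x)) = l2_class g"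
proof -
  assume g: "sq_integrable g"
  have eq: "g (clamp01 x) = g x" if "x \<in> space I01" for x
    using that by (simp add: space_restrict_space clamp01_id)
  show sq: "sq_integrable (\<lambda>x. g (clamp01 x))"
  proof -
    have "(\<lambda>x. g (clamp01 x)) \<in> borel_measurable I01 \<longleftrightarrow> g \<in> borel_measurable I01"
      by (rule measurable_cong) (rule eq)
    moreover have "integrable I01 (\<lambda>x. (g (clamp01 x))\<^sup>2) \<longleftrightarrow> integrable I01 (\<lambda>x. (g x)\<^sup>2)"
      by (rule Bochner_Integration.integrable_cong[OF refl]) (simp only: eq)
    ultimately show ?thesis using g unfolding sq_integrable_def by blast
  qed
  show "l2_class (\<lambda>x. g (clamp01 x)) = l2_class g"
    by (intro l2_class_eqI sq g AE_I2 eq)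
qed

lemma C1_unit_continuous: "C1_unit g \<Longrightarrow> continuous_on {0..1} g"
  unfolding C1_unit_def by (metis DERIV_continuous_on)

section \<open>Mesh quadrature in expectation\<close>

lemma mesh_point_in:
  assumes "\<alpha> > 0" "\<epsilon> > 0" "J \<ge> 2" "even J" "j \<le> J"
  shows "mesh_point \<alpha> \<epsilon> J j \<in> {0..1}"
proof -
  note mesh = shishkin_mesh[OF assms(1-4)]
  have mono: "mono (mesh_point \<alpha> \<epsilon> J)"
    using mesh(4,6) by (intro incseq_SucI) (metis diff_ge_0_iff_ge)
  show ?thesis
    using monoD[OF mono, of 0 j] monoD[OF mono, of j J] assms(5) mesh(1,2) by simp
qed

lemma sum_mesh_weight:
  assumes "\<alpha> > 0" "\<epsilon> > 0" "J \<ge> 2" "even J"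
  shows "(\<Sum>j\<le>J. mesh_weight \<alpha> \<epsilon> J j * g (mesh_point \<alpha> \<epsilon> J j)) =
      (\<Sum>j<J. (mesh_point \<alpha> \<epsilon> J (Suc j) - mesh_point \<alpha> \<epsilon> J j) * g (mesh_point \<alpha> \<epsilon> J (Suc j)))"
    and sum_mesh_weight_1: "(\<Sum>j\<le>J. mesh_weight \<alpha> \<epsilon> J j) = 1"
proof -
  note mesh = shishkin_mesh[OF assms]
  show eq: "(\<Sum>j\<le>J. mesh_weight \<alpha> \<epsilon> J j * g (mesh_point \<alpha> \<epsilon> J j)) =
      (\<Sum>j<J. (mesh_point \<alpha> \<epsilon> J (Suc j) - mesh_point \<alpha> \<epsilon> J j) * g (mesh_point \<alpha> \<epsilon> J (Suc j)))" for g
    unfolding sum.atMost_shift mesh(3,6) by simp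
  have "(\<Sum>j\<le>J. mesh_weight \<alpha> \<epsilon> J j) = mesh_point \<alpha> \<epsilon> J J - mesh_point \<alpha> \<epsilon> J 0"
    using eq[of "\<lambda>_. 1"] sum_lessThan_telescope[of "mesh_point \<alpha> \<epsilon> J" J] by simp
  then show "(\<Sum>j\<le>J. mesh_weight \<alpha> \<epsilon> J j) = 1" using mesh(1,2) by simp
qed

lemma mesh_quadrature_error:
  assumes par: "\<alpha> > 0" "\<epsilon> > 0" "J \<ge> 2" "even J"
    and deriv: "\<And>x. x \<in> {0..1} \<Longrightarrow> (g has_real_derivative g' x) (at x within {0..1})"
    and cont: "continuous_on {0..1} g'"
  shows "\<bar>(LINT x|I01. g x) - (\<Sum>j\<le>J. mesh_weight \<alpha> \<epsilon> J j * g (mesh_point \<alpha> \<epsilon> J j))\<bar>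
    \<le> 2 / real J * (LINT x|I01. \<bar>g' x\<bar>)"
proof -
  note mesh = shishkin_mesh[OF par]
  have contg: "continuous_on {0..1} g" using deriv by (rule DERIV_continuous_on)
  have 1: "(LINT x|I01. g x) = integral {0..1} g"
    by (rule lebesgue_integral_eq_integral) (auto intro: continuous_imp_integrable_real contg)
  have 2: "(LINT x|I01. \<bar>g' x\<bar>) = integral {0..1} (\<lambda>x. \<bar>g' x\<bar>)"
    by (rule lebesgue_integral_eq_integral) (auto intro!: continuous_imp_integrable_real continuous_intros cont)
  show ?thesis
    unfolding 1 2 sum_mesh_weight[OF par]
  proof (rule quadrature_error[OF deriv cont])
    fix j
    show "mesh_point \<alpha> \<epsilon> J j \<le> mesh_point \<alpha> \<epsilon> J (Suc j)"
      "mesh_point \<alpha> \<epsilon> J (Suc j) - mesh_point \<alpha> \<epsilon> J j \<le> 2 / real J"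
      using mesh(4)[of "Suc j"] mesh(5)[of "Suc j"] mesh(6)[of j] by linarith+
  qed (use mesh(1,2) in auto)
qed

text \<open>The quadrature bound involves the integral over x of |g'| for each f, whereas the
  hypothesis controls its expectation for each x. Tonelli exchanges the two, and the boundary layer
  is then integrated exactly.\<close>

lemma nn_integral_quadrature_error:
  fixes g :: "'a \<Rightarrow> real \<Rightarrow> real"
  assumes par: "\<alpha> > 0" "\<epsilon> > 0" "J \<ge> 2" "even J" "K \<ge> 0"
    and \<mu>: "prob_space \<mu>"
    and C1: "\<And>f. C1_unit (g f)"
    and meas: "\<And>x. x \<in> {0..1} \<Longrightarrow> (\<lambda>f. g f x) \<in> borel_measurable \<mu>"
    and bound: "\<And>x. x \<in> {0..1} \<Longrightarrow>
      (\<integral>\<^sup>+f. ennreal \<bar>vector_derivative (g f) (at x within {0..1})\<bar> \<partial>\<mu>)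
        \<le> ennreal (K * (1 + 1 / \<epsilon> * exp (- \<alpha> * (1 - x) / \<epsilon>)))"
  shows "(\<integral>\<^sup>+f. ennreal \<bar>(LINT x|I01. g f x) -
        (\<Sum>j\<le>J. mesh_weight \<alpha> \<epsilon> J j * g f (mesh_point \<alpha> \<epsilon> J j))\<bar> \<partial>\<mu>)
      \<le> ennreal (2 / real J * (K * (1 + 1 / \<alpha>)))"
proof -
  interpret U: prob_space unit_measure by (rule prob_space_unit_measure)
  interpret M: prob_space \<mu> by (rule \<mu>)
  interpret pair_sigma_finite \<mu> unit_measure ..
  have "\<forall>f. \<exists>g'. continuous_on {0..1} g' \<and>
      (\<forall>x\<in>{0..1}. (g f has_real_derivative g' x) (at x within {0..1}))"
    using C1 unfolding C1_unit_def by blast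
  then obtain g' where g': "\<And>f. continuous_on {0..1} (g' f)"
    "\<And>f x. x \<in> {0..1} \<Longrightarrow> (g f has_real_derivative g' f x) (at x within {0..1})"
    by metis
  \<comment> \<open>Derivatives within the interval are unique, also at its end points, so the
    derivative that was chosen is the one bounded by the hypothesis.\<close>
  have vd: "vector_derivative (g f) (at x within {0..1}) = g' f x" if "x \<in> {0..1}" for f x
    using g'(2)[OF that, of f] that
    by (intro vector_derivative_within_closed_interval)
       (auto simp: has_real_derivative_iff_has_vector_derivative)
  have "(\<lambda>f. g' f x) \<in> borel_measurable \<mu>" if "x \<in> {0..1}" for x
    by (rule borel_measurable_family_derivative[OF meas g'(2) g'(1) that])
  then have "(\<lambda>z. g' (fst z) (clamp01 (snd z))) \<in> borel_measurable (\<mu> \<Otimes>\<^sub>M borel)"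
    by (intro borel_measurable_Caratheodory g'(1))
  then have joint: "(\<lambda>z. ennreal \<bar>g' (fst z) (clamp01 (snd z))\<bar>) \<in> borel_measurable (\<mu> \<Otimes>\<^sub>M borel)"
    by measurable
  then have m: "(\<lambda>(f, x). ennreal \<bar>g' f (clamp01 x)\<bar>) \<in> borel_measurable (\<mu> \<Otimes>\<^sub>M unit_measure)"
    unfolding split_beta' by (simp cong: measurable_cong_sets sets_pair_measure_cong)
  have absL: "ennreal (LINT x|I01. \<bar>g' f x\<bar>) = (\<integral>\<^sup>+x. ennreal \<bar>g' f (clamp01 x)\<bar> \<partial>unit_measure)"
    if f: "f \<in> space \<mu>" for f
  proof -
    have "ennreal (LINT x|I01. \<bar>g' f x\<bar>) = (\<integral>\<^sup>+x. ennreal \<bar>g' f x\<bar> \<partial>I01)"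
      by (intro nn_integral_eq_integral[symmetric] continuous_imp_integrable_real continuous_intros g'(1)) auto
    also have "\<dots> = (\<integral>\<^sup>+x. ennreal \<bar>g' f (clamp01 x)\<bar> \<partial>I01)"
      by (intro nn_integral_cong) (simp add: space_restrict_space clamp01_id)
    also have "\<dots> = (\<integral>\<^sup>+x. ennreal \<bar>g' f (clamp01 x)\<bar> \<partial>unit_measure)"
      using measurable_compose[OF measurable_Pair1'[OF f, of borel] joint]
      by (intro nn_integral_unit_measure[symmetric]) simp
    finally show ?thesis .
  qed
  have m2: "(\<lambda>f. \<integral>\<^sup>+x. ennreal \<bar>g' f (clamp01 x)\<bar> \<partial>unit_measure) \<in> borel_measurable \<mu>"
    by (rule U.borel_measurable_nn_integral[OF m])
  have E1: "(\<integral>\<^sup>+f. ennreal \<bar>(LINT x|I01. g f x) -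
        (\<Sum>j\<le>J. mesh_weight \<alpha> \<epsilon> J j * g f (mesh_point \<alpha> \<epsilon> J j))\<bar> \<partial>\<mu>)
      \<le> (\<integral>\<^sup>+f. ennreal (2 / real J) * (\<integral>\<^sup>+x. ennreal \<bar>g' f (clamp01 x)\<bar> \<partial>unit_measure) \<partial>\<mu>)"
  proof (rule nn_integral_mono)
    fix f assume f: "f \<in> space \<mu>"
    have "ennreal \<bar>(LINT x|I01. g f x) - (\<Sum>j\<le>J. mesh_weight \<alpha> \<epsilon> J j * g f (mesh_point \<alpha> \<epsilon> J j))\<bar>
        \<le> ennreal (2 / real J * (LINT x|I01. \<bar>g' f x\<bar>))"
      by (intro ennreal_leI mesh_quadrature_error par g')
    also have "\<dots> = ennreal (2 / real J) * ennreal (LINT x|I01. \<bar>g' f x\<bar>)"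
      by (intro ennreal_mult) auto
    finally show "ennreal \<bar>(LINT x|I01. g f x) - (\<Sum>j\<le>J. mesh_weight \<alpha> \<epsilon> J j * g f (mesh_point \<alpha> \<epsilon> J j))\<bar>
        \<le> ennreal (2 / real J) * (\<integral>\<^sup>+x. ennreal \<bar>g' f (clamp01 x)\<bar> \<partial>unit_measure)"
      unfolding absL[OF f] .
  qed
  have E2: "(\<integral>\<^sup>+f. ennreal (2 / real J) * (\<integral>\<^sup>+x. ennreal \<bar>g' f (clamp01 x)\<bar> \<partial>unit_measure) \<partial>\<mu>) =
      ennreal (2 / real J) * (\<integral>\<^sup>+f. \<integral>\<^sup>+x. ennreal \<bar>g' f (clamp01 x)\<bar> \<partial>unit_measure \<partial>\<mu>)"
    by (rule nn_integral_cmult[OF m2])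
  have "(\<integral>\<^sup>+f. \<integral>\<^sup>+x. ennreal \<bar>g' f (clamp01 x)\<bar> \<partial>unit_measure \<partial>\<mu>)
      = (\<integral>\<^sup>+x. \<integral>\<^sup>+f. ennreal \<bar>g' f (clamp01 x)\<bar> \<partial>\<mu> \<partial>unit_measure)"
    by (rule Fubini'[OF m, symmetric])
  also have "\<dots> \<le> (\<integral>\<^sup>+x. ennreal (K * (1 + 1 / \<epsilon> * exp (- \<alpha> * (1 - x) / \<epsilon>))) \<partial>unit_measure)"
  proof (rule nn_integral_mono_AE)
    show "AE x in unit_measure. (\<integral>\<^sup>+f. ennreal \<bar>g' f (clamp01 x)\<bar> \<partial>\<mu>)
        \<le> ennreal (K * (1 + 1 / \<epsilon> * exp (- \<alpha> * (1 - x) / \<epsilon>)))"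
      using AE_unit_measure
    proof eventually_elim
      case (elim x)
      then show ?case using bound[OF elim] by (simp only: vd clamp01_id)
    qed
  qed
  also have "\<dots> = (\<integral>\<^sup>+x. ennreal (K * (1 + 1 / \<epsilon> * exp (- \<alpha> * (1 - x) / \<epsilon>))) \<partial>I01)"
    by (rule nn_integral_unit_measure) measurable
  also have "\<dots> \<le> ennreal (K * (1 + 1 / \<alpha>))"
    by (rule integral_boundary_layer[OF par(1,2,5)])
  finally have E3: "(\<integral>\<^sup>+f. \<integral>\<^sup>+x. ennreal \<bar>g' f (clamp01 x)\<bar> \<partial>unit_measure \<partial>\<mu>)
      \<le> ennreal (K * (1 + 1 / \<alpha>))" .
  have "ennreal (2 / real J) * ennreal (K * (1 + 1 / \<alpha>)) = ennreal (2 / real J * (K * (1 + 1 / \<alpha>)))"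
    by (rule ennreal_mult[symmetric]) (use par in auto)
  then show ?thesis
    using order_trans[OF E1[unfolded E2] mult_left_mono[OF E3 zero_le]] by simp
qed

section \<open>The gap of a fixed network\<close>

lemma assumption_A1_mono: "assumption_A1 K \<mu> G V \<Longrightarrow> K \<le> K' \<Longrightarrow> assumption_A1 K' \<mu> G V"
  unfolding assumption_A1_def by (meson ennreal_leI order_trans)

lemma assumption_A2_mono:
  assumes "assumption_A2 K \<alpha> \<epsilon> N \<mu> G V" "K \<le> K'" "\<epsilon> > 0"
  shows "assumption_A2 K' \<alpha> \<epsilon> N \<mu> G V"
proof -
  have "ennreal (K / real N powr (1 / 2)) \<le> ennreal (K' / real N powr (1 / 2))"
    using assms(2) by (intro ennreal_leI divide_right_mono) auto
  moreover have "ennreal (K * (1 + 1 / \<epsilon> * exp (- \<alpha> * (1 - x) / \<epsilon>)))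
      \<le> ennreal (K' * (1 + 1 / \<epsilon> * exp (- \<alpha> * (1 - x) / \<epsilon>)))" for x
    using assms(2,3) by (intro ennreal_leI mult_right_mono) auto
  ultimately show ?thesis
    using assms(1) unfolding assumption_A2_def by (meson order_trans)
qed

lemma deeponet_sq_integrable:
  assumes "deeponet m p E V"
  shows "sq_integrable (V f)"
proof -
  obtain A \<tau> where \<tau>: "\<And>k. k \<le> p \<Longrightarrow> sq_integrable (\<lambda>x. \<tau> (\<lambda>_. x) k)"
    and V: "V = (\<lambda>f x. \<tau> (\<lambda>_. x) 0 + (\<Sum>k=1..p. A (E f) (k - 1) * \<tau> (\<lambda>_. x) k))"
    using assms unfolding deeponet_def by blast
  have "sq_integrable (\<lambda>x. \<Sum>k\<in>I. A (E f) (k - 1) * \<tau> (\<lambda>_. x) k)" if "finite I" "I \<subseteq> {1..p}" for I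
    using that
  proof (induction I)
    case (insert k I)
    then show ?case
      by (simp add: sq_integrable_add sq_integrable_scale \<tau>)
  qed (simp add: sq_integrable_zero)
  then show ?thesis
    unfolding V by (intro sq_integrable_add \<tau>) auto
qed

section \<open>Splitting the gap and taking expectations\<close>

text \<open>The chain leads from the expectation m of X to the sample means of X, X', Y' and Y. Here
  X and Y are the squared errors of the network in the continuous and the discrete norm, X' and Y'
  those of its smooth approximation. The first and third links compare quantities that are close
  only before the root is taken, hence the roots of differences there; the other two come from
  triangle inequalities.\<close>

lemma generalization_gap_pointwise:
  fixes m :: real and X Y X' Y' D D' Q :: "'a \<Rightarrow> real"
  assumes N: "N \<ge> 1" and m: "m \<ge> 0" and X: "\<And>f. X f \<ge> 0"
    and X': "\<And>f. X' f \<ge> 0" and Y': "\<And>f. Y' f \<ge> 0"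
    and XX': "\<bar>sqrt (\<Sum>n<N. 1 / real N * X (F n)) - sqrt (\<Sum>n<N. 1 / real N * X' (F n))\<bar>
        \<le> sqrt (\<Sum>n<N. 1 / real N * D (F n))"
    and YY': "\<bar>sqrt (\<Sum>n<N. 1 / real N * Y' (F n)) - sqrt (\<Sum>n<N. 1 / real N * Y (F n))\<bar>
        \<le> sqrt (\<Sum>n<N. 1 / real N * D' (F n))"
    and Q: "\<And>f. \<bar>X' f - Y' f\<bar> \<le> Q f"
  shows "\<bar>sqrt m - sqrt (\<Sum>n<N. 1 / real N * Y (F n))\<bar> \<le>
      sqrt \<bar>m - (\<Sum>n<N. 1 / real N * X (F n))\<bar> + sqrt (\<Sum>n<N. 1 / real N * D (F n))
      + sqrt (\<Sum>n<N. 1 / real N * Q (F n)) + sqrt (\<Sum>n<N. 1 / real N * D' (F n))"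
proof -
  have 1: "\<bar>sqrt m - sqrt (\<Sum>n<N. 1 / real N * X (F n))\<bar> \<le> sqrt \<bar>m - (\<Sum>n<N. 1 / real N * X (F n))\<bar>"
    by (intro abs_sqrt_diff_le m sum_nonneg mult_nonneg_nonneg X) auto
  have "\<bar>sqrt (\<Sum>n<N. 1 / real N * X' (F n)) - sqrt (\<Sum>n<N. 1 / real N * Y' (F n))\<bar>
      \<le> sqrt \<bar>(\<Sum>n<N. 1 / real N * X' (F n)) - (\<Sum>n<N. 1 / real N * Y' (F n))\<bar>"
    by (intro abs_sqrt_diff_le sum_nonneg mult_nonneg_nonneg X' Y') auto
  also have "\<dots> \<le> sqrt (\<Sum>n<N. 1 / real N * Q (F n))"
  proof (rule real_sqrt_le_mono)
    have "(\<Sum>n<N. 1 / real N * X' (F n)) - (\<Sum>n<N. 1 / real N * Y' (F n))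
        = (\<Sum>n<N. 1 / real N * (X' (F n) - Y' (F n)))"
      by (simp add: sum_subtractf[symmetric] diff_divide_distrib)
    also have "\<bar>\<dots>\<bar> \<le> (\<Sum>n<N. \<bar>1 / real N * (X' (F n) - Y' (F n))\<bar>)"
      by (rule sum_abs)
    also have "\<dots> \<le> (\<Sum>n<N. 1 / real N * Q (F n))"
      using Q N by (intro sum_mono) (simp add: abs_mult divide_right_mono)
    finally show "\<bar>(\<Sum>n<N. 1 / real N * X' (F n)) - (\<Sum>n<N. 1 / real N * Y' (F n))\<bar>
        \<le> (\<Sum>n<N. 1 / real N * Q (F n))" .
  qed
  finally show ?thesis using 1 XX' YY' by linarith
qed

text \<open>Three of the four terms are governed by N and one by J. The estimates add up to the
  coefficients 2 + 5 K / 4 and 1/2 + K (1 + 1 / \<alpha>) of the two rates; the constant stated is a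
  common upper bound of both.\<close>

lemma expected_gap_bound:
  fixes \<mu> :: "l2 measure" and G :: "l2 \<Rightarrow> l2" and V :: "l2 \<Rightarrow> real \<Rightarrow> real" and L :: real
  assumes par: "\<alpha> > 0" "\<epsilon> > 0" "J \<ge> 2" "even J" "N \<ge> 1" "K \<ge> 0"
    and \<mu>: "prob_space \<mu>" "sets \<mu> = sets borel"
    and G: "L-lipschitz_on UNIV G"
    and C1: "\<And>f. C1_unit (cont_rep (G f))" and rep: "\<And>f. represents (cont_rep (G f)) (G f)"
    and V: "\<And>f. sq_integrable (V f)"
      "(\<lambda>z. V (fst z) (snd z)) \<in> borel_measurable (borel \<Otimes>\<^sub>M borel)"
    and A1: "assumption_A1 K \<mu> G V" and A2: "assumption_A2 K \<alpha> \<epsilon> N \<mu> G V"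
  shows "(\<integral>\<^sup>+F. ennreal \<bar>approx_error \<mu> G V - empirical_risk \<alpha> \<epsilon> N J G V F\<bar> \<partial>PiM {..<N} (\<lambda>_. \<mu>))
    \<le> ennreal ((4 + 3 * K + 2 * K * (1 + 1 / \<alpha>)) * (1 / real N powr (1 / 4) + 1 / real J powr (1 / 2)))"
proof -
  interpret M: prob_space \<mu> by (rule \<mu>)
  note mesh = shishkin_mesh[OF par(1-4)]
  let ?P = "PiM {..<N} (\<lambda>_. \<mu>)"
  let ?w = "mesh_weight \<alpha> \<epsilon> J" and ?y = "mesh_point \<alpha> \<epsilon> J"
  have y: "?y j \<in> {0..1}" if "j \<le> J" for j by (rule mesh_point_in[OF par(1-4) that])
  define U where "U f = cont_rep (G f)" for f
  have contU: "continuous_on {0..1} (U f)" for f unfolding U_def by (intro C1_unit_continuous C1)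
  have Um: "(\<lambda>f. U f x) \<in> borel_measurable borel" if "x \<in> {0..1}" for x
    unfolding U_def by (rule cont_rep_measurable[OF G rep C1_unit_continuous[OF C1] that])
  obtain W :: "l2 \<Rightarrow> real \<Rightarrow> real" where W1: "\<And>f. C1_unit (W f)"
    and Wm: "\<And>x. x \<in> {0..1} \<Longrightarrow> (\<lambda>f. W f x) \<in> borel_measurable borel"
    and VW: "\<And>x. x \<in> {0..1} \<Longrightarrow> (\<integral>\<^sup>+f. ennreal (\<bar>V f x - W f x\<bar>\<^sup>2) \<partial>\<mu>) \<le> ennreal (K / real N powr (1 / 2))"
    and dUW: "\<And>x. x \<in> {0..1} \<Longrightarrow>
      (\<integral>\<^sup>+f. ennreal \<bar>vector_derivative (\<lambda>y. (cont_rep (G f) y - W f y)\<^sup>2) (at x within {0..1})\<bar> \<partial>\<mu>)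
           \<le> ennreal (K * (1 + 1 / \<epsilon> * exp (- \<alpha> * (1 - x) / \<epsilon>)))"
    using A2 unfolding assumption_A2_def by blast
  have contW: "continuous_on {0..1} (W f)" for f by (intro C1_unit_continuous W1)
  have \<mu>_meas: "borel_measurable \<mu> = borel_measurable borel"
    by (rule measurable_cong_sets) (simp_all add: \<mu>(2))
  have pair_meas: "borel_measurable (\<mu> \<Otimes>\<^sub>M borel) = borel_measurable (borel \<Otimes>\<^sub>M borel)"
    by (rule measurable_cong_sets) (simp_all add: \<mu>(2) cong: sets_pair_measure_cong)
  have sqU: "sq_integrable (U f)" and sqW: "sq_integrable (W f)" for f
    by (intro sq_integrable_continuous contU contW)+
  have classU: "l2_class (U f) = G f" for f using rep[of f] by (simp add: U_def represents_def)
  have Uj: "(\<lambda>z. U (fst z) (clamp01 (snd z))) \<in> borel_measurable (\<mu> \<Otimes>\<^sub>M borel)"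
    unfolding pair_meas by (rule borel_measurable_Caratheodory[OF Um contU])
  have Wj: "(\<lambda>z. W (fst z) (clamp01 (snd z))) \<in> borel_measurable (\<mu> \<Otimes>\<^sub>M borel)"
    unfolding pair_meas by (rule borel_measurable_Caratheodory[OF Wm contW])
  have Vj: "(\<lambda>z. V (fst z) (snd z)) \<in> borel_measurable (\<mu> \<Otimes>\<^sub>M borel)"
    unfolding pair_meas by (rule V(2))
  have Vm: "(\<lambda>f. V f x) \<in> borel_measurable \<mu>" for x
    using measurable_compose[OF measurable_Pair2'[of x borel \<mu>] Vj] by simp
  have Um': "(\<lambda>f. U f x) \<in> borel_measurable \<mu>" and Wm': "(\<lambda>f. W f x) \<in> borel_measurable \<mu>" if "x \<in> {0..1}" for x
    unfolding \<mu>_meas using Um[OF that] Wm[OF that] by auto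
  define X where "X f = (norm (G f - l2_class (V f)))\<^sup>2" for f
  define X' where "X' f = (norm (G f - l2_class (W f)))\<^sup>2" for f
  define D where "D f = (norm (l2_class (V f) - l2_class (W f)))\<^sup>2" for f
  define Y where "Y f = (\<Sum>j\<le>J. ?w j * (U f (?y j) - V f (?y j))\<^sup>2)" for f
  define Y' where "Y' f = (\<Sum>j\<le>J. ?w j * (U f (?y j) - W f (?y j))\<^sup>2)" for f
  define D' where "D' f = (\<Sum>j\<le>J. ?w j * (V f (?y j) - W f (?y j))\<^sup>2)" for f
  define Q where "Q f = \<bar>X' f - Y' f\<bar>" for f
  \<comment> \<open>Composition with \<open>clamp01\<close> leaves the classes unchanged and
    supplies the joint measurability under which the squared norms are measurable in f.\<close>
  have X_eq: "X f = (norm (l2_class (\<lambda>x. U f (clamp01 x) - V f x)))\<^sup>2" for f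
    unfolding X_def minus_l2_class[OF clamp01_sq_integrable[OF sqU] V(1), symmetric]
      clamp01_l2_class[OF sqU] classU ..
  have X'_eq: "X' f = (norm (l2_class (\<lambda>x. U f (clamp01 x) - W f (clamp01 x))))\<^sup>2" for f
    unfolding X'_def minus_l2_class[OF clamp01_sq_integrable[OF sqU] clamp01_sq_integrable[OF sqW], symmetric]
      clamp01_l2_class[OF sqU] clamp01_l2_class[OF sqW] classU ..
  have D_eq: "D f = (norm (l2_class (\<lambda>x. V f x - W f (clamp01 x))))\<^sup>2" for f
    unfolding D_def minus_l2_class[OF V(1) clamp01_sq_integrable[OF sqW], symmetric]
      clamp01_l2_class[OF sqW] ..
  have Xm: "X \<in> borel_measurable \<mu>"
    unfolding X_eq[abs_def]
    by (rule l2_class_norm_measurable) (use Uj Vj V sqU in \<open>auto intro!: sq_integrable_diff clamp01_sq_integrable\<close>)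
  have X'm: "X' \<in> borel_measurable \<mu>"
    unfolding X'_eq[abs_def]
    by (rule l2_class_norm_measurable) (use Uj Wj sqW sqU in \<open>auto intro!: sq_integrable_diff clamp01_sq_integrable\<close>)
  have Dm: "D \<in> borel_measurable \<mu>"
    unfolding D_eq[abs_def]
    by (rule l2_class_norm_measurable) (use Wj Vj V sqW in \<open>auto intro!: sq_integrable_diff clamp01_sq_integrable\<close>)
  have Y'm: "Y' \<in> borel_measurable \<mu>"
    unfolding Y'_def[abs_def] using y Um' Wm'
    by (intro borel_measurable_sum borel_measurable_times borel_measurable_power borel_measurable_diff borel_measurable_const) auto
  have D'm: "D' \<in> borel_measurable \<mu>"
    unfolding D'_def[abs_def] using y Vm Wm'
    by (intro borel_measurable_sum borel_measurable_times borel_measurable_power borel_measurable_diff borel_measurable_const) auto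
  have Qm: "Q \<in> borel_measurable \<mu>"
    unfolding Q_def[abs_def] using X'm Y'm by measurable
  have nonneg: "X f \<ge> 0" "X' f \<ge> 0" "D f \<ge> 0" "Y f \<ge> 0" "Y' f \<ge> 0" "D' f \<ge> 0" "Q f \<ge> 0" for f
    by (auto simp: X_def X'_def D_def Y_def Y'_def D'_def Q_def intro!: sum_nonneg mult_nonneg_nonneg mesh)

  \<comment> \<open>The two target rates, used as parameters of the mean inequality; t^2 and s^2 are
    the orders of the expectations under the roots.\<close>
  define t where "t = 1 / real N powr (1 / 4)"
  define s where "s = 1 / real J powr (1 / 2)"
  have t: "t > 0" "t * t = 1 / real N powr (1 / 2)"
    using par(5) by (auto simp: t_def powr_add[symmetric])
  have s: "s > 0" "s * s = 1 / real J"
    using par(3) by (auto simp: s_def powr_add[symmetric])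

  \<comment> \<open>X is a squared norm, so its second moment is a fourth moment of the error n. The
    bound n^4 \<le> 1 + n^q, by cases n \<le> 1 and n > 1, reduces it to (A1).\<close>
  have EX2: "(\<integral>\<^sup>+f. ennreal ((X f)\<^sup>2) \<partial>\<mu>) \<le> ennreal (1 + K)"
  proof -
    obtain q where q: "q \<ge> 4" "(\<integral>\<^sup>+f. ennreal (norm (G f - l2_class (V f)) powr q) \<partial>\<mu>) \<le> ennreal K"
      using A1 unfolding assumption_A1_def by blast
    have le: "(X f)\<^sup>2 \<le> 1 + norm (G f - l2_class (V f)) powr q" for f
    proof -
      let ?n = "norm (G f - l2_class (V f))"
      have eq: "(X f)\<^sup>2 = ?n ^ 4" by (simp add: X_def)
      show ?thesis
      proof (cases "?n \<le> 1")
        case True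
        then have "?n ^ 4 \<le> 1" by (simp add: power_le_one)
        then show ?thesis unfolding eq by (simp add: add_increasing2)
      next
        case False
        then have "?n ^ 4 = ?n powr 4" by (simp add: powr_realpow[symmetric])
        also have "\<dots> \<le> ?n powr q" using False q(1) by (intro powr_mono) auto
        finally show ?thesis unfolding eq by simp
      qed
    qed
    have nm: "(\<lambda>f. ennreal (norm (G f - l2_class (V f)) powr q)) \<in> borel_measurable \<mu>"
    proof -
      have "norm (G f - l2_class (V f)) = sqrt (X f)" for f by (simp add: X_def)
      then show ?thesis using Xm by simp
    qed
    have "(\<integral>\<^sup>+f. ennreal ((X f)\<^sup>2) \<partial>\<mu>) \<le> (\<integral>\<^sup>+f. 1 + ennreal (norm (G f - l2_class (V f)) powr q) \<partial>\<mu>)"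
    proof (rule nn_integral_mono)
      fix f
      show "ennreal ((X f)\<^sup>2) \<le> 1 + ennreal (norm (G f - l2_class (V f)) powr q)"
        using ennreal_leI[OF le[of f]] by (simp add: ennreal_plus)
    qed
    also have "\<dots> = 1 + (\<integral>\<^sup>+f. ennreal (norm (G f - l2_class (V f)) powr q) \<partial>\<mu>)"
      using nm M.emeasure_space_1 by (subst nn_integral_add) auto
    also have "\<dots> \<le> 1 + ennreal K" by (intro add_left_mono q)
    also have "\<dots> = ennreal (1 + K)" using par by (simp add: ennreal_plus)
    finally show ?thesis .
  qed

  have VW2: "(\<integral>\<^sup>+f. ennreal ((V f x - W f x)\<^sup>2) \<partial>\<mu>) \<le> ennreal (K * (t * t))" if "x \<in> {0..1}" for x
    using VW[OF that] by (simp add: t(2))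
  have ED: "(\<integral>\<^sup>+f. ennreal (D f) \<partial>\<mu>) \<le> ennreal (K * (t * t))"
    unfolding D_eq
  proof (rule nn_integral_l2_class_norm_le[OF \<mu>(1)])
    show "sq_integrable (\<lambda>x. V f x - W f (clamp01 x))" for f
      by (intro sq_integrable_diff V clamp01_sq_integrable sqW)
    show "(\<lambda>z. V (fst z) (snd z) - W (fst z) (clamp01 (snd z))) \<in> borel_measurable (\<mu> \<Otimes>\<^sub>M borel)"
      by (intro borel_measurable_diff Vj Wj)
    show "(\<integral>\<^sup>+f. ennreal ((V f x - W f (clamp01 x))\<^sup>2) \<partial>\<mu>) \<le> ennreal (K * (t * t))" if "x \<in> {0..1}" for x
      using VW2[OF that] by (simp only: clamp01_id[OF that])
  qed
  \<comment> \<open>A weighted average of the bounds at the mesh points, with total weight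
    1.\<close>
  have ED': "(\<integral>\<^sup>+f. ennreal (D' f) \<partial>\<mu>) \<le> ennreal (K * (t * t))"
  proof -
    let ?d = "\<lambda>j f. ennreal ((V f (?y j) - W f (?y j))\<^sup>2)"
    have dm: "?d j \<in> borel_measurable \<mu>" if "j \<le> J" for j
      using Vm[of "?y j"] Wm'[OF y[OF that]] by measurable
    have "(\<integral>\<^sup>+f. ennreal (D' f) \<partial>\<mu>) = (\<integral>\<^sup>+f. (\<Sum>j\<le>J. ennreal (?w j) * ?d j f) \<partial>\<mu>)"
    proof (rule nn_integral_cong)
      fix f
      have "(\<Sum>j\<le>J. ennreal (?w j) * ?d j f) = (\<Sum>j\<le>J. ennreal (?w j * (V f (?y j) - W f (?y j))\<^sup>2))"
        using mesh(4) by (intro sum.cong refl ennreal_mult[symmetric]) auto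
      also have "\<dots> = ennreal (D' f)"
        unfolding D'_def using mesh(4) by (intro sum_ennreal) auto
      finally show "ennreal (D' f) = (\<Sum>j\<le>J. ennreal (?w j) * ?d j f)" ..
    qed
    also have "\<dots> = (\<Sum>j\<le>J. \<integral>\<^sup>+f. ennreal (?w j) * ?d j f \<partial>\<mu>)"
      by (intro nn_integral_sum borel_measurable_times_ennreal dm) auto
    also have "\<dots> = (\<Sum>j\<le>J. ennreal (?w j) * (\<integral>\<^sup>+f. ?d j f \<partial>\<mu>))"
      by (intro sum.cong refl nn_integral_cmult dm) auto
    also have "\<dots> \<le> (\<Sum>j\<le>J. ennreal (?w j) * ennreal (K * (t * t)))"
      by (intro sum_mono mult_left_mono VW2 y) auto
    also have "\<dots> = (\<Sum>j\<le>J. ennreal (?w j)) * ennreal (K * (t * t))"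
      by (simp add: sum_distrib_right)
    also have "(\<Sum>j\<le>J. ennreal (?w j)) = 1"
      using mesh(4) sum_mesh_weight_1[OF par(1-4)] by (subst sum_ennreal) auto
    finally show ?thesis by simp
  qed
  \<comment> \<open>X' f is the exact integral and Y' f the mesh sum of one and the same C^1
    function, the square of U f - W f; this is the purpose of the smooth approximation.\<close>
  have EQ: "(\<integral>\<^sup>+f. ennreal (Q f) \<partial>\<mu>) \<le> ennreal (2 * (s * s) * (K * (1 + 1 / \<alpha>)))"
  proof -
    have X'L: "X' f = (LINT x|I01. (U f x - W f x)\<^sup>2)" for f
      unfolding X'_def classU[symmetric] minus_l2_class[OF sqU sqW]
      by (rule norm_l2_class_square[OF sq_integrable_diff[OF sqU sqW]])
    have "(\<integral>\<^sup>+f. ennreal \<bar>(LINT x|I01. (U f x - W f x)\<^sup>2) -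
        (\<Sum>j\<le>J. ?w j * (U f (?y j) - W f (?y j))\<^sup>2)\<bar> \<partial>\<mu>) \<le> ennreal (2 / real J * (K * (1 + 1 / \<alpha>)))"
    proof (rule nn_integral_quadrature_error[OF par(1-4,6) \<mu>(1), where g = "\<lambda>f x. (U f x - W f x)\<^sup>2"])
      show "C1_unit (\<lambda>x. (U f x - W f x)\<^sup>2)" for f
      proof -
        obtain u' w' where d: "continuous_on {0..1} u'" "continuous_on {0..1} w'"
          "\<And>x. x \<in> {0..1} \<Longrightarrow> (U f has_real_derivative u' x) (at x within {0..1})"
          "\<And>x. x \<in> {0..1} \<Longrightarrow> (W f has_real_derivative w' x) (at x within {0..1})"
          using C1[of f] W1[of f] unfolding C1_unit_def U_def by blast
        then show ?thesis
          unfolding C1_unit_def using contU[of f] contW[of f]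
          by (intro exI[of _ "\<lambda>x. 2 * (U f x - W f x) * (u' x - w' x)"])
             (auto intro!: continuous_intros derivative_eq_intros d)
      qed
      show "(\<lambda>f. (U f x - W f x)\<^sup>2) \<in> borel_measurable \<mu>" if "x \<in> {0..1}" for x
        using Um'[OF that] Wm'[OF that] by measurable
    qed (use dUW in \<open>simp add: U_def\<close>)
    then show ?thesis by (simp add: Q_def X'L Y'_def s(2))
  qed
  have EDev: "(\<integral>\<^sup>+F. ennreal \<bar>(LINT f|\<mu>. X f) - (\<Sum>n<N. 1 / real N * X (F n))\<bar> \<partial>?P)
      \<le> ennreal ((2 + K) / 2 * (t * t))"
  proof -
    have "(1 + (1 + K)) / 2 / sqrt (real N) = (2 + K) / 2 * (t * t)"
      by (simp add: t(2) powr_half_sqrt)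
    then show ?thesis
      using sample_mean_deviation[OF \<mu>(1) par(5) Xm EX2] par(6) by (simp only: add_nonneg_nonneg zero_le_one)
  qed

  have mean_meas: "(\<lambda>F. \<Sum>n<N. 1 / real N * h (F n)) \<in> borel_measurable ?P"
    if "h \<in> borel_measurable \<mu>" for h :: "l2 \<Rightarrow> real"
    using that
    by (intro borel_measurable_sum borel_measurable_times borel_measurable_const
        measurable_compose[OF measurable_component_singleton]) auto
  have mean_nonneg: "(\<Sum>n<N. 1 / real N * h (F n)) \<ge> 0" if "\<And>f. h f \<ge> 0" for h :: "l2 \<Rightarrow> real" and F
    using that by (intro sum_nonneg mult_nonneg_nonneg) auto
  have P: "prob_space ?P" by (rule prob_space_PiM) (rule \<mu>)
  let ?S1 = "\<lambda>F. sqrt \<bar>(LINT f|\<mu>. X f) - (\<Sum>n<N. 1 / real N * X (F n))\<bar>"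
  let ?S = "\<lambda>h F. sqrt (\<Sum>n<N. 1 / real N * h (F n))"
  have mean_bound: "(\<integral>\<^sup>+F. ennreal (?S h F) \<partial>?P) \<le> ennreal ((r + c / r) / 2)"
    if "h \<in> borel_measurable \<mu>" "\<And>f. h f \<ge> 0" "(\<integral>\<^sup>+f. ennreal (h f) \<partial>\<mu>) \<le> ennreal c" "c \<ge> 0" "r > 0"
    for h :: "l2 \<Rightarrow> real" and c r
    using that by (intro nn_integral_sqrt_bound[OF P] mean_meas mean_nonneg)
      (simp_all only: nn_integral_sample_mean[OF \<mu>(1) par(5)])
  have B1: "(\<integral>\<^sup>+F. ennreal (?S1 F) \<partial>?P) \<le> ennreal ((t + ((2 + K) / 2 * (t * t)) / t) / 2)"
    using par t by (intro nn_integral_sqrt_bound[OF P _ _ EDev] borel_measurable_abs borel_measurable_diff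
        mean_meas Xm borel_measurable_const) auto
  have B2: "(\<integral>\<^sup>+F. ennreal (?S D F) \<partial>?P) \<le> ennreal ((t + (K * (t * t)) / t) / 2)"
    using par t by (intro mean_bound Dm nonneg ED) auto
  have B3: "(\<integral>\<^sup>+F. ennreal (?S Q F) \<partial>?P) \<le> ennreal ((s + (2 * (s * s) * (K * (1 + 1 / \<alpha>))) / s) / 2)"
    using par s by (intro mean_bound Qm nonneg EQ) auto
  have B4: "(\<integral>\<^sup>+F. ennreal (?S D' F) \<partial>?P) \<le> ennreal ((t + (K * (t * t)) / t) / 2)"
    using par t by (intro mean_bound D'm nonneg ED') auto

  have approx: "approx_error \<mu> G V = sqrt (LINT f|\<mu>. X f)"
    by (simp add: approx_error_def X_def)
  have emp: "empirical_risk \<alpha> \<epsilon> N J G V F = ?S Y F" for F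
    unfolding empirical_risk_def Y_def U_def by (simp add: sum_distrib_left)
  have pw: "\<bar>approx_error \<mu> G V - empirical_risk \<alpha> \<epsilon> N J G V F\<bar> \<le> ?S1 F + ?S D F + ?S Q F + ?S D' F" for F
    unfolding approx emp
  proof (rule generalization_gap_pointwise[OF par(5), where X' = X' and Y' = Y'])
    show "0 \<le> (LINT f|\<mu>. X f)" by (simp add: nonneg)
    show "\<bar>X' f - Y' f\<bar> \<le> Q f" for f by (simp add: Q_def)
    \<comment> \<open>The reverse triangle inequality is used on two levels: over the samples, and
      then in the \<open>l2\<close> norm of the error of each sample.\<close>
    have "\<bar>?S X F - ?S X' F\<bar> \<le> sqrt (\<Sum>n<N. 1 / real N *
        (norm (G (F n) - l2_class (V (F n))) - norm (G (F n) - l2_class (W (F n))))\<^sup>2)"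
      unfolding X_def X'_def by (rule weighted_L2_diff) simp
    also have "\<dots> \<le> ?S D F"
    proof (intro real_sqrt_le_mono sum_mono mult_left_mono)
      fix n
      have "\<bar>norm (G (F n) - l2_class (V (F n))) - norm (G (F n) - l2_class (W (F n)))\<bar>
          \<le> norm ((G (F n) - l2_class (V (F n))) - (G (F n) - l2_class (W (F n))))"
        by (rule norm_triangle_ineq3)
      also have "\<dots> = norm (l2_class (V (F n)) - l2_class (W (F n)))"
        by (simp add: norm_minus_commute)
      finally show "(norm (G (F n) - l2_class (V (F n))) - norm (G (F n) - l2_class (W (F n))))\<^sup>2 \<le> D (F n)"
        unfolding D_def by (simp add: abs_le_square_iff[symmetric])
    qed simp
    finally show "\<bar>?S X F - ?S X' F\<bar> \<le> ?S D F" .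
    \<comment> \<open>Samples and mesh points are merged into one index set, so that a single
      weighted triangle inequality covers the double sum; the common term U cancels in the
      difference.\<close>
    have flat: "?S (\<lambda>f. \<Sum>j\<le>J. ?w j * (a f j)\<^sup>2) F =
        sqrt (\<Sum>i\<in>{..<N} \<times> {..J}. (1 / real N * ?w (snd i)) * (a (F (fst i)) (snd i))\<^sup>2)" for a :: "l2 \<Rightarrow> nat \<Rightarrow> real"
      by (simp add: sum_distrib_left sum.cartesian_product' mult.assoc)
    have flats: "?S Y' F = sqrt (\<Sum>i\<in>{..<N} \<times> {..J}. (1 / real N * ?w (snd i)) * (U (F (fst i)) (?y (snd i)) - W (F (fst i)) (?y (snd i)))\<^sup>2)"
      "?S Y F = sqrt (\<Sum>i\<in>{..<N} \<times> {..J}. (1 / real N * ?w (snd i)) * (U (F (fst i)) (?y (snd i)) - V (F (fst i)) (?y (snd i)))\<^sup>2)"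
      "?S D' F = sqrt (\<Sum>i\<in>{..<N} \<times> {..J}. (1 / real N * ?w (snd i)) * (V (F (fst i)) (?y (snd i)) - W (F (fst i)) (?y (snd i)))\<^sup>2)"
      unfolding Y_def Y'_def D'_def
      by (rule flat[of "\<lambda>f j. U f (?y j) - W f (?y j)"] flat[of "\<lambda>f j. U f (?y j) - V f (?y j)"]
            flat[of "\<lambda>f j. V f (?y j) - W f (?y j)"])+
    have "\<bar>sqrt (\<Sum>i\<in>{..<N} \<times> {..J}. (1 / real N * ?w (snd i)) * (U (F (fst i)) (?y (snd i)) - W (F (fst i)) (?y (snd i)))\<^sup>2)
        - sqrt (\<Sum>i\<in>{..<N} \<times> {..J}. (1 / real N * ?w (snd i)) * (U (F (fst i)) (?y (snd i)) - V (F (fst i)) (?y (snd i)))\<^sup>2)\<bar>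
      \<le> sqrt (\<Sum>i\<in>{..<N} \<times> {..J}. (1 / real N * ?w (snd i)) *
          ((U (F (fst i)) (?y (snd i)) - W (F (fst i)) (?y (snd i))) - (U (F (fst i)) (?y (snd i)) - V (F (fst i)) (?y (snd i))))\<^sup>2)"
      by (rule weighted_L2_diff) (intro mult_nonneg_nonneg mesh(4), simp)
    then show "\<bar>?S Y' F - ?S Y F\<bar> \<le> ?S D' F"
      unfolding flats by simp
  qed (rule nonneg)+

  have m1: "(\<lambda>F. ennreal (?S1 F)) \<in> borel_measurable ?P"
    using mean_meas[OF Xm] by measurable
  have m2: "(\<lambda>F. ennreal (?S h F)) \<in> borel_measurable ?P" if "h \<in> borel_measurable \<mu>" for h :: "l2 \<Rightarrow> real"
    using mean_meas[OF that] by measurable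
  have "(\<integral>\<^sup>+F. ennreal \<bar>approx_error \<mu> G V - empirical_risk \<alpha> \<epsilon> N J G V F\<bar> \<partial>?P)
      \<le> (\<integral>\<^sup>+F. ennreal (?S1 F) + ennreal (?S D F) + ennreal (?S Q F) + ennreal (?S D' F) \<partial>?P)"
  proof (rule nn_integral_mono)
    fix F
    have "ennreal \<bar>approx_error \<mu> G V - empirical_risk \<alpha> \<epsilon> N J G V F\<bar> \<le> ennreal (?S1 F + ?S D F + ?S Q F + ?S D' F)"
      by (rule ennreal_leI[OF pw])
    also have "\<dots> = ennreal (?S1 F) + ennreal (?S D F) + ennreal (?S Q F) + ennreal (?S D' F)"
      by (simp only: ennreal_plus real_sqrt_ge_zero abs_ge_zero mean_nonneg nonneg add_nonneg_nonneg)
    finally show "ennreal \<bar>approx_error \<mu> G V - empirical_risk \<alpha> \<epsilon> N J G V F\<bar>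
        \<le> ennreal (?S1 F) + ennreal (?S D F) + ennreal (?S Q F) + ennreal (?S D' F)" .
  qed
  also have "\<dots> = (\<integral>\<^sup>+F. ennreal (?S1 F) \<partial>?P) + (\<integral>\<^sup>+F. ennreal (?S D F) \<partial>?P)
      + (\<integral>\<^sup>+F. ennreal (?S Q F) \<partial>?P) + (\<integral>\<^sup>+F. ennreal (?S D' F) \<partial>?P)"
    by (simp only: nn_integral_add m1 m2 Dm D'm Qm borel_measurable_add)
  also have "\<dots> \<le> ennreal ((t + ((2 + K) / 2 * (t * t)) / t) / 2) + ennreal ((t + (K * (t * t)) / t) / 2)
      + ennreal ((s + (2 * (s * s) * (K * (1 + 1 / \<alpha>))) / s) / 2) + ennreal ((t + (K * (t * t)) / t) / 2)"
    by (intro add_mono B1 B2 B3 B4)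
  also have "\<dots> = ennreal ((t + ((2 + K) / 2 * (t * t)) / t) / 2 + (t + (K * (t * t)) / t) / 2
      + (s + (2 * (s * s) * (K * (1 + 1 / \<alpha>))) / s) / 2 + (t + (K * (t * t)) / t) / 2)"
    using t(1) s(1) par by (subst ennreal_plus[symmetric]; simp)+
  also have "\<dots> \<le> ennreal ((4 + 3 * K + 2 * K * (1 + 1 / \<alpha>)) * (t + s))"
  proof (rule ennreal_leI)
    let ?K' = "K * (1 + 1 / \<alpha>)"
    have K': "?K' \<ge> 0" using par by simp
    have "(t + ((2 + K) / 2 * (t * t)) / t) / 2 + (t + (K * (t * t)) / t) / 2
      + (s + (2 * (s * s) * ?K') / s) / 2 + (t + (K * (t * t)) / t) / 2
      = (2 + 5 / 4 * K) * t + (1 / 2 + ?K') * s"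
      using t(1) s(1) by (simp add: field_simps)
    also have "\<dots> \<le> (4 + 3 * K + 2 * ?K') * t + (4 + 3 * K + 2 * ?K') * s"
    proof -
      have c: "2 + 5 / 4 * K \<le> 4 + 3 * K + 2 * ?K'" "1 / 2 + ?K' \<le> 4 + 3 * K + 2 * ?K'"
        using par(6) K' by linarith+
      show ?thesis
        by (rule add_mono[OF mult_right_mono[OF c(1) less_imp_le[OF t(1)]]
              mult_right_mono[OF c(2) less_imp_le[OF s(1)]]])
    qed
    finally show "(t + ((2 + K) / 2 * (t * t)) / t) / 2 + (t + (K * (t * t)) / t) / 2
      + (s + (2 * (s * s) * ?K') / s) / 2 + (t + (K * (t * t)) / t) / 2
      \<le> (4 + 3 * K + 2 * K * (1 + 1 / \<alpha>)) * (t + s)"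
      by (simp only: distrib_left mult.assoc)
  qed
  finally show ?thesis unfolding t_def s_def .
qed

section \<open>The gap of a learned network\<close>

text \<open>The constant is fixed before \<epsilon>, l, N, J, m, p and all the objects that depend
  on them; the one chosen is a function of K and \<alpha> only.\<close>

theorem theorem4p1:
  fixes a b :: "real \<Rightarrow> real" and \<alpha> K :: real
  assumes "C1_unit a" and "C1_unit b"
    and "\<alpha> > 0" and "\<forall>x\<in>{0..1}. a x \<ge> \<alpha>"
  shows "\<exists>C::real. \<forall>(\<epsilon>::real) (l::real) (N::nat) (J::nat) (m::nat) (p::nat)
      (G :: l2 \<Rightarrow> l2) (\<mu> :: l2 measure) (s :: nat \<Rightarrow> real) (E :: l2 \<Rightarrow> nat \<Rightarrow> real)
      (P :: 'w measure) (F :: nat \<Rightarrow> 'w \<Rightarrow> l2)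
      (T :: 'd measure) (D :: 'w \<Rightarrow> 'd) (\<N> :: 'd \<Rightarrow> l2 \<Rightarrow> real \<Rightarrow> real).
      \<epsilon> > 0 \<longrightarrow> l > 0 \<longrightarrow> N \<ge> 1 \<longrightarrow> J \<ge> 2 \<longrightarrow> even J \<longrightarrow>
      solution_operator \<epsilon> a b G \<longrightarrow> (\<exists>L. L-lipschitz_on UNIV G) \<longrightarrow>
      centred_gaussian \<mu> \<longrightarrow> has_covariance \<mu> (cov_operator l) \<longrightarrow>
      prob_space P \<longrightarrow> iid_samples P \<mu> N F \<longrightarrow>
      encoder m s E \<longrightarrow> learned_network P T D \<N> m p E N F \<longrightarrow>
      (AE \<omega> in P. assumption_A1 K \<mu> G (\<N> (D \<omega>))) \<longrightarrow>
      (AE \<omega> in P. assumption_A2 K \<alpha> \<epsilon> N \<mu> G (\<N> (D \<omega>))) \<longrightarrow>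
      generalization_gap P \<mu> \<alpha> \<epsilon> N J G (\<lambda>\<omega>. \<N> (D \<omega>)) F
        \<le> ennreal (C * (1 / real N powr (1 / 4) + sqrt (ln (real J)) / real J powr (1 / 2)))"
proof -
  \<comment> \<open>K carries no sign condition, while the estimates for a fixed network require a
    nonnegative constant; enlarging K preserves (A1) and (A2).\<close>
  define K0 where "K0 = max K 0"
  define C0 where "C0 = 4 + 3 * K0 + 2 * K0 * (1 + 1 / \<alpha>)"
  define C where "C = C0 * max 1 (1 / sqrt (ln 2))"
  have K0: "K0 \<ge> 0" "K \<le> K0" by (auto simp: K0_def)
  have C0: "C0 \<ge> 0" using K0 assms(3) by (simp add: C0_def)
  show ?thesis
  proof (intro exI[of _ C] allI impI)
    fix \<epsilon> l :: real and N J m p :: nat and G :: "l2 \<Rightarrow> l2" and \<mu> :: "l2 measure"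
      and s :: "nat \<Rightarrow> real" and E :: "l2 \<Rightarrow> nat \<Rightarrow> real" and P :: "'w measure" and F :: "nat \<Rightarrow> 'w \<Rightarrow> l2"
      and T :: "'d measure" and D :: "'w \<Rightarrow> 'd" and \<N> :: "'d \<Rightarrow> l2 \<Rightarrow> real \<Rightarrow> real"
    assume \<epsilon>: "\<epsilon> > 0" and "l > 0" and N: "N \<ge> 1" and J: "J \<ge> 2" "even J"
      and sol: "solution_operator \<epsilon> a b G" and lip: "\<exists>L. L-lipschitz_on UNIV G"
      and gauss: "centred_gaussian \<mu>" and P: "prob_space P" and iid: "iid_samples P \<mu> N F"
      and net: "learned_network P T D \<N> m p E N F"
      and A1: "AE \<omega> in P. assumption_A1 K \<mu> G (\<N> (D \<omega>))"
      and A2: "AE \<omega> in P. assumption_A2 K \<alpha> \<epsilon> N \<mu> G (\<N> (D \<omega>))"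
    interpret P: prob_space P by (rule P)
    obtain L where L: "L-lipschitz_on UNIV G" using lip by blast
    have \<mu>: "prob_space \<mu>" "sets \<mu> = sets borel" using gauss by (auto simp: centred_gaussian_def)
    interpret M: prob_space \<mu> by (rule \<mu>)
    note regular = solution_operator_C1[OF \<epsilon> assms(1,2) sol]
    let ?y = "mesh_point \<alpha> \<epsilon> J" and ?w = "mesh_weight \<alpha> \<epsilon> J"
    let ?S = "PiM {..<N} (\<lambda>_. borel :: l2 measure)" and ?S\<mu> = "PiM {..<N} (\<lambda>_. \<mu>)"
    \<comment> \<open>All samples as one random element of the product space. Values at indices from
      N on are \<open>undefined\<close>, and the empirical risk never reads them.\<close>
    define Fr where "Fr \<omega> = restrict (\<lambda>n. F n \<omega>) {..<N}" for \<omega>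
    define bound where "bound = C0 * (1 / real N powr (1 / 4) + 1 / real J powr (1 / 2))"
    define gap where "gap d F' = ennreal \<bar>approx_error \<mu> G (\<N> d) - empirical_risk \<alpha> \<epsilon> N J G (\<N> d) F'\<bar>" for d F'

    have deep: "deeponet m p E (\<N> d)" if "d \<in> space T" for d
      using net that by (simp add: learned_network_def)
    have \<N>m: "(\<lambda>(d, f, x). \<N> d f x) \<in> borel_measurable (T \<Otimes>\<^sub>M borel \<Otimes>\<^sub>M borel)"
      and Dm: "D \<in> measurable P T"
      and ind: "P.indep_set (sets (vimage_algebra (space P) D T)) (sets (vimage_algebra (space P) Fr ?S))"
      using net unfolding learned_network_def Fr_def[abs_def] by blast+
    have Fiv: "P.indep_vars (\<lambda>_. borel) F {..<N}" and Fd: "\<And>n. n < N \<Longrightarrow> distr P borel (F n) = \<mu>"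
      using iid by (simp_all add: iid_samples_def)
    have Fm: "F n \<in> measurable P borel" if "n < N" for n
      using Fiv that by (auto simp: P.indep_vars_def)
    have Frm: "Fr \<in> measurable P ?S"
      unfolding Fr_def[abs_def] by (rule measurable_restrict) (use Fm in auto)
    have law_F: "distr P ?S Fr = ?S\<mu>"
    proof -
      have "0 \<in> {..<N}" using N by simp
      then have ne: "{..<N} \<noteq> {}" by blast
      have "distr P ?S Fr = PiM {..<N} (\<lambda>n. distr P borel (F n))"
        unfolding Fr_def[abs_def]
        by (rule P.indep_vars_iff_distr_eq_PiM'[OF ne, THEN iffD1, OF _ Fiv]) (use Fm in auto)
      also have "\<dots> = ?S\<mu>" by (rule PiM_cong) (use Fd in auto)
      finally show ?thesis .
    qed
    \<comment> \<open>Product laws are determined by rectangles, and on these independence of the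
      two generated sigma-algebras is the product formula.\<close>
    have law: "distr P T D \<Otimes>\<^sub>M distr P ?S Fr = distr P (T \<Otimes>\<^sub>M ?S) (\<lambda>\<omega>. (D \<omega>, Fr \<omega>))"
    proof (rule pair_measure_eqI)
      interpret D: prob_space "distr P T D" by (rule P.prob_space_distr[OF Dm])
      interpret Fr: prob_space "distr P ?S Fr" by (rule P.prob_space_distr[OF Frm])
      show "sigma_finite_measure (distr P T D)" "sigma_finite_measure (distr P ?S Fr)" ..
      show "sets (distr P T D \<Otimes>\<^sub>M distr P ?S Fr) = sets (distr P (T \<Otimes>\<^sub>M ?S) (\<lambda>\<omega>. (D \<omega>, Fr \<omega>)))"
        by (simp cong: sets_pair_measure_cong)
      fix A B assume "A \<in> sets (distr P T D)" "B \<in> sets (distr P ?S Fr)"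
      then have AB: "A \<in> sets T" "B \<in> sets ?S" by simp_all
      have prod: "P.prob ((D -` A \<inter> space P) \<inter> (Fr -` B \<inter> space P)) =
          P.prob (D -` A \<inter> space P) * P.prob (Fr -` B \<inter> space P)"
        by (rule P.indep_setD[OF ind]) (intro in_vimage_algebra AB)+
      have "(\<lambda>\<omega>. (D \<omega>, Fr \<omega>)) -` (A \<times> B) \<inter> space P = (D -` A \<inter> space P) \<inter> (Fr -` B \<inter> space P)"
        by auto
      then show "emeasure (distr P T D) A * emeasure (distr P ?S Fr) B =
          emeasure (distr P (T \<Otimes>\<^sub>M ?S) (\<lambda>\<omega>. (D \<omega>, Fr \<omega>))) (A \<times> B)"
        using AB prod measurable_Pair[OF Dm Frm]
        by (simp add: emeasure_distr Dm Frm P.emeasure_eq_measure ennreal_mult)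
    qed

    have Um: "(\<lambda>f. cont_rep (G f) x) \<in> borel_measurable borel" if "x \<in> {0..1}" for x
      by (rule cont_rep_measurable[OF L regular(2,3) that])
    \<comment> \<open>Fubini requires measurability of the gap in the data and the samples jointly;
      this rests on the joint measurability of the network in (d, f, x).\<close>
    have gap_meas: "(\<lambda>z. gap (fst z) (snd z)) \<in> borel_measurable (T \<Otimes>\<^sub>M ?S)"
    proof -
      have Xm: "(\<lambda>z. (norm (G (snd z) - l2_class (\<N> (fst z) (snd z))))\<^sup>2) \<in> borel_measurable (T \<Otimes>\<^sub>M borel)"
      proof -
        have sq: "sq_integrable (\<lambda>x. cont_rep (G f) (clamp01 x))"
          and cl: "l2_class (\<lambda>x. cont_rep (G f) (clamp01 x)) = G f" for f
          using clamp01_sq_integrable clamp01_l2_class regular(2)[of f] by (auto simp: represents_def)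
        have sqN: "sq_integrable (\<N> d f)" if "d \<in> space T" for d f
          by (rule deeponet_sq_integrable[OF deep[OF that]])
        have "(\<lambda>z. (norm (l2_class (\<lambda>x. cont_rep (G (snd z)) (clamp01 x) - \<N> (fst z) (snd z) x)))\<^sup>2)
            \<in> borel_measurable (T \<Otimes>\<^sub>M borel)"
        proof (rule l2_class_norm_measurable)
          show "sq_integrable (\<lambda>x. cont_rep (G (snd z)) (clamp01 x) - \<N> (fst z) (snd z) x)"
            if "z \<in> space (T \<Otimes>\<^sub>M borel)" for z
            using that by (intro sq_integrable_diff sq sqN) (auto simp: space_pair_measure)
          have p1: "(\<lambda>z. cont_rep (G (fst z)) (clamp01 (snd z))) \<in> borel_measurable (borel \<Otimes>\<^sub>M borel)"
            by (rule borel_measurable_Caratheodory[OF Um regular(3)])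
          have p2: "(\<lambda>z. (snd (fst z), snd z)) \<in> measurable ((T \<Otimes>\<^sub>M borel) \<Otimes>\<^sub>M borel) (borel \<Otimes>\<^sub>M borel)"
            by measurable
          have 1: "(\<lambda>z. cont_rep (G (snd (fst z))) (clamp01 (snd z)))
              \<in> borel_measurable ((T \<Otimes>\<^sub>M borel) \<Otimes>\<^sub>M borel)"
            using measurable_compose[OF p2 p1] by simp
          have "(\<lambda>z. (fst (fst z), snd (fst z), snd z)) \<in> measurable ((T \<Otimes>\<^sub>M borel) \<Otimes>\<^sub>M borel) (T \<Otimes>\<^sub>M borel \<Otimes>\<^sub>M borel)"
            by measurable
          from measurable_compose[OF this \<N>m] 1
          show "(\<lambda>z. cont_rep (G (snd (fst z))) (clamp01 (snd z)) - \<N> (fst (fst z)) (snd (fst z)) (snd z))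
              \<in> borel_measurable ((T \<Otimes>\<^sub>M borel) \<Otimes>\<^sub>M borel)"
            by simp
        qed
        also have "?this \<longleftrightarrow> ?thesis"
          by (rule measurable_cong)
             (simp add: space_pair_measure minus_l2_class[OF sq sqN, symmetric] cl split_beta mem_Times_iff)
        finally show ?thesis .
      qed
      have am: "(\<lambda>d. approx_error \<mu> G (\<N> d)) \<in> borel_measurable T"
      proof -
        have "(\<lambda>(d, f). (norm (G f - l2_class (\<N> d f)))\<^sup>2) \<in> borel_measurable (T \<Otimes>\<^sub>M \<mu>)"
          using Xm by (simp add: split_beta' \<mu>(2) cong: measurable_cong_sets sets_pair_measure_cong)
        from M.borel_measurable_lebesgue_integral[OF this] show ?thesis
          unfolding approx_error_def by measurable
      qed
      have em: "(\<lambda>z. empirical_risk \<alpha> \<epsilon> N J G (\<N> (fst z)) (snd z)) \<in> borel_measurable (T \<Otimes>\<^sub>M ?S)"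
      proof -
        have c: "(\<lambda>z. snd z n) \<in> measurable (T \<Otimes>\<^sub>M ?S) borel" if "n < N" for n
          by (rule measurable_compose[OF measurable_snd measurable_component_singleton]) (use that in auto)
        have u: "(\<lambda>z. cont_rep (G (snd z n)) (?y j)) \<in> borel_measurable (T \<Otimes>\<^sub>M ?S)" if "n < N" "j \<le> J" for n j
          by (rule measurable_compose[OF c[OF that(1)] Um[OF mesh_point_in[OF assms(3) \<epsilon> J that(2)]]])
        have v: "(\<lambda>z. \<N> (fst z) (snd z n) x) \<in> borel_measurable (T \<Otimes>\<^sub>M ?S)" if "n < N" for n x
        proof -
          have "(\<lambda>z. (fst z, snd z n, x)) \<in> measurable (T \<Otimes>\<^sub>M ?S) (T \<Otimes>\<^sub>M borel \<Otimes>\<^sub>M borel)"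
            using c[OF that] by measurable
          from measurable_compose[OF this \<N>m] show ?thesis by simp
        qed
        have "(\<lambda>z. \<Sum>n<N. \<Sum>j\<le>J. ?w j * \<bar>cont_rep (G (snd z n)) (?y j) - \<N> (fst z) (snd z n) (?y j)\<bar>\<^sup>2)
            \<in> borel_measurable (T \<Otimes>\<^sub>M ?S)"
          using u v
          by (intro borel_measurable_times borel_measurable_sum borel_measurable_power
              borel_measurable_abs borel_measurable_diff borel_measurable_const) auto
        then show ?thesis
          unfolding empirical_risk_def by measurable
      qed
      show ?thesis
        unfolding gap_def using measurable_compose[OF measurable_fst am] em by measurable
    qed

    have inner: "(\<integral>\<^sup>+F'. gap (D \<omega>) F' \<partial>?S\<mu>) \<le> ennreal bound"
      if \<omega>: "D \<omega> \<in> space T" "assumption_A1 K \<mu> G (\<N> (D \<omega>))" "assumption_A2 K \<alpha> \<epsilon> N \<mu> G (\<N> (D \<omega>))" for \<omega>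
    proof -
      have "(\<lambda>z. (D \<omega>, fst z, snd z)) \<in> measurable (borel \<Otimes>\<^sub>M borel) (T \<Otimes>\<^sub>M borel \<Otimes>\<^sub>M borel)"
        using \<omega>(1) by measurable
      from measurable_compose[OF this \<N>m]
      have "(\<lambda>z. \<N> (D \<omega>) (fst z) (snd z)) \<in> borel_measurable (borel \<Otimes>\<^sub>M borel)" by simp
      then show ?thesis
        unfolding gap_def bound_def C0_def
        by (intro expected_gap_bound[OF assms(3) \<epsilon> J N K0(1) \<mu> L regular(1,2)]
            deeponet_sq_integrable[OF deep] assumption_A1_mono[OF _ K0(2)]
            assumption_A2_mono[OF _ K0(2) \<epsilon>] \<omega>)
    qed

    have "generalization_gap P \<mu> \<alpha> \<epsilon> N J G (\<lambda>\<omega>. \<N> (D \<omega>)) F = (\<integral>\<^sup>+\<omega>. gap (D \<omega>) (Fr \<omega>) \<partial>P)"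
      by (simp add: generalization_gap_def gap_def empirical_risk_def Fr_def)
    also have "\<dots> = (\<integral>\<^sup>+z. gap (fst z) (snd z) \<partial>distr P (T \<Otimes>\<^sub>M ?S) (\<lambda>\<omega>. (D \<omega>, Fr \<omega>)))"
      using Dm Frm gap_meas by (subst nn_integral_distr) (auto intro!: measurable_Pair)
    also have "\<dots> = (\<integral>\<^sup>+z. gap (fst z) (snd z) \<partial>(distr P T D \<Otimes>\<^sub>M ?S\<mu>))"
      unfolding law[symmetric] law_F ..
    also have "\<dots> = (\<integral>\<^sup>+d. \<integral>\<^sup>+F'. gap d F' \<partial>?S\<mu> \<partial>distr P T D)"
    proof -
      interpret S: prob_space ?S\<mu> by (rule prob_space_PiM) (rule \<mu>)
      have "(\<lambda>z. gap (fst z) (snd z)) \<in> borel_measurable (distr P T D \<Otimes>\<^sub>M ?S\<mu>)"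
        using gap_meas unfolding law_F[symmetric] by (simp cong: measurable_cong_sets sets_pair_measure_cong)
      from S.nn_integral_fst[OF this] show ?thesis by simp
    qed
    \<comment> \<open>The outer integral returns from the law of D to P, because (A1) and (A2) are
      assumed for almost every \<omega>.\<close>
    also have "\<dots> = (\<integral>\<^sup>+\<omega>. \<integral>\<^sup>+F'. gap (D \<omega>) F' \<partial>?S\<mu> \<partial>P)"
    proof (rule nn_integral_distr[OF Dm])
      interpret S: prob_space ?S\<mu> by (rule prob_space_PiM) (rule \<mu>)
      have "(\<lambda>(d, F'). gap d F') \<in> borel_measurable (T \<Otimes>\<^sub>M ?S\<mu>)"
        using gap_meas unfolding law_F[symmetric] split_beta'
        by (simp cong: measurable_cong_sets sets_pair_measure_cong)
      then show "(\<lambda>d. \<integral>\<^sup>+F'. gap d F' \<partial>?S\<mu>) \<in> borel_measurable (distr P T D)"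
        using S.borel_measurable_nn_integral by simp
    qed
    also have "\<dots> \<le> (\<integral>\<^sup>+\<omega>. ennreal bound \<partial>P)"
    proof (rule nn_integral_mono_AE)
      have "AE \<omega> in P. D \<omega> \<in> space T" using measurable_space[OF Dm] by auto
      then show "AE \<omega> in P. (\<integral>\<^sup>+F'. gap (D \<omega>) F' \<partial>?S\<mu>) \<le> ennreal bound"
        using A1 A2 by eventually_elim (rule inner)
    qed
    also have "\<dots> = ennreal bound" by (simp add: P.emeasure_space_1)
    also have "\<dots> \<le> ennreal (C * (1 / real N powr (1 / 4) + sqrt (ln (real J)) / real J powr (1 / 2)))"
    proof (rule ennreal_leI)
      let ?k = "max 1 (1 / sqrt (ln 2))" and ?t = "1 / real N powr (1 / 4)" and ?s = "1 / real J powr (1 / 2)"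
      \<comment> \<open>As J \<ge> 2, the factor sqrt (ln J) is bounded below by sqrt (ln 2); the
        second factor of C pays for its insertion next to J^(-1/2).\<close>
      have "sqrt (ln 2) \<le> sqrt (ln (real J))" using J by simp
      moreover have l2: "sqrt (ln (2::real)) > 0" by simp
      ultimately have "1 \<le> 1 / sqrt (ln 2) * sqrt (ln (real J))" by (simp add: field_simps)
      also have "\<dots> \<le> ?k * sqrt (ln (real J))" using J by (intro mult_right_mono) auto
      finally have "1 * ?s \<le> (?k * sqrt (ln (real J))) * ?s" by (intro mult_right_mono) auto
      moreover have "1 * ?t \<le> ?k * ?t" by (intro mult_right_mono) auto
      ultimately have "?t + ?s \<le> ?k * (?t + sqrt (ln (real J)) / real J powr (1 / 2))"
        by (simp add: distrib_left)
      then have "C0 * (?t + ?s) \<le> C0 * (?k * (?t + sqrt (ln (real J)) / real J powr (1 / 2)))"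
        using C0 by (rule mult_left_mono)
      then show "bound \<le> C * (?t + sqrt (ln (real J)) / real J powr (1 / 2))"
        by (simp only: bound_def C_def mult.assoc)
    qed
    finally show "generalization_gap P \<mu> \<alpha> \<epsilon> N J G (\<lambda>\<omega>. \<N> (D \<omega>)) F
        \<le> ennreal (C * (1 / real N powr (1 / 4) + sqrt (ln (real J)) / real J powr (1 / 2)))" .
  qed
qed

end
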